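(* Let $n\ge 2$ be an even integer, $k=n/2$, $\beta\in[0,1)$, and let $w$ be either of the two weights $w_0(x)=\left(\ln\frac{1}{|x|}\right)^{\frac{\beta n}{2}}$ or $w_1(x)=\left(\ln\frac{\mathrm{e}}{|x|}\right)^{\frac{\beta n}{2}}$ on the unit ball $B\subset\mathbb{R}^n$. Set $\gamma_{n,\beta}=\frac{n+2}{n(1-\beta)}$ and $\alpha_{n,\beta}=n\left[c_n^{\frac{2}{n}}(1-\beta)\right]^{\frac{1}{1-\beta}}$. (a) For $\gamma>0$: $\int_B \mathrm{e}^{|u|^{\gamma}}\,\mathrm{d}x<\infty$ for every $u\in\Phi^{k}_{0,\mathrm{rad}}(B,w)$ if and only if $\gamma\le\gamma_{n,\beta}$. (b) Let $\Sigma=\{u\in\Phi^{k}_{0,\mathrm{rad}}(B,w): \|u\|_{\Phi,w}\le 1\}$. Then, for $\alpha\in\mathbb{R}$, $$\sup_{u\in\Sigma}\int_B \mathrm{e}^{\alpha|u|^{\gamma_{n,\beta}}}\,\mathrm{d}x<\infty \iff \alpha\le\alpha_{n,\beta}.$$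
   Context: $B$ is the open unit ball of $\mathbb{R}^n$ centered at $0$, $\omega_{n-1}$ is the area of the unit sphere in $\mathbb{R}^n$, and $c_n=\frac{\omega_{n-1}}{k}\binom{n-1}{k-1}$. For $u\in C^2(B)$, $S_j(D^2u)$ is the sum of all $j\times j$ principal minors of the Hessian matrix $D^2u$. A function $u\in C^2(B)\cap C^0(\overline{B})$ is $k$-admissible if $S_j(D^2u)\ge0$ in $B$ for $j=1,\dots,k$. $\Phi^k_{0,\mathrm{rad}}(B)$ is the set of radially symmetric $k$-admissible functions on $B$ vanishing on $\partial B$. For a positive radial weight $w(x)=w(r)$ and a radial function $u(x)=v(r)$, $r=|x|$, set $$\|u\|_{\Phi,w}=\Big(c_n\int_0^1 r^{n-k}|v'(r)|^{k+1}w(r)\,\mathrm{d}r\Big)^{\frac{1}{k+1}}.$$ $\Phi^k_{0,\mathrm{rad}}(B,w)$ is the closure, with respect to $\|\cdot\|_{\Phi,w}$, of $\{u\in\Phi^k_{0,\mathrm{rad}}(B):\|u\|_{\Phi,w}<\infty\}$; its elements are identified with radial functions $u(x)=v(|x|)$, $v$ locally absolutely continuous on $(0,1)$ with $v(r)\to0$ as $r\to1$, that are limits of sequences in this set in the sense that $\|u_m-u\|_{\Phi,w}\to0$ (norm given by the same formula). *)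

theory Defs
  imports "HOL-Analysis.Analysis"
begin

text \<open>
  The Euclidean space of dimension \<open>n\<close> is \<open>real ^ 'n\<close> with \<open>n = CARD('n)\<close>, and the ball \<open>B\<close> is
  \<open>ball 0 1\<close>. Functions on the ball or its closure are total functions \<open>real ^ 'n \<Rightarrow> real\<close>; no
  definition below depends on their values elsewhere.
\<close>


subsection \<open>The Hessian and its symmetric invariants\<close>

definition partial_deriv :: "'n \<Rightarrow> (real ^ 'n \<Rightarrow> real) \<Rightarrow> real ^ 'n \<Rightarrow> real" where
  "partial_deriv i u x = frechet_derivative u (at x) (axis i 1)"

definition hessian :: "(real ^ 'n \<Rightarrow> real) \<Rightarrow> real ^ 'n \<Rightarrow> real ^ 'n ^ 'n" where
  "hessian u x = (\<chi> i j. partial_deriv i (partial_deriv j u) x)"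

text \<open>Meant for open \<open>S\<close> only, since \<^const>\<open>partial_deriv\<close> uses the full filter \<open>at x\<close>.\<close>

definition C2_on :: "(real ^ 'n) set \<Rightarrow> (real ^ 'n \<Rightarrow> real) \<Rightarrow> bool" where
  "C2_on S u \<longleftrightarrow>
     u differentiable_on S \<and>
     (\<forall>j. partial_deriv j u differentiable_on S) \<and>
     (\<forall>i j. continuous_on S (partial_deriv i (partial_deriv j u)))"

text \<open>
  The Leibniz formula for the determinant of the submatrix of \<open>A\<close> with rows and columns in \<open>I\<close>.
\<close>

definition principal_minor :: "'n::finite set \<Rightarrow> real ^ 'n ^ 'n \<Rightarrow> real" where
  "principal_minor I A =
     (\<Sum>p | p permutes I. of_int (sign p) * (\<Prod>i\<in>I. A $ i $ p i))"

lemma principal_minor_UNIV: "principal_minor UNIV A = det A"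
  by (simp add: principal_minor_def det_def)

lemma principal_minor_singleton: "principal_minor {i} A = A $ i $ i"
  by (simp add: principal_minor_def)

definition S_minors :: "nat \<Rightarrow> real ^ 'n ^ 'n \<Rightarrow> real" where
  "S_minors j A = (\<Sum>I | I \<subseteq> (UNIV :: 'n::finite set) \<and> card I = j. principal_minor I A)"

definition admissible :: "nat \<Rightarrow> (real ^ 'n \<Rightarrow> real) \<Rightarrow> bool" where
  "admissible k u \<longleftrightarrow>
     C2_on (ball 0 1) u \<and> continuous_on (cball 0 1) u \<and>
     (\<forall>j\<in>{1..k}. \<forall>x\<in>ball 0 1. S_minors j (hessian u x) \<ge> 0)"


subsection \<open>Radial functions\<close>

definition radial_on :: "(real ^ 'n) set \<Rightarrow> (real ^ 'n \<Rightarrow> real) \<Rightarrow> bool" where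
  "radial_on S u \<longleftrightarrow> (\<forall>x\<in>S. \<forall>y\<in>S. norm x = norm y \<longrightarrow> u x = u y)"

text \<open>The function \<open>v\<close> with \<open>u x = v (norm x)\<close>, for a radial \<open>u\<close>.\<close>

definition radial_profile :: "(real ^ 'n \<Rightarrow> real) \<Rightarrow> real \<Rightarrow> real" where
  "radial_profile u r = u (SOME x. norm x = r)"

lemma radial_profile_norm:
  fixes u :: "real ^ 'n \<Rightarrow> real"
  assumes "radial_on (ball 0 \<rho>) u" and "x \<in> ball 0 \<rho>"
  shows "radial_profile u (norm x) = u x"
proof -
  have *: "norm (SOME y::real^'n. norm y = norm x) = norm x"
    using someI_ex[of "\<lambda>y::real^'n. norm y = norm x"] by blast
  then have "(SOME y::real^'n. norm y = norm x) \<in> ball 0 \<rho>"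
    using assms(2) by simp
  with * assms show ?thesis
    unfolding radial_profile_def radial_on_def by blast
qed

definition Phi0_rad :: "nat \<Rightarrow> (real ^ 'n \<Rightarrow> real) set" where
  "Phi0_rad k =
     {u. admissible k u \<and> radial_on (cball 0 1) u \<and> (\<forall>x\<in>sphere 0 1. u x = 0)}"


subsection \<open>The weighted norm\<close>

text \<open>
  Surface measure on the unit sphere, as it arises from polar coordinates: \<open>n\<close> times the volume of
  the cone over the set with apex at the origin.
\<close>

definition sphere_measure :: "(real ^ 'n) set \<Rightarrow> real" where
  "sphere_measure E =
     real CARD('n) * measure lebesgue {t *\<^sub>R x |t x. 0 < t \<and> t \<le> 1 \<and> x \<in> E}"

definition sphere_area :: "'n::finite itself \<Rightarrow> real" where
  "sphere_area _ = sphere_measure (sphere (0 :: real ^ 'n) 1)"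

lemma sphere_area_eq: "sphere_area TYPE('n::finite) = real CARD('n) * unit_ball_vol CARD('n)"
proof -
  have *: "{t *\<^sub>R x |t x. 0 < t \<and> t \<le> 1 \<and> x \<in> sphere (0::real^'n) 1} = cball 0 1 - {0}"
  proof (intro equalityI subsetI)
    fix y :: "real ^ 'n"
    assume "y \<in> cball 0 1 - {0}"
    then have "y = norm y *\<^sub>R sgn y" "0 < norm y" "norm y \<le> 1" "sgn y \<in> sphere 0 1"
      by (simp_all add: sgn_div_norm)
    then show "y \<in> {t *\<^sub>R x |t x. 0 < t \<and> t \<le> 1 \<and> x \<in> sphere 0 1}"
      by (intro CollectI exI[of _ "norm y"] exI[of _ "sgn y"] conjI)
  next
    fix y :: "real ^ 'n"
    assume "y \<in> {t *\<^sub>R x |t x. 0 < t \<and> t \<le> 1 \<and> x \<in> sphere 0 1}"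
    then obtain t x where y: "y = t *\<^sub>R x" and t: "0 < t" "t \<le> 1" and x: "norm x = 1" by auto
    then have "norm y = t" by simp
    with t show "y \<in> cball 0 1 - {0}" by auto
  qed
  have "measure lebesgue (cball (0::real^'n) 1 - {0}) = measure lebesgue (cball (0::real^'n) 1)"
    by (rule measure_Diff_null_set) (simp_all add: null_sets_def)
  also have "\<dots> = unit_ball_vol CARD('n)"
    by (simp add: content_cball)
  finally show ?thesis
    unfolding sphere_area_def sphere_measure_def * by simp
qed

definition norm_const :: "'n::finite itself \<Rightarrow> nat \<Rightarrow> real" where
  "norm_const T k = sphere_area T / real k * real ((CARD('n) - 1) choose (k - 1))"

text \<open>
  A radial weight is given by its profile \<open>w\<close> on \<open>{0<..<1}\<close>. The norm is extended-real-valued, so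
  that functions of infinite norm are not confused with functions of norm zero.
\<close>

definition Phi_norm :: "nat \<Rightarrow> (real \<Rightarrow> real) \<Rightarrow> (real ^ 'n \<Rightarrow> real) \<Rightarrow> ennreal" where
  "Phi_norm k w u =
     (let E = ennreal (norm_const TYPE('n) k) *
            (\<integral>\<^sup>+r\<in>{0<..<1}. ennreal (r ^ (CARD('n) - k) *
               \<bar>deriv (radial_profile u) r\<bar> ^ (k + 1) * w r) \<partial>lborel)
      in if E = \<infinity> then \<infinity> else ennreal (enn2real E powr (1 / real (k + 1))))"


subsection \<open>The weighted space\<close>

definition abs_continuous_on :: "real \<Rightarrow> real \<Rightarrow> (real \<Rightarrow> real) \<Rightarrow> bool" where
  "abs_continuous_on a b f \<longleftrightarrow>
     (\<forall>\<epsilon>>0. \<exists>\<delta>>0. \<forall>D. D division_of \<Union>D \<and> \<Union>D \<subseteq> {a..b} \<and> (\<Sum>K\<in>D. Sup K - Inf K) < \<delta>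
        \<longrightarrow> (\<Sum>K\<in>D. \<bar>f (Sup K) - f (Inf K)\<bar>) < \<epsilon>)"

definition locally_abs_continuous :: "(real \<Rightarrow> real) \<Rightarrow> bool" where
  "locally_abs_continuous f \<longleftrightarrow> (\<forall>a b. 0 < a \<and> a \<le> b \<and> b < 1 \<longrightarrow> abs_continuous_on a b f)"

text \<open>
  Elements may be unbounded at the origin; the value \<open>u 0\<close> is then arbitrary and plays no role.
\<close>

definition Phi0_rad_weighted :: "nat \<Rightarrow> (real \<Rightarrow> real) \<Rightarrow> (real ^ 'n \<Rightarrow> real) set" where
  "Phi0_rad_weighted k w =
     {u. radial_on (ball 0 1) u \<and>
         locally_abs_continuous (radial_profile u) \<and>
         (radial_profile u \<longlongrightarrow> 0) (at_left 1) \<and>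
         (\<exists>U. (\<forall>m::nat. U m \<in> Phi0_rad k \<and> Phi_norm k w (U m) < \<infinity>) \<and>
              (\<lambda>m. Phi_norm k w (\<lambda>x. U m x - u x)) \<longlonglongrightarrow> 0)}"

definition weight0 :: "nat \<Rightarrow> real \<Rightarrow> real \<Rightarrow> real" where
  "weight0 n \<beta> r = ln (1 / r) powr (\<beta> * real n / 2)"

definition weight1 :: "nat \<Rightarrow> real \<Rightarrow> real \<Rightarrow> real" where
  "weight1 n \<beta> r = ln (exp 1 / r) powr (\<beta> * real n / 2)"

end

(*
  In the variable t = ln (1/r) a radial function becomes phi(t), and with p = k + 1 the norm is
  (c_n int |phi'|^p w dt)^(1/p), w being t^(beta k) or (1+t)^(beta k); moreover
  int_B exp(alpha |u|^gamma) dx is comparable to int exp(alpha |phi|^gamma - n t) dt. Hoelder gives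
  alpha_(n,beta) |phi(t)|^(gamma_(n,beta)) <= n t on the unit ball of the norm, and Moser's argument
  shows that the set where the defect F of this inequality is at most L has measure O(L), whence
  int exp(-F) dt is bounded. Only the absolute continuity of u is used here, not its being a limit
  of admissible functions, so that finiteness in (a) follows by applying the bound to the small
  difference of u and a bounded admissible function.

  As k = n/2, a radial u is k-admissible precisely when -phi is nonnegative, increasing and concave
  in t. Hence 1 - (1 + t)^theta and its truncations, obtained by composing with a smooth concave
  cut-off of t, serve as counterexamples beyond the critical values. Since w_0 <= w_1, the upper
  bounds are needed for w_0 and the counterexamples for w_1 only.

  The definition of the norm forces one to know that an absolutely continuous function is
  differentiable almost everywhere: deriv has junk values elsewhere.
*)

theory Submission
  imports Defs "HOL-Real_Asymp.Real_Asymp"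
begin


section \<open>Absolutely continuous functions on the line\<close>

text \<open>The weight disappears in T = t powr (1 - \<beta>): by Hoelder's inequality an increment
  of the profile costs energy and an increment of T, each to a fixed power, exactly as without
  weight. Because \<beta> < 1, t powr (- \<beta>) is integrable at t = 0, the boundary of the ball,
  where w_0 vanishes; this is how the boundary value 0 controls the profile. The level sets of the
  defect are counted rather than measured: F is replaced by its infimum over each unit interval of
  t, and the integral over the ball is compared with a series over shells. The counterexamples must
  be twice continuously differentiable on the whole ball, which excludes a minimum of t and a
  constant. The cut-off ln ((1 + \<epsilon>) / (s + \<epsilon>)) / 2 in s = |x|^2 is smooth, has
  slope at most 1 in t, and lets the energy be integrated in closed form once the weight is
  majorised. Part (b) takes the power \<theta> = 1 - \<beta>, whose energy grows with the height of
  the truncation and is normalised away; part (a) takes a smaller \<theta>, for which the energy is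
  finite without truncation.\<close>

lemma sum_division_telescope:
  fixes f :: "real \<Rightarrow> real"
  assumes "D division_of {a..b}" "a \<le> b"
  shows "(\<Sum>K\<in>D. f (Sup K) - f (Inf K)) = f b - f a"
proof -
  let ?f = "(\<lambda>K::real set. if K = {} then 0 else f (interval_upperbound K) - f (interval_lowerbound K))"
  interpret operative_real plus 0 ?f
    rewrites "comm_monoid_set.F (+) 0 = sum"
    by standard[1] (auto simp add: sum_def)
  have "sum ?f D = ?f (cbox a b)"
    using division[of D a b] assms by simp
  moreover have "sum ?f D = (\<Sum>K\<in>D. f (Sup K) - f (Inf K))"
  proof (rule sum.cong[OF refl])
    fix K assume "K \<in> D"
    then obtain c d where "K = cbox c d" "K \<noteq> {}" using division_ofD[OF assms(1)] by metis
    then show "?f K = f (Sup K) - f (Inf K)" by auto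
  qed
  ultimately show ?thesis using assms(2) by auto
qed

text \<open>Inside each interval of \<open>D1\<close> the pieces taken from \<open>D2\<close> are
  completed to a division; \<open>G\<close> collects what was added. The quantifier over
  \<open>f\<close> stands in the conclusion because the same \<open>G\<close> is used for the
  increments of a function and, with the identity, for lengths.\<close>

lemma refine_division_disjoint:
  fixes D1 D2 :: "real set set"
  assumes D1: "D1 division_of \<Union>D1" and disj: "pairwise disjnt D1"
    and D2: "D2 division_of \<Union>D2" and sub: "\<And>K'. K' \<in> D2 \<Longrightarrow> \<exists>K\<in>D1. K' \<subseteq> K"
  obtains G where "G division_of \<Union>G" "\<Union>G \<subseteq> \<Union>D1"
    "\<forall>f::real\<Rightarrow>real. (\<Sum>K\<in>D1. f (Sup K) - f (Inf K)) =
      (\<Sum>K\<in>D2. f (Sup K) - f (Inf K)) + (\<Sum>K\<in>G. f (Sup K) - f (Inf K))"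
proof -
  note d1 = division_ofD[OF D1] and d2 = division_ofD[OF D2]
  have "\<exists>r. {K'\<in>D2. K' \<subseteq> K} \<subseteq> r \<and> r division_of K" if "K \<in> D1" for K
  proof -
    obtain c d where K: "K = cbox c d" using d1(4) \<open>K \<in> D1\<close> by blast
    have "{K'\<in>D2. K' \<subseteq> K} division_of \<Union>{K'\<in>D2. K' \<subseteq> K}"
      by (rule division_of_subset[OF D2]) auto
    moreover have "\<Union>{K'\<in>D2. K' \<subseteq> K} \<subseteq> cbox c d" using K by auto
    ultimately show ?thesis using partial_division_extend_interval K by metis
  qed
  then obtain r where r: "\<And>K. K \<in> D1 \<Longrightarrow> {K'\<in>D2. K' \<subseteq> K} \<subseteq> r K"
     "\<And>K. K \<in> D1 \<Longrightarrow> r K division_of K" by metis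
  have rsub: "K' \<subseteq> K" "K' \<noteq> {}" if "K \<in> D1" "K' \<in> r K" for K K'
    using division_ofD[OF r(2)[OF that(1)]] that by auto
  define R where "R = (\<Union>K\<in>D1. r K)"
  have fin: "finite (r K)" if "K \<in> D1" for K using r(2)[OF that] by auto
  have Rdiv: "R division_of \<Union>D1"
  proof (rule division_ofI)
    show "finite R" unfolding R_def using d1(1) fin by blast
    show "K' \<subseteq> \<Union>D1" "K' \<noteq> {}" "\<exists>a b. K' = cbox a b" if "K' \<in> R" for K'
      using that rsub division_ofD(4)[OF r(2)] unfolding R_def by blast+
    show "\<Union>R = \<Union>D1" 
    proof -
      have "\<Union>R = (\<Union>K\<in>D1. \<Union>(r K))" unfolding R_def by blast
      also have "\<dots> = \<Union>D1" using division_ofD(6)[OF r(2)] by simp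
      finally show ?thesis .
    qed
    fix A B assume AB: "A \<in> R" "B \<in> R" "A \<noteq> B"
    then obtain K L where KL: "K \<in> D1" "A \<in> r K" "L \<in> D1" "B \<in> r L" unfolding R_def by auto
    show "interior A \<inter> interior B = {}"
    proof (cases "K = L")
      case True then show ?thesis using division_ofD(5)[OF r(2)] KL AB by metis
    next
      case False
      then have "K \<inter> L = {}" using disj KL by (auto simp: pairwise_def disjnt_def)
      then have "A \<inter> B = {}" using rsub KL by blast
      then show ?thesis using interior_subset by blast
    qed
  qed
  have D2R: "D2 \<subseteq> R"
    using sub r(1) unfolding R_def by blast
  define G where "G = R - D2"
  have Rsum: "(\<Sum>K\<in>D1. f (Sup K) - f (Inf K)) = (\<Sum>K\<in>R. f (Sup K) - f (Inf K))" for f :: "real \<Rightarrow> real"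
  proof -
    have "(\<Sum>K\<in>R. f (Sup K) - f (Inf K)) = (\<Sum>K\<in>D1. \<Sum>K'\<in>r K. f (Sup K') - f (Inf K'))"
      unfolding R_def
    proof (rule sum.UNION_disjoint)
      show "\<forall>K\<in>D1. \<forall>L\<in>D1. K \<noteq> L \<longrightarrow> r K \<inter> r L = {}"
      proof (intro ballI impI, rule ccontr)
        fix K L assume KL: "K \<in> D1" "L \<in> D1" "K \<noteq> L" "r K \<inter> r L \<noteq> {}"
        then obtain A where A: "A \<in> r K" "A \<in> r L" by blast
        have "A \<subseteq> K" "A \<subseteq> L" "A \<noteq> {}" using rsub[OF KL(1) A(1)] rsub[OF KL(2) A(2)] by auto
        moreover have "K \<inter> L = {}" using disj KL by (auto simp: pairwise_def disjnt_def)
        ultimately show False by blast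
      qed
    qed (use d1(1) fin in auto)
    also have "\<dots> = (\<Sum>K\<in>D1. f (Sup K) - f (Inf K))"
    proof (rule sum.cong[OF refl])
      fix K assume "K \<in> D1"
      then obtain c d where K: "K = {c..d}" "c \<le> d" using d1(3,4)[OF \<open>K\<in>D1\<close>] by fastforce
      then show "(\<Sum>K'\<in>r K. f (Sup K') - f (Inf K')) = f (Sup K) - f (Inf K)"
        using sum_division_telescope[of "r K" c d f] r(2)[OF \<open>K\<in>D1\<close>] by simp
    qed
    finally show ?thesis by simp
  qed
  show thesis
  proof
    show "G division_of \<Union>G"
      unfolding G_def by (rule division_of_subset[OF Rdiv[THEN division_of_union_self]]) auto
    show "\<Union>G \<subseteq> \<Union>D1" unfolding G_def using division_ofD(6)[OF Rdiv] by blast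
    have "finite R" using Rdiv by auto
    then show "\<forall>f::real\<Rightarrow>real. (\<Sum>K\<in>D1. f (Sup K) - f (Inf K)) =
      (\<Sum>K\<in>D2. f (Sup K) - f (Inf K)) + (\<Sum>K\<in>G. f (Sup K) - f (Inf K))"
      unfolding Rsum G_def by (intro allI, subst sum.subset_diff[OF D2R]) (simp_all add: add.commute)
  qed
qed

text \<open>Vitali's theorem gives countably many disjoint intervals that cover \<open>S\<close> up
  to a null set. They all lie in the bounded set \<open>U\<close>, so finitely many of them carry
  the measure of the union up to \<epsilon>; \<open>W\<close> consists of the tail and the null
  set.\<close>

lemma Vitali_intervals_finite:
  fixes S U :: "real set"
  assumes U: "open U" "bounded U" "S \<subseteq> U" and "0 < \<epsilon>"
    and cov: "\<And>x d. x \<in> S \<Longrightarrow> 0 < d \<Longrightarrow> \<exists>c e. c < e \<and> e - c < d \<and> c \<le> x \<and> x \<le> e \<and> P c e"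
  obtains D W where "D division_of \<Union>D" "pairwise disjnt D"
    "\<forall>K\<in>D. \<exists>c e. c < e \<and> K = {c..e} \<and> {c..e} \<subseteq> U \<and> P c e"
    "W \<in> lmeasurable" "measure lebesgue W < \<epsilon>" "S \<subseteq> \<Union>D \<union> W"
proof -
  define I where "I = {(c,e). c < e \<and> {c..e} \<subseteq> U \<and> P c e}"
  \<comment> \<open>The covering theorem speaks of balls, so an interval is coded by its midpoint
    and half its length.\<close>
  have cb: "cball ((fst i + snd i)/2) ((snd i - fst i)/2) = {fst i..snd i}" if "fst i < snd i" for i :: "real \<times> real"
    using that by (auto simp: cball_def dist_real_def abs_if field_simps split: if_splits)
  obtain C where C: "countable C" "C \<subseteq> I"
     "pairwise (\<lambda>i j. disjnt (cball ((fst i + snd i)/2) ((snd i - fst i)/2)) (cball ((fst j + snd j)/2) ((snd j - fst j)/2))) C"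
     "negligible (S - (\<Union>i \<in> C. cball ((fst i + snd i)/2) ((snd i - fst i)/2)))"
  proof (rule Vitali_covering_theorem_cballs[of I "\<lambda>i. (snd i - fst i)/2" S "\<lambda>i. (fst i + snd i)/2"])
    show "0 < (snd i - fst i)/2" if "i \<in> I" for i using that unfolding I_def by auto
    fix x d :: real assume x: "x \<in> S" "0 < d"
    then obtain \<eta> where \<eta>: "\<eta> > 0" "ball x \<eta> \<subseteq> U" using U open_contains_ball by blast
    then obtain c e where ce: "c < e" "e - c < min d \<eta>" "c \<le> x" "x \<le> e" "P c e"
      using cov[OF x(1), of "min d \<eta>"] x(2) by auto
    have "{c..e} \<subseteq> ball x \<eta>" using ce by (auto simp: dist_real_def)
    then have "(c,e) \<in> I" using ce \<eta> unfolding I_def by auto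
    moreover have "x \<in> cball ((fst (c,e) + snd (c,e))/2) ((snd (c,e) - fst (c,e))/2)"
      using ce by (subst cb) auto
    ultimately show "\<exists>i. i \<in> I \<and> x \<in> cball ((fst i + snd i)/2) ((snd i - fst i)/2) \<and> (snd i - fst i)/2 < d"
      using ce by (intro exI[of _ "(c,e)"]) auto
  qed
  have lt: "fst i < snd i" if "i \<in> C" for i using that C(2) unfolding I_def by auto
  define \<D> where "\<D> = (\<lambda>i. {fst i..snd i}) ` C"
  have neg: "negligible (S - \<Union>\<D>)"
    using C(4) lt unfolding \<D>_def by (simp add: cb)
  have dis: "pairwise disjnt \<D>"
    unfolding pairwise_def \<D>_def using C(3) lt by (auto simp: pairwise_def cb)
  have \<D>I: "\<exists>c e. c < e \<and> K = {c..e} \<and> {c..e} \<subseteq> U \<and> P c e" if "K \<in> \<D>" for K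
  proof -
    obtain i where "i \<in> C" "K = {fst i..snd i}" using \<open>K \<in> \<D>\<close> unfolding \<D>_def by blast
    moreover from \<open>i \<in> C\<close> have "i \<in> I" using C(2) by blast
    ultimately show ?thesis unfolding I_def by (intro exI[of _ "fst i"] exI[of _ "snd i"]) auto
  qed
  have count: "countable \<D>" unfolding \<D>_def using C(1) by simp
  have meas: "K \<in> lmeasurable" if "K \<in> \<D>" for K using \<D>I[OF that] by auto
  have Ul: "U \<in> lmeasurable" using U by (simp add: lmeasurable_open)
  obtain D where D: "D \<subseteq> \<D>" "finite D" "measure lebesgue (\<Union>\<D>) - \<epsilon> < measure lebesgue (\<Union>D)"
  proof (rule measure_countable_Union_approachable[OF count \<open>0 < \<epsilon>\<close> meas])
    show "measure lebesgue (\<Union>D') \<le> measure lebesgue U" if "D' \<subseteq> \<D>" "finite D'" for D'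
    proof (rule measure_mono_fmeasurable[OF _ _ Ul])
      show "\<Union>D' \<subseteq> U" using that \<D>I by blast
      show "\<Union>D' \<in> sets lebesgue" using that meas by (intro sets.finite_Union) (auto simp: fmeasurableD)
    qed
  qed
  have \<D>U: "\<Union>\<D> \<in> lmeasurable"
  proof (rule fmeasurableI2[OF Ul])
    show "\<Union>\<D> \<subseteq> U" using \<D>I by blast
    show "\<Union>\<D> \<in> sets lebesgue" using count meas by (intro sets.countable_Union) (auto simp: fmeasurableD)
  qed
  have DU: "\<Union>D \<in> lmeasurable" using D meas by (intro fmeasurable.finite_Union) auto
  show thesis
  proof
    show "pairwise disjnt D" using dis D(1) by (rule pairwise_subset)
    show "\<forall>K\<in>D. \<exists>c e. c < e \<and> K = {c..e} \<and> {c..e} \<subseteq> U \<and> P c e" using \<D>I D(1) by blast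
    show "D division_of \<Union>D"
    proof (rule division_ofI)
      show "interior A \<inter> interior B = {}" if "A \<in> D" "B \<in> D" "A \<noteq> B" for A B
        using that \<open>pairwise disjnt D\<close> interior_subset unfolding pairwise_def disjnt_def by blast
      show "\<exists>a b. K = cbox a b" if "K \<in> D" for K using \<D>I[of K] D(1) that by (metis box_real(2) subsetD)
      show "K \<noteq> {}" if "K \<in> D" for K using \<D>I[of K] D(1) that by fastforce
    qed (use D(2) in auto)
    let ?W = "(\<Union>\<D> - \<Union>D) \<union> (S - \<Union>\<D>)"
    show "S \<subseteq> \<Union>D \<union> ?W" by blast
    have d: "\<Union>\<D> - \<Union>D \<in> lmeasurable" using \<D>U DU by (rule fmeasurable.Diff)
    then show "?W \<in> lmeasurable" using neg negligible_imp_measurable by blast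
    have "measure lebesgue ?W \<le> measure lebesgue (\<Union>\<D> - \<Union>D) + measure lebesgue (S - \<Union>\<D>)"
      using d neg negligible_imp_measurable by (intro measure_Un_le) (auto simp: fmeasurableD)
    also have "\<dots> = measure lebesgue (\<Union>\<D>) - measure lebesgue (\<Union>D)"
      using neg \<D>U DU D(1) by (subst measurable_measure_Diff) (auto simp: negligible_imp_measure0 fmeasurableD)
    finally show "measure lebesgue ?W < \<epsilon>" using D(3) by simp
  qed
qed

lemma sum_length_division:
  assumes "D division_of (S::real set)"
  shows "(\<Sum>K\<in>D. Sup K - Inf K) = measure lebesgue S"
proof -
  have "(\<Sum>K\<in>D. Sup K - Inf K) = (\<Sum>K\<in>D. measure lebesgue K)"
  proof (rule sum.cong[OF refl])
    fix K assume "K \<in> D"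
    then obtain c d where "K = cbox c d" "K \<noteq> {}" using division_ofD[OF assms] by metis
    then show "Sup K - Inf K = measure lebesgue K" by auto
  qed
  then show ?thesis using content_division[OF assms] by (simp add: measure_completion)
qed

section \<open>Differentiability almost everywhere\<close>

definition slope :: "(real \<Rightarrow> real) \<Rightarrow> real \<Rightarrow> real \<Rightarrow> real" where
  "slope f x y = (f y - f x) / (y - x)"

lemma abs_continuous_onD:
  assumes "abs_continuous_on a b f" "0 < \<epsilon>"
  shows "\<exists>\<delta>>0. \<forall>D. D division_of \<Union>D \<and> \<Union>D \<subseteq> {a..b} \<and> (\<Sum>K\<in>D. Sup K - Inf K) < \<delta>
     \<longrightarrow> (\<Sum>K\<in>D. \<bar>f (Sup K) - f (Inf K)\<bar>) < \<epsilon>"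
  using assms by (simp add: abs_continuous_on_def)

lemma slope_interval:
  assumes "y \<noteq> x" "\<bar>y - x\<bar> < d"
  obtains c e where "c < e" "e - c < d" "c \<le> x" "x \<le> e" "(f e - f c) = slope f x y * (e - c)"
proof (cases "x < y")
  case True
  then show ?thesis using assms by (intro that[of x y]) (auto simp: slope_def)
next
  case False
  then show ?thesis using assms by (intro that[of y x]) (auto simp: slope_def field_simps)
qed

text \<open>The sets of bad points are not known to be measurable, so \<open>s\<close> is their
  outer measure, taken as an infimum over measurable supersets. The open sets that almost attain it
  stay inside (a,b), where absolute continuity can be applied.\<close>

lemma lebesgue_outer_cover:
  fixes S :: "real set"
  assumes "S \<subseteq> {a<..<b}"
  obtains s where "s \<ge> 0" "\<And>W. W \<in> lmeasurable \<Longrightarrow> S \<subseteq> W \<Longrightarrow> s \<le> measure lebesgue W"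
    "\<And>\<epsilon>. 0 < \<epsilon> \<Longrightarrow> \<exists>U. open U \<and> S \<subseteq> U \<and> U \<subseteq> {a<..<b} \<and> measure lebesgue U < s + \<epsilon>"
proof -
  let ?M = "measure lebesgue ` {W \<in> lmeasurable. S \<subseteq> W}"
  have ne: "?M \<noteq> {}" using assms by (auto intro!: exI[of _ "{a<..<b}"])
  have bd: "bdd_below ?M" by (rule bdd_belowI[of _ 0]) auto
  show thesis
  proof
    show "0 \<le> Inf ?M" using ne by (intro cInf_greatest) auto
    show "Inf ?M \<le> measure lebesgue W" if "W \<in> lmeasurable" "S \<subseteq> W" for W
      using that bd by (intro cInf_lower) auto
    fix \<epsilon> :: real assume "0 < \<epsilon>"
    then obtain W where W: "W \<in> lmeasurable" "S \<subseteq> W" "measure lebesgue W < Inf ?M + \<epsilon>/2"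
      using cInf_lessD[OF ne, of "Inf ?M + \<epsilon>/2"] by auto
    obtain T where T: "open T" "W \<subseteq> T" "T - W \<in> lmeasurable" "emeasure lebesgue (T - W) < ennreal (\<epsilon>/2)"
      using sets_lebesgue_outer_open[OF fmeasurableD[OF W(1)], of "\<epsilon>/2"] \<open>0 < \<epsilon>\<close> by auto
    have TW: "measure lebesgue (T - W) < \<epsilon>/2"
      using T \<open>0 < \<epsilon>\<close> by (simp add: emeasure_eq_measure2 ennreal_less_iff)
    have Tm: "T = W \<union> (T - W)" using T by blast
    then have Tl: "T \<in> lmeasurable" using W T(3) fmeasurable.Un by metis
    have "measure lebesgue T \<le> measure lebesgue W + measure lebesgue (T - W)"
      using Tm measure_Un_le[of W lebesgue "T - W"] W(1) T(3) by (metis fmeasurableD)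
    moreover have "measure lebesgue (T \<inter> {a<..<b}) \<le> measure lebesgue T"
      using Tl T(1) by (intro measure_mono_fmeasurable) auto
    ultimately have "measure lebesgue (T \<inter> {a<..<b}) < Inf ?M + \<epsilon>" using W(3) TW by linarith
    then show "\<exists>U. open U \<and> S \<subseteq> U \<and> U \<subseteq> {a<..<b} \<and> measure lebesgue U < Inf ?M + \<epsilon>"
      using T W assms by (intro exI[of _ "T \<inter> {a<..<b}"]) auto
  qed
qed

text \<open>
  Let \<open>s\<close> be the outer measure of the set. Vitali's theorem gives disjoint intervals \<open>D1\<close> of slope at
  most \<open>p\<close>, and inside them intervals \<open>D2\<close> of slope at least \<open>q\<close>, both of total length close to \<open>s\<close>.
  The gaps are short, so by absolute continuity the increments over \<open>D1\<close> and \<open>D2\<close> nearly agree: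
  \<open>q s \<le> p s\<close> up to a small error.
\<close>

lemma negligible_oscillating_slopes:
  assumes ac: "abs_continuous_on a b f" and pq: "p < q"
  shows "negligible {x \<in> {a<..<b}. (\<forall>d>0. \<exists>y. y \<noteq> x \<and> \<bar>y - x\<bar> < d \<and> slope f x y < p) \<and>
                              (\<forall>d>0. \<exists>y. y \<noteq> x \<and> \<bar>y - x\<bar> < d \<and> q < slope f x y)}"
    (is "negligible ?S")
proof -
  obtain s where s: "s \<ge> 0" "\<And>W. W \<in> lmeasurable \<Longrightarrow> ?S \<subseteq> W \<Longrightarrow> s \<le> measure lebesgue W"
    "\<And>\<epsilon>. 0 < \<epsilon> \<Longrightarrow> \<exists>U. open U \<and> ?S \<subseteq> U \<and> U \<subseteq> {a<..<b} \<and> measure lebesgue U < s + \<epsilon>"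
    by (rule lebesgue_outer_cover[of ?S a b]) auto
  have key: "(q - p) * s \<le> (2 * \<bar>q\<bar> + 2 * \<bar>p\<bar> + 1) * \<epsilon>" if "0 < \<epsilon>" for \<epsilon> :: real
  proof -
    obtain \<delta> where \<delta>: "\<delta> > 0" "\<forall>D. D division_of \<Union>D \<and> \<Union>D \<subseteq> {a..b} \<and> (\<Sum>K\<in>D. Sup K - Inf K) < \<delta>
       \<longrightarrow> (\<Sum>K\<in>D. \<bar>f (Sup K) - f (Inf K)\<bar>) < \<epsilon>"
      using abs_continuous_onD[OF ac \<open>0 < \<epsilon>\<close>] by blast
    \<comment> \<open>Three errors of size \<open>e\<close> add up: \<open>U\<close> exceeds
      \<open>s\<close> by one of them, and \<open>W1\<close> and \<open>W2\<close> may hide one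
      each. The gaps between \<open>D1\<close> and \<open>D2\<close> then have total length below 3
      e, hence below \<delta>.\<close>
    define e where "e = min \<epsilon> (\<delta>/3)"
    have e: "0 < e" "e \<le> \<epsilon>" "3 * e \<le> \<delta>" using \<delta>(1) that unfolding e_def by auto
    obtain U where U: "open U" "?S \<subseteq> U" "U \<subseteq> {a<..<b}" "measure lebesgue U < s + e" using s(3)[OF e(1)] by (elim exE conjE) (rule that)
    have bU: "bounded U" by (rule bounded_subset[OF _ U(3)]) auto
    have Ul: "U \<in> lmeasurable" using U bU by (simp add: lmeasurable_open)
    have cov1: "\<exists>c e. c < e \<and> e - c < d \<and> c \<le> x \<and> x \<le> e \<and> f e - f c \<le> p * (e - c)" if xS: "x \<in> ?S" and d0: "0 < d" for x d
    proof -
      obtain y where "y \<noteq> x" "\<bar>y - x\<bar> < d" "slope f x y < p" using xS d0 by blast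
      moreover then obtain c e where "c < e" "e - c < d" "c \<le> x" "x \<le> e" "(f e - f c) = slope f x y * (e - c)"
        using slope_interval by metis
      ultimately show ?thesis by (intro exI[of _ c] exI[of _ e]) auto
    qed
    have cov2: "\<exists>c e. c < e \<and> e - c < d \<and> c \<le> x \<and> x \<le> e \<and> q * (e - c) \<le> f e - f c" if xS: "x \<in> ?S" and d0: "0 < d" for x d
    proof -
      obtain y where "y \<noteq> x" "\<bar>y - x\<bar> < d" "q < slope f x y" using xS d0 by blast
      moreover then obtain c e where "c < e" "e - c < d" "c \<le> x" "x \<le> e" "(f e - f c) = slope f x y * (e - c)"
        using slope_interval by metis
      ultimately show ?thesis by (intro exI[of _ c] exI[of _ e]) auto
    qed
    obtain D1 W1 where D1: "D1 division_of \<Union>D1" "pairwise disjnt D1"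
      "\<forall>K\<in>D1. \<exists>c e. c < e \<and> K = {c..e} \<and> {c..e} \<subseteq> U \<and> f e - f c \<le> p * (e - c)"
      and W1: "W1 \<in> lmeasurable" "measure lebesgue W1 < e" "?S \<subseteq> \<Union>D1 \<union> W1"
      by (rule Vitali_intervals_finite[OF U(1) bU U(2) e(1) cov1])
    \<comment> \<open>The second cover is sought inside the interiors of the intervals of
      \<open>D1\<close>, so that each interval of \<open>D2\<close> falls into a single one of them;
      only finitely many endpoints are lost.\<close>
    define V where "V = (\<Union>K\<in>D1. interior K)"
    have V: "open V" "V \<subseteq> \<Union>D1" unfolding V_def using interior_subset by auto
    have D1U: "\<Union>D1 \<subseteq> U" using D1(3) by blast
    have bV: "bounded V" by (rule bounded_subset[OF bU]) (use V(2) D1U in blast)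
    obtain D2 W2 where D2: "D2 division_of \<Union>D2" "pairwise disjnt D2"
      "\<forall>K\<in>D2. \<exists>c e. c < e \<and> K = {c..e} \<and> {c..e} \<subseteq> V \<and> q * (e - c) \<le> f e - f c"
      and W2: "W2 \<in> lmeasurable" "measure lebesgue W2 < e" "?S \<inter> V \<subseteq> \<Union>D2 \<union> W2"
    proof (rule Vitali_intervals_finite[OF V(1) bV _ e(1)])
      show "\<exists>c e. c < e \<and> e - c < d \<and> c \<le> x \<and> x \<le> e \<and> q * (e - c) \<le> f e - f c" if "x \<in> ?S \<inter> V" "0 < d" for x d
        using that cov2 by blast
    qed (use that in auto)
    have sub: "\<exists>K\<in>D1. K' \<subseteq> K" if "K' \<in> D2" for K'
    proof -
      obtain c e where ce: "c < e" "K' = {c..e}" "{c..e} \<subseteq> V" using D2(3) \<open>K' \<in> D2\<close> by blast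
      then obtain K where K: "K \<in> D1" "c \<in> interior K" unfolding V_def by force
      \<comment> \<open>\<open>K'\<close> is connected and covered by pairwise disjoint open
        interiors, so it meets only one of them.\<close>
      have "interior K \<inter> K' = {} \<or> \<Union>((\<lambda>K. interior K) ` (D1 - {K})) \<inter> K' = {}"
      proof (rule connectedD)
        show "connected K'" using ce by simp
        show "open (\<Union>((\<lambda>K. interior K) ` (D1 - {K})))" by blast
        show "interior K \<inter> \<Union> (interior ` (D1 - {K})) \<inter> K' = {}"
          using division_ofD(5)[OF D1(1)] K(1) by blast
        show "K' \<subseteq> interior K \<union> \<Union> (interior ` (D1 - {K}))" using ce unfolding V_def by blast
      qed auto
      moreover have "K' \<inter> interior K \<noteq> {}" using ce K by auto
      ultimately have "K' \<subseteq> interior K" using ce unfolding V_def by blast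
      then show ?thesis using K interior_subset by blast
    qed
    obtain G where G: "G division_of \<Union>G" "\<Union>G \<subseteq> \<Union>D1"
      "\<forall>f::real\<Rightarrow>real. (\<Sum>K\<in>D1. f (Sup K) - f (Inf K)) =
        (\<Sum>K\<in>D2. f (Sup K) - f (Inf K)) + (\<Sum>K\<in>G. f (Sup K) - f (Inf K))"
      by (rule refine_division_disjoint[OF D1(1,2) D2(1) sub])
    define m1 m2 where "m1 = measure lebesgue (\<Union>D1)" and "m2 = measure lebesgue (\<Union>D2)"
    have lm: "\<Union>D1 \<in> lmeasurable" "\<Union>D2 \<in> lmeasurable" using D1(1) D2(1) by (auto intro: lmeasurable_division)
    have m1: "m1 < s + e" using measure_mono_fmeasurable[OF D1U _ Ul] lm U(4) unfolding m1_def by (auto simp: fmeasurableD)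
    have negB: "negligible (\<Union>D1 - V)"
    proof -
      have "\<Union>D1 - V \<subseteq> (\<Union>K\<in>D1. frontier K)"
        unfolding V_def frontier_def using closure_subset by blast
      moreover have "negligible (\<Union>K\<in>D1. frontier K)"
        using D1(1) division_ofD(4)[OF D1(1)] by (intro negligible_Union) (auto intro!: negligible_convex_frontier)
      ultimately show ?thesis using negligible_subset by blast
    qed
    have m2: "s \<le> m2 + 2 * e"
    proof -
      have Bl: "\<Union>D1 - V \<in> lmeasurable" using negB negligible_imp_measurable by blast
      have "?S \<subseteq> \<Union>D2 \<union> (W2 \<union> (W1 \<union> (\<Union>D1 - V)))" using W1(3) W2(3) by blast
      then have "s \<le> measure lebesgue (\<Union>D2 \<union> (W2 \<union> (W1 \<union> (\<Union>D1 - V))))"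
        using lm W1 W2 Bl by (intro s(2)) auto
      also have "\<dots> \<le> m2 + measure lebesgue (W2 \<union> (W1 \<union> (\<Union>D1 - V)))"
        unfolding m2_def using lm W1 W2 Bl by (intro measure_Un_le) (auto intro!: sets.Un simp: fmeasurableD)
      also have "measure lebesgue (W2 \<union> (W1 \<union> (\<Union>D1 - V))) \<le> measure lebesgue W2 + measure lebesgue (W1 \<union> (\<Union>D1 - V))"
        using lm W1 W2 Bl by (intro measure_Un_le) (auto intro!: sets.Un simp: fmeasurableD)
      also have "measure lebesgue (W1 \<union> (\<Union>D1 - V)) \<le> measure lebesgue W1 + measure lebesgue (\<Union>D1 - V)"
        using lm W1 W2 Bl by (intro measure_Un_le) (auto intro!: sets.Un simp: fmeasurableD)
      finally show ?thesis using W1(2) W2(2) negligible_imp_measure0[OF negB] by linarith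
    qed
    have m1': "s \<le> m1 + e"
    proof -
      have "s \<le> measure lebesgue (\<Union>D1 \<union> W1)" using lm W1 by (intro s(2)) auto
      also have "\<dots> \<le> m1 + measure lebesgue W1" unfolding m1_def using lm W1 by (intro measure_Un_le) (auto simp: fmeasurableD)
      finally show ?thesis using W1(2) by linarith
    qed
    have len1: "(\<Sum>K\<in>D1. Sup K - Inf K) = m1" and len2: "(\<Sum>K\<in>D2. Sup K - Inf K) = m2"
      unfolding m1_def m2_def by (rule sum_length_division[OF D1(1)], rule sum_length_division[OF D2(1)])
    have lenG: "m1 = m2 + (\<Sum>K\<in>G. Sup K - Inf K)" using G(3)[rule_format, of "\<lambda>x. x"] len1 len2 by simp
    have "(\<Sum>K\<in>G. \<bar>f (Sup K) - f (Inf K)\<bar>) < \<epsilon>"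
    proof (intro \<delta>(2)[rule_format] conjI G(1))
      show "\<Union>G \<subseteq> {a..b}" using G(2) D1U U(3) by force
      show "(\<Sum>K\<in>G. Sup K - Inf K) < \<delta>" using lenG m1 m2 e by linarith
    qed
    then have G\<epsilon>: "(\<Sum>K\<in>G. f (Sup K) - f (Inf K)) > - \<epsilon>" 
      using sum_abs[of "\<lambda>K. f (Sup K) - f (Inf K)" G] by linarith
    have "(\<Sum>K\<in>D1. f (Sup K) - f (Inf K)) \<le> (\<Sum>K\<in>D1. p * (Sup K - Inf K))"
    proof (rule sum_mono)
      fix K assume "K \<in> D1"
      then obtain c e where "c < e" "K = {c..e}" "f e - f c \<le> p * (e - c)" using D1(3) by blast
      then show "f (Sup K) - f (Inf K) \<le> p * (Sup K - Inf K)" by simp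
    qed
    then have l1: "(\<Sum>K\<in>D1. f (Sup K) - f (Inf K)) \<le> p * m1" by (simp add: sum_distrib_left[symmetric] len1)
    have "(\<Sum>K\<in>D2. f (Sup K) - f (Inf K)) \<ge> (\<Sum>K\<in>D2. q * (Sup K - Inf K))"
    proof (rule sum_mono)
      fix K assume "K \<in> D2"
      then obtain c e where "c < e" "K = {c..e}" "q * (e - c) \<le> f e - f c" using D2(3) by blast
      then show "q * (Sup K - Inf K) \<le> f (Sup K) - f (Inf K)" by simp
    qed
    then have l2: "(\<Sum>K\<in>D2. f (Sup K) - f (Inf K)) \<ge> q * m2" by (simp add: sum_distrib_left[symmetric] len2)
    have A: "q * m2 - \<epsilon> \<le> p * m1" using l1 l2 G\<epsilon> G(3)[rule_format, of f] by linarith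
    have "m2 \<le> m1"
      unfolding m1_def m2_def using sub lm by (intro measure_mono_fmeasurable) (auto simp: fmeasurableD)
    then have "\<bar>m1 - s\<bar> \<le> 2 * \<epsilon>" "\<bar>m2 - s\<bar> \<le> 2 * \<epsilon>" using m1 m2 m1' e by linarith+
    then have "\<bar>p\<bar> * \<bar>m1 - s\<bar> \<le> \<bar>p\<bar> * (2 * \<epsilon>)" "\<bar>q\<bar> * \<bar>m2 - s\<bar> \<le> \<bar>q\<bar> * (2 * \<epsilon>)" by (intro mult_left_mono; simp)+
    then have "p * (m1 - s) \<le> \<bar>p\<bar> * (2 * \<epsilon>)" "- (q * (m2 - s)) \<le> \<bar>q\<bar> * (2 * \<epsilon>)"
      by (simp_all flip: abs_mult)
    then show ?thesis using A by (simp add: algebra_simps)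
  qed
  have "s = 0"
  proof (rule ccontr)
    assume "s \<noteq> 0"
    then have "s > 0" using s(1) by simp
    then have pos: "(q - p) * s > 0" using pq by simp
    define M where "M = 2 * \<bar>q\<bar> + 2 * \<bar>p\<bar> + 1"
    have "M > 0" unfolding M_def by linarith
    then show False using key[of "(q - p) * s / (2 * M)"] pos unfolding M_def[symmetric] by (simp add: field_simps)
  qed
  show ?thesis
    unfolding negligible_outer
  proof (intro allI impI)
    fix \<epsilon> :: real assume "\<epsilon> > 0"
    obtain U where U: "open U" "?S \<subseteq> U" "U \<subseteq> {a<..<b}" "measure lebesgue U < s + \<epsilon>"
      using s(3)[OF \<open>\<epsilon> > 0\<close>] by (elim exE conjE) (rule that)
    then have "U \<in> lmeasurable" using bounded_subset[of "{a<..<b}" U] by (intro lmeasurable_open) auto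
    then show "\<exists>T. ?S \<subseteq> T \<and> T \<in> lmeasurable \<and> measure lebesgue T < \<epsilon>" using U \<open>s = 0\<close> by (intro exI[of _ U]) simp
  qed
qed

text \<open>On intervals whose increments are at least 2/\<epsilon> times their lengths, absolute
  continuity turns the bound 1 on the total increment into the bound \<epsilon>/2 on the total
  length. Working in windows of length \<delta>/2 keeps disjoint intervals short enough in total for
  \<delta> to apply.\<close>

lemma negligible_unbounded_slopes:
  assumes ac: "abs_continuous_on a b f"
  shows "negligible {x \<in> {a<..<b}. \<forall>M. \<forall>d>0. \<exists>y. y \<noteq> x \<and> \<bar>y - x\<bar> < d \<and> M < \<bar>slope f x y\<bar>}"
    (is "negligible ?S")
proof -
  obtain \<delta> where \<delta>: "\<delta> > 0" "\<forall>D. D division_of \<Union>D \<and> \<Union>D \<subseteq> {a..b} \<and> (\<Sum>K\<in>D. Sup K - Inf K) < \<delta>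
     \<longrightarrow> (\<Sum>K\<in>D. \<bar>f (Sup K) - f (Inf K)\<bar>) < 1"
    using abs_continuous_onD[OF ac zero_less_one] by blast
  have small: "negligible (?S \<inter> {c<..<c + \<delta>/2})" for c
    unfolding negligible_outer
  proof (intro allI impI)
    fix \<epsilon> :: real assume "\<epsilon> > 0"
    define U where "U = {a<..<b} \<inter> {c<..<c + \<delta>/2}"
    have U: "open U" "bounded U" unfolding U_def by (auto intro: bounded_Int)
    obtain D W where D: "D division_of \<Union>D" "pairwise disjnt D"
      "\<forall>K\<in>D. \<exists>c e. c < e \<and> K = {c..e} \<and> {c..e} \<subseteq> U \<and> 2 / \<epsilon> * (e - c) \<le> \<bar>f e - f c\<bar>"
      and W: "W \<in> lmeasurable" "measure lebesgue W < \<epsilon> / 2" "?S \<inter> {c<..<c + \<delta>/2} \<subseteq> \<Union>D \<union> W"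
    proof (rule Vitali_intervals_finite[OF U, of "?S \<inter> {c<..<c + \<delta>/2}" "\<epsilon>/2"])
      show "?S \<inter> {c<..<c + \<delta>/2} \<subseteq> U" unfolding U_def by auto
      show "\<exists>c e. c < e \<and> e - c < d \<and> c \<le> x \<and> x \<le> e \<and> 2 / \<epsilon> * (e - c) \<le> \<bar>f e - f c\<bar>"
        if "x \<in> ?S \<inter> {c<..<c + \<delta>/2}" "0 < d" for x d
      proof -
        obtain y where y: "y \<noteq> x" "\<bar>y - x\<bar> < d" "2 / \<epsilon> < \<bar>slope f x y\<bar>" using \<open>x \<in> _\<close> \<open>0 < d\<close> by blast
        then obtain c e where ce: "c < e" "e - c < d" "c \<le> x" "x \<le> e" "(f e - f c) = slope f x y * (e - c)"
          using slope_interval by metis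
        then have "\<bar>f e - f c\<bar> = \<bar>slope f x y\<bar> * (e - c)" by (simp add: abs_mult)
        also have "\<dots> \<ge> 2 / \<epsilon> * (e - c)" using ce y by (intro mult_right_mono) auto
        finally show ?thesis using ce by (intro exI[of _ c] exI[of _ e]) simp
      qed
    qed (use \<open>\<epsilon> > 0\<close> in auto)
    have DU: "\<Union>D \<subseteq> U" using D(3) by blast
    have len: "(\<Sum>K\<in>D. Sup K - Inf K) = measure lebesgue (\<Union>D)" using sum_length_division[OF D(1)] .
    have Dl: "\<Union>D \<in> lmeasurable" using D(1) by (auto intro: lmeasurable_division)
    have "measure lebesgue (\<Union>D) \<le> measure lebesgue {c<..<c + \<delta>/2}"
      using DU Dl unfolding U_def by (intro measure_mono_fmeasurable) (auto simp: fmeasurableD)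
    then have "measure lebesgue (\<Union>D) < \<delta>" using \<delta>(1) by simp
    then have "(\<Sum>K\<in>D. \<bar>f (Sup K) - f (Inf K)\<bar>) < 1"
      using D(1) DU len unfolding U_def by (intro \<delta>(2)[rule_format] conjI) auto
    moreover have "(\<Sum>K\<in>D. 2 / \<epsilon> * (Sup K - Inf K)) \<le> (\<Sum>K\<in>D. \<bar>f (Sup K) - f (Inf K)\<bar>)"
    proof (rule sum_mono)
      fix K assume "K \<in> D"
      then obtain c e where "c < e" "K = {c..e}" "2 / \<epsilon> * (e - c) \<le> \<bar>f e - f c\<bar>" using D(3) by blast
      then show "2 / \<epsilon> * (Sup K - Inf K) \<le> \<bar>f (Sup K) - f (Inf K)\<bar>" by simp
    qed
    moreover have "(\<Sum>K\<in>D. 2 / \<epsilon> * (Sup K - Inf K)) = 2 / \<epsilon> * measure lebesgue (\<Union>D)"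
      unfolding len[symmetric] by (rule sum_distrib_left[symmetric])
    ultimately have "2 / \<epsilon> * measure lebesgue (\<Union>D) < 1" by linarith
    then have "measure lebesgue (\<Union>D) < \<epsilon> / 2" using \<open>\<epsilon> > 0\<close> by (simp add: field_simps)
    moreover have "measure lebesgue (\<Union>D \<union> W) \<le> measure lebesgue (\<Union>D) + measure lebesgue W"
      using Dl W by (intro measure_Un_le) (auto simp: fmeasurableD)
    ultimately show "\<exists>T. ?S \<inter> {c<..<c + \<delta>/2} \<subseteq> T \<and> T \<in> lmeasurable \<and> measure lebesgue T < \<epsilon>"
      using W Dl by (intro exI[of _ "\<Union>D \<union> W"]) auto
  qed
  \<comment> \<open>The windows start at all multiples of \<delta>/4, so neighbours overlap and the
    open windows miss no point.\<close>
  have "?S \<subseteq> (\<Union>i::int. ?S \<inter> {\<delta> / 4 * of_int i<..<\<delta> / 4 * of_int i + \<delta>/2})"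
  proof
    fix x assume x: "x \<in> ?S"
    define i where "i = \<lceil>4 * x / \<delta>\<rceil> - 1"
    have "of_int i < 4 * x / \<delta>" "4 * x / \<delta> \<le> of_int i + 1" unfolding i_def by linarith+
    then have "\<delta> / 4 * of_int i < x" "x < \<delta> / 4 * of_int i + \<delta>/2" using \<delta>(1) by (simp_all add: field_simps)
    then show "x \<in> (\<Union>i::int. ?S \<inter> {\<delta> / 4 * of_int i<..<\<delta> / 4 * of_int i + \<delta>/2})"
      by (intro UN_I[of i] IntI x) auto
  qed
  moreover have "negligible (\<Union>i::int. ?S \<inter> {\<delta> / 4 * of_int i<..<\<delta> / 4 * of_int i + \<delta>/2})"
    using small by (intro negligible_countable_Union) auto
  ultimately show ?thesis by (rule negligible_subset[rotated])
qed

text \<open>Off countably many of the preceding null sets the slopes at x stay bounded near x and do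
  not oscillate across any pair of rationals. Hence they converge in \<open>ereal\<close>, and
  boundedness makes the limit real.\<close>

lemma abs_continuous_on_differentiable_ae:
  assumes ac: "abs_continuous_on a b f"
  shows "negligible {x \<in> {a<..<b}. \<not> f field_differentiable (at x)}"
proof -
  let ?B = "{x \<in> {a<..<b}. \<forall>M. \<forall>d>0. \<exists>y. y \<noteq> x \<and> \<bar>y - x\<bar> < d \<and> M < \<bar>slope f x y\<bar>}"
  let ?O = "\<lambda>p q. {x \<in> {a<..<b}. (\<forall>d>0. \<exists>y. y \<noteq> x \<and> \<bar>y - x\<bar> < d \<and> slope f x y < p) \<and>
                              (\<forall>d>0. \<exists>y. y \<noteq> x \<and> \<bar>y - x\<bar> < d \<and> q < slope f x y)}"
  have fr: "(\<exists>\<^sub>F y in at x. P y) \<Longrightarrow> \<forall>d>0. \<exists>y. y \<noteq> x \<and> \<bar>y - x\<bar> < d \<and> P y" for x :: real and P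
    unfolding frequently_def eventually_at by (auto simp: dist_real_def)
  have "f field_differentiable (at x)"
    if x: "x \<in> {a<..<b}" "x \<notin> ?B" "\<And>p q. p \<in> \<rat> \<Longrightarrow> q \<in> \<rat> \<Longrightarrow> p < q \<Longrightarrow> x \<notin> ?O p q" for x
  proof -
    define s where "s y = ereal (slope f x y)" for y
    have "Liminf (at x) s = Limsup (at x) s"
    proof (rule ccontr)
      assume "Liminf (at x) s \<noteq> Limsup (at x) s"
      then have "Liminf (at x) s < Limsup (at x) s"
        using Liminf_le_Limsup[of "at x" s] by (simp add: less_le)
      then obtain p' q' where pq': "Liminf (at x) s < ereal p'" "ereal p' < ereal q'" "ereal q' < Limsup (at x) s"
        by (metis ereal_dense2)
      then have "p' < q'" by simp
      then obtain p where p: "p \<in> \<rat>" "p' < p" "p < q'" using Rats_dense_in_real by blast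
      then obtain q where q: "q \<in> \<rat>" "p < q" "q < q'" using Rats_dense_in_real by blast
      have "Liminf (at x) s < ereal p" using pq' p by (meson ereal_less_eq less_le_trans less_ereal.simps(1) less_trans)
      then have 1: "\<exists>\<^sub>F y in at x. s y < ereal p"
        using le_Liminf_iff[of "ereal p" "at x" s] Liminf_bounded[of "ereal p" s "at x"] by (auto simp: frequently_def not_less)
      have "ereal q < Limsup (at x) s" using pq' q by (meson less_ereal.simps(1) less_trans)
      then have 2: "\<exists>\<^sub>F y in at x. ereal q < s y"
        using Limsup_bounded[of s "ereal q" "at x"] by (auto simp: frequently_def not_less)
      have "x \<in> ?O p q"
        using fr[OF 1] fr[OF 2] x(1) by (auto simp: s_def)
      then show False using x(3) p q by blast
    qed
    then obtain L where L: "(s \<longlongrightarrow> L) (at x)"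
      by (metis Liminf_le_Limsup lim_increasing_cl trivial_limit_at tendsto_iff_Liminf_eq_Limsup)
    obtain M d where M: "d > 0" "\<And>y. y \<noteq> x \<Longrightarrow> \<bar>y - x\<bar> < d \<Longrightarrow> \<bar>slope f x y\<bar> \<le> M"
      using x(1,2) by (force simp: not_less)
    have ev: "\<forall>\<^sub>F y in at x. s y \<le> ereal M \<and> ereal (-M) \<le> s y"
      unfolding eventually_at using M by (intro exI[of _ d]) (force simp: s_def dist_real_def abs_le_iff)
    have "L \<le> ereal M" "ereal (-M) \<le> L"
      using tendsto_upperbound[OF L, of "ereal M"] tendsto_lowerbound[OF L, of "ereal (-M)"]
        eventually_conj_iff[of _ _ "at x"] ev by auto
    then obtain l where "L = ereal l" by (cases L) auto
    then have "(slope f x \<longlongrightarrow> l) (at x)" using L unfolding s_def by simp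
    then have "(f has_field_derivative l) (at x)"
      unfolding has_field_derivative_iff slope_def[abs_def] by simp
    then show ?thesis unfolding field_differentiable_def by blast
  qed
  then have sub: "{x \<in> {a<..<b}. \<not> f field_differentiable (at x)} \<subseteq>
     ?B \<union> (\<Union>r\<in>{r \<in> \<rat> \<times> \<rat>. fst r < snd r}. ?O (fst r) (snd r))"
    by fastforce
  have O: "negligible (\<Union>r\<in>{r \<in> \<rat> \<times> \<rat>. fst r < snd r}. ?O (fst r) (snd r))"
  proof (intro negligible_countable_Union countable_image)
    show "countable {r \<in> \<rat> \<times> \<rat>. fst r < (snd r :: real)}"
      by (rule countable_subset[of _ "\<rat> \<times> \<rat>"]) (auto intro: countable_rat)
  qed (use negligible_oscillating_slopes[OF ac] in auto)
  show ?thesis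
    by (rule negligible_subset[OF negligible_Un[OF negligible_unbounded_slopes[OF ac] O] sub])
qed

section \<open>The fundamental theorem of calculus for absolutely continuous functions\<close>

text \<open>At tags in \<open>N\<close> the gauge forces the intervals into an open set of measure
  below \<delta>, so absolute continuity makes their increments small, while \<open>g\<close>
  contributes nothing there. At all other tags the derivative supplies the gauge.\<close>

lemma abs_continuous_on_has_integral:
  fixes f g :: "real \<Rightarrow> real"
  assumes ac: "abs_continuous_on a b f" and ab: "a \<le> b"
    and N: "negligible N" and g0: "\<And>x. x \<in> N \<Longrightarrow> g x = 0"
    and der: "\<And>x. x \<in> {a..b} - N \<Longrightarrow> (f has_real_derivative g x) (at x)"
  shows "(g has_integral (f b - f a)) {a..b}"
  unfolding has_integral_real
proof (intro allI impI)
  fix \<epsilon> :: real assume "0 < \<epsilon>"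
  then have e2: "0 < \<epsilon>/2" by simp
  obtain \<delta> where \<delta>: "\<delta> > 0" "\<forall>D. D division_of \<Union>D \<and> \<Union>D \<subseteq> {a..b} \<and> (\<Sum>K\<in>D. Sup K - Inf K) < \<delta>
     \<longrightarrow> (\<Sum>K\<in>D. \<bar>f (Sup K) - f (Inf K)\<bar>) < \<epsilon>/2"
    using abs_continuous_onD[OF ac e2] by blast
  obtain U where U: "open U" "N \<subseteq> U" "U \<in> lmeasurable" "measure lebesgue U < \<delta>"
  proof -
    obtain T where T: "open T" "N \<subseteq> T" "T - N \<in> lmeasurable" "emeasure lebesgue (T - N) < ennreal \<delta>"
      using sets_lebesgue_outer_open[OF fmeasurableD[OF negligible_imp_measurable[OF N]] \<delta>(1)] by blast
    have TN: "T = N \<union> (T - N)" using T by blast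
    have "T \<in> lmeasurable" using TN fmeasurable.Un[OF negligible_imp_measurable[OF N] T(3)] by simp
    moreover have "measure lebesgue T \<le> measure lebesgue N + measure lebesgue (T - N)"
      using TN measure_Un_le[of N lebesgue "T - N"] negligible_imp_measurable[OF N] T(3) by (metis fmeasurableD)
    moreover have "measure lebesgue (T - N) < \<delta>"
      using T \<delta>(1) by (simp add: emeasure_eq_measure2 ennreal_less_iff)
    ultimately show ?thesis using that[of T] T negligible_imp_measure0[OF N] by simp
  qed
  define e where "e = \<epsilon> / (2 * (b - a + 1))"
  have e: "e > 0" "e * (b - a) < \<epsilon>/2" using \<open>0 < \<epsilon>\<close> ab unfolding e_def by (auto simp: field_simps)
  have "\<exists>d>0. \<forall>y. \<bar>y - x\<bar> < d \<longrightarrow> \<bar>f y - f x - g x * (y - x)\<bar> \<le> e * \<bar>y - x\<bar>" if "x \<in> {a..b} - N" for x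
    using der[OF that] e(1) unfolding has_field_derivative_def has_derivative_at_alt by (auto simp: mult.commute)
  then obtain d where d: "\<And>x. x \<in> {a..b} - N \<Longrightarrow> d x > 0"
    "\<And>x y. x \<in> {a..b} - N \<Longrightarrow> \<bar>y - x\<bar> < d x \<Longrightarrow> \<bar>f y - f x - g x * (y - x)\<bar> \<le> e * \<bar>y - x\<bar>" by metis
  define \<gamma> where "\<gamma> x = (if x \<in> N then U else if x \<in> {a..b} then ball x (d x) else UNIV)" for x
  show "\<exists>\<gamma>. gauge \<gamma> \<and> (\<forall>\<D>. \<D> tagged_division_of {a..b} \<and> \<gamma> fine \<D> \<longrightarrow>
          norm ((\<Sum>(x, k)\<in>\<D>. measure lborel k *\<^sub>R g x) - (f b - f a)) < \<epsilon>)"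
  proof (intro exI[of _ \<gamma>] conjI allI impI; (elim conjE)?)
    show "gauge \<gamma>"
      unfolding gauge_def \<gamma>_def using U d(1) by auto
    fix \<D> assume D: "\<D> tagged_division_of {a..b}" and fine: "\<gamma> fine \<D>"
    have fin: "finite \<D>" using D by auto
    have K: "\<exists>c e. c \<le> e \<and> K = {c..e} \<and> c \<le> x \<and> x \<le> e \<and> K \<subseteq> \<gamma> x \<and> {c..e} \<subseteq> {a..b}" if "(x,K) \<in> \<D>" for x K
    proof -
      obtain c e where "K = cbox c e" "x \<in> K" "K \<subseteq> {a..b}" using tagged_division_ofD(2-4)[OF D] \<open>(x,K) \<in> \<D>\<close> by metis
      moreover have "K \<subseteq> \<gamma> x" using fine \<open>(x,K) \<in> \<D>\<close> unfolding fine_def by auto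
      ultimately show ?thesis by (intro exI[of _ c] exI[of _ e]) auto
    qed
    define R where "R = (\<lambda>(x::real,K). measure lborel K * g x - (f (Sup K) - f (Inf K)))"
    define DN where "DN = {(x,K) \<in> \<D>. x \<in> N}"
    have "(\<Sum>(x, k)\<in>\<D>. measure lborel k *\<^sub>R g x) - (f b - f a) = (\<Sum>z\<in>\<D>. R z)"
      unfolding additive_tagged_division_1[OF ab D, of f, symmetric] R_def
      by (simp add: sum_subtractf[symmetric] split_def)
    also have "\<dots> = (\<Sum>z\<in>\<D> - DN. R z) + (\<Sum>z\<in>DN. R z)"
      using fin by (intro sum.subset_diff) (auto simp: DN_def)
    finally have eq: "(\<Sum>(x, k)\<in>\<D>. measure lborel k *\<^sub>R g x) - (f b - f a) = (\<Sum>z\<in>\<D> - DN. R z) + (\<Sum>z\<in>DN. R z)" .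
    have "\<bar>\<Sum>z\<in>\<D> - DN. R z\<bar> \<le> (\<Sum>(x,K)\<in>\<D> - DN. e * measure lborel K)"
    proof (rule order_trans[OF sum_abs sum_mono])
      fix z assume z: "z \<in> \<D> - DN"
      obtain x K where zK: "z = (x,K)" by (cases z)
      then have xK: "(x,K) \<in> \<D>" "x \<notin> N" using z unfolding DN_def by auto
      from K[OF xK(1)] obtain c h where ch: "c \<le> h" "K = {c..h}" "c \<le> x" "x \<le> h" "K \<subseteq> \<gamma> x" "{c..h} \<subseteq> {a..b}"
        by (elim exE conjE) (rule that)
      have x: "x \<in> {a..b} - N" using ch xK by auto
      have "K \<subseteq> ball x (d x)" using ch(5) x unfolding \<gamma>_def by auto
      then have "c \<in> ball x (d x)" "h \<in> ball x (d x)" unfolding ch(2) using ch(1) by (metis atLeastAtMost_iff order_refl subsetD)+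
      then have "\<bar>f c - f x - g x * (c - x)\<bar> \<le> e * \<bar>c - x\<bar>" "\<bar>f h - f x - g x * (h - x)\<bar> \<le> e * \<bar>h - x\<bar>"
        by (auto intro!: d(2)[OF x] simp: dist_real_def)
      then have "\<bar>g x * (h - c) - (f h - f c)\<bar> \<le> e * (h - c)" using ch by (auto simp: abs_le_iff algebra_simps)
      then show "\<bar>R z\<bar> \<le> (case z of (x,K) \<Rightarrow> e * measure lborel K)"
        using ch zK unfolding R_def by (simp add: mult.commute)
    qed
    also have "\<dots> \<le> (\<Sum>(x,K)\<in>\<D>. e * measure lborel K)"
      using e(1) fin by (intro sum_mono2) (auto simp: zero_le_mult_iff)
    also have "\<dots> = e * (\<Sum>(x,K)\<in>\<D>. measure lborel K)" by (simp add: sum_distrib_left split_def)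
    also have "(\<Sum>(x,K)\<in>\<D>. measure lborel K) = b - a"
      using additive_content_tagged_division[of \<D> a b] D ab by simp
    finally have 1: "\<bar>\<Sum>z\<in>\<D> - DN. R z\<bar> < \<epsilon>/2" using e(2) by linarith
    have DN: "DN tagged_partial_division_of {a..b}"
      using D unfolding tagged_division_of_def DN_def by (rule tagged_partial_division_subset[OF conjunct1]) auto
    have DN': "DN tagged_division_of \<Union>(snd ` DN)" using tagged_partial_division_of_Union_self[OF DN] .
    have divN: "snd ` DN division_of \<Union>(snd ` DN)" using partial_division_of_tagged_division[OF DN] .
    have DNU: "\<Union>(snd ` DN) \<subseteq> U \<inter> {a..b}" using K unfolding DN_def \<gamma>_def by fastforce
    \<comment> \<open>Passing from tagged pairs to the intervals themselves requires a quantity that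
      vanishes on every interval with empty interior; the empty set is singled out because
      \<open>Sup {}\<close> carries no information.\<close>
    define F where "F K = (if K = {} then 0 else \<bar>f (Sup K) - f (Inf K)\<bar>)" for K
    have "\<bar>\<Sum>z\<in>DN. R z\<bar> \<le> (\<Sum>(x,K)\<in>DN. F K)"
    proof (rule order_trans[OF sum_abs sum_mono])
      fix z assume z: "z \<in> DN"
      obtain x L where xL: "z = (x,L)" by (cases z)
      then have "L \<noteq> {}" "x \<in> N" using z K[of x L] unfolding DN_def by auto
      then show "\<bar>R z\<bar> \<le> (case z of (x,K) \<Rightarrow> F K)" unfolding xL R_def F_def by (simp add: g0)
    qed
    also have "\<dots> = (\<Sum>K\<in>snd ` DN. F K)"
    proof (rule sum.over_tagged_division_lemma[OF DN'])
      fix u v :: real assume "box u v = {}"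
      then show "F (cbox u v) = 0" by (cases "u = v") (auto simp: F_def)
    qed
    also have "\<dots> = (\<Sum>K\<in>snd ` DN. \<bar>f (Sup K) - f (Inf K)\<bar>)"
      using division_ofD(3)[OF divN] by (intro sum.cong) (auto simp: F_def)
    also have "\<dots> < \<epsilon>/2"
    proof (intro \<delta>(2)[rule_format] conjI divN)
      show "\<Union>(snd ` DN) \<subseteq> {a..b}" using DNU by blast
      have "measure lebesgue (\<Union>(snd ` DN)) \<le> measure lebesgue U"
        using DNU lmeasurable_division[OF divN] by (intro measure_mono_fmeasurable U(3)) (auto simp: fmeasurableD)
      then show "(\<Sum>K\<in>snd ` DN. Sup K - Inf K) < \<delta>" using U(4) sum_length_division[OF divN] by simp
    qed
    finally have 2: "\<bar>\<Sum>z\<in>DN. R z\<bar> < \<epsilon>/2" .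
    show "norm ((\<Sum>(x, k)\<in>\<D>. measure lborel k *\<^sub>R g x) - (f b - f a)) < \<epsilon>"
      unfolding eq using 1 2 by (simp add: abs_if split: if_splits)
  qed
qed

text \<open>The Borel function \<open>g\<close> replaces \<^term>\<open>deriv f\<close>, which is arbitrary where \<open>f\<close> is not differentiable.\<close>

lemma locally_abs_continuous_derivative:
  assumes "locally_abs_continuous f"
  obtains g :: "real \<Rightarrow> real" where "g \<in> borel_measurable borel"
    "AE x in lborel. x \<in> {0<..<1} \<longrightarrow> (f has_real_derivative g x) (at x)"
    "\<And>a b. 0 < a \<Longrightarrow> a \<le> b \<Longrightarrow> b < 1 \<Longrightarrow> ennreal \<bar>f b - f a\<bar> \<le> (\<integral>\<^sup>+x\<in>{a..b}. ennreal \<bar>g x\<bar> \<partial>lborel)"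
proof -
  define N where "N = {x \<in> {0<..<1}. \<not> f field_differentiable (at x)}"
  \<comment> \<open>The 3 keeps the exhausting intervals nondegenerate for every n.\<close>
  have "N \<subseteq> (\<Union>n::nat. {x \<in> {1 / (real n + 3)<..<1 - 1 / (real n + 3)}. \<not> f field_differentiable (at x)})"
  proof
    fix x assume x: "x \<in> N"
    then have "min x (1 - x) > 0" unfolding N_def by auto
    then obtain n where n: "inverse (real (Suc n)) < min x (1 - x)" using reals_Archimedean by blast
    have "1 / (real n + 3) \<le> inverse (real (Suc n))" by (simp add: field_simps)
    then show "x \<in> (\<Union>n::nat. {x \<in> {1 / (real n + 3)<..<1 - 1 / (real n + 3)}. \<not> f field_differentiable (at x)})"
      using n x unfolding N_def by (intro UN_I[of n]) auto
  qed
  moreover have "negligible (\<Union>n::nat. {x \<in> {1 / (real n + 3)<..<1 - 1 / (real n + 3)}. \<not> f field_differentiable (at x)})"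
  proof (intro negligible_countable_Union)
    fix S assume "S \<in> range (\<lambda>n. {x \<in> {1 / (real n + 3)<..<1 - 1 / (real n + 3)}. \<not> f field_differentiable (at x)})"
    then obtain n where S: "S = {x \<in> {1 / (real n + 3)<..<1 - 1 / (real n + 3)}. \<not> f field_differentiable (at x)}" by blast
    have "abs_continuous_on (1 / (real n + 3)) (1 - 1 / (real n + 3)) f"
      using assms unfolding locally_abs_continuous_def by (simp add: field_simps)
    then show "negligible S" unfolding S by (rule abs_continuous_on_differentiable_ae)
  qed auto
  ultimately have N: "negligible N" by (rule negligible_subset[rotated])
  \<comment> \<open>The value 0 on \<open>N\<close> is what
    \<open>abs_continuous_on_has_integral\<close> expects there. \<open>h\<close> is only Lebesgue
    measurable at first; a Borel function equal to it almost everywhere is chosen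
    afterwards.\<close>
  define h where "h x = (if x \<in> {0<..<1} - N then deriv f x else 0)" for x
  have hd: "(f has_real_derivative h x) (at x)" if "x \<in> {0<..<1} - N" for x
    using that DERIV_deriv_iff_field_differentiable[of f x] unfolding h_def N_def by auto
  have hint: "(h has_integral (f b - f a)) {a..b}" if "0 < a" "a \<le> b" "b < 1" for a b
  proof (rule abs_continuous_on_has_integral[OF _ that(2) N])
    show "abs_continuous_on a b f" using assms that unfolding locally_abs_continuous_def by auto
  qed (use that hd in \<open>auto simp: h_def\<close>)
  have hm: "h \<in> borel_measurable lebesgue"
  proof -
    define hn where "hn n x = (if x \<in> {1 / (real n + 3)..1 - 1 / (real n + 3)} then h x else 0)" for n x
    have "hn n \<in> borel_measurable lebesgue" for n
    proof -
      have "h integrable_on {1 / (real n + 3)..1 - 1 / (real n + 3)}"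
        using hint[of "1 / (real n + 3)" "1 - 1 / (real n + 3)"] by (auto simp: field_simps)
      then have "h \<in> borel_measurable (lebesgue_on {1 / (real n + 3)..1 - 1 / (real n + 3)})"
        by (rule integrable_imp_measurable)
      then show ?thesis unfolding hn_def[abs_def] by (rule borel_measurable_if_I) simp
    qed
    moreover have "(\<lambda>n. hn n x) \<longlonglongrightarrow> h x" for x
    proof (cases "x \<in> {0<..<1}")
      case True
      then have "min x (1 - x) > 0" by auto
      moreover have "(\<lambda>n. 1 / (real n + 3)) \<longlonglongrightarrow> 0" by real_asymp
      ultimately have "\<forall>\<^sub>F n in sequentially. 1 / (real n + 3) < min x (1 - x)" by (metis order_tendstoD(2))
      then have "\<forall>\<^sub>F n in sequentially. hn n x = h x" by eventually_elim (auto simp: hn_def)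
      then show ?thesis by (rule tendsto_eventually)
    next
      case False
      then have "hn n x = h x" for n unfolding hn_def h_def by auto
      then show ?thesis by simp
    qed
    ultimately show ?thesis by (rule borel_measurable_LIMSEQ_real[rotated])
  qed
  obtain g where g: "g \<in> borel_measurable lborel" "AE x in lborel. h x = g x"
    using completion_ex_borel_measurable_real[OF hm] by blast
  have "AE x in lborel. x \<notin> N"
    using N unfolding negligible_iff_null_sets by (metis AE_completion_iff AE_not_in)
  with g(2) have AE: "AE x in lborel. x \<in> {0<..<1} \<longrightarrow> (f has_real_derivative g x) (at x)"
    by eventually_elim (metis DiffI hd)
  have "ennreal \<bar>f b - f a\<bar> \<le> (\<integral>\<^sup>+x\<in>{a..b}. ennreal \<bar>g x\<bar> \<partial>lborel)" if "0 < a" "a \<le> b" "b < 1" for a b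
  proof (cases "(\<integral>\<^sup>+x\<in>{a..b}. ennreal \<bar>g x\<bar> \<partial>lborel) < \<infinity>")
    case True
    have "set_integrable lborel {a..b} g"
      unfolding set_integrable_def
    proof (rule integrableI_bounded)
      show "(\<integral>\<^sup>+ x. ennreal (norm (indicat_real {a..b} x *\<^sub>R g x)) \<partial>lborel) < \<infinity>"
        using True by (subst (asm) nn_integral_cong[of _ _ "\<lambda>x. ennreal (norm (indicat_real {a..b} x *\<^sub>R g x))"])
          (auto simp: indicator_def)
    qed (use g(1) in measurable)
    then have "(g has_integral (LINT x:{a..b}|lborel. g x)) {a..b}" 
      using set_borel_integral_eq_integral[of "{a..b}" g] by (metis integrable_integral)
    moreover have "(g has_integral (f b - f a)) {a..b}"
    proof -
      have "AE x in lebesgue. h x = g x" using g(2) by (rule AE_completion)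
      then obtain M where M: "M \<in> null_sets lebesgue" "{x. h x \<noteq> g x} \<subseteq> M" by (auto simp: eventually_ae_filter)
      show ?thesis
      proof (rule has_integral_spike[OF _ _ hint[OF that], of M])
        show "g x = h x" if "x \<in> {a..b} - M" for x using M(2) that by (metis (mono_tags, lifting) DiffD2 mem_Collect_eq subsetD)
      qed (use M in \<open>simp add: negligible_iff_null_sets\<close>)
    qed
    ultimately have "f b - f a = (LINT x:{a..b}|lborel. g x)" using has_integral_unique by blast
    then have "ennreal \<bar>f b - f a\<bar> = ennreal (norm (LINT x:{a..b}|lborel. g x))" by simp
    also have "\<dots> \<le> (\<integral>\<^sup>+ x. ennreal (norm (indicat_real {a..b} x *\<^sub>R g x)) \<partial>lborel)"
      unfolding set_lebesgue_integral_def
      using \<open>set_integrable lborel {a..b} g\<close> unfolding set_integrable_def by (rule integral_norm_bound_ennreal)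
    also have "\<dots> = (\<integral>\<^sup>+x\<in>{a..b}. ennreal \<bar>g x\<bar> \<partial>lborel)"
      by (rule nn_integral_cong) (auto simp: indicator_def)
    finally show ?thesis .
  qed (simp add: not_less top_unique)
  then show ?thesis using that g(1) AE by simp
qed


section \<open>Moser's gap estimate\<close>

text \<open>Mean value theorem, followed by subadditivity of x powr (q - 1), whose exponent lies in
  [0,1]. In \<open>Moser_gap\<close> the pure power of \<open>y\<close> is absorbed because little
  energy is left, and the mixed term by comparing powers.\<close>

lemma powr_add_le_linear:
  fixes X y q :: real
  assumes "0 \<le> X" "0 \<le> y" "1 \<le> q" "q \<le> 2"
  shows "(X + y) powr q \<le> X powr q + 2 * y * (X powr (q - 1) + y powr (q - 1))"
proof (cases "y = 0")
  case False
  then have y: "y > 0" using assms by simp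
  show ?thesis
  proof (cases "X = 0")
    case True
    have "y powr q = y * y powr (q - 1)" using y by (simp add: powr_mult_base)
    then show ?thesis using True y assms by simp
  next
    case False
    then have X: "X > 0" using assms by simp
    have "\<exists>z>X. z < X + y \<and> (X + y) powr q - X powr q = (X + y - X) * (q * z powr (q - 1))"
    proof (rule MVT2)
      show "X < X + y" using y by simp
      show "((\<lambda>x. x powr q) has_real_derivative q * x powr (q - 1)) (at x)" if "X \<le> x" for x
        using that X by (auto intro!: derivative_eq_intros)
    qed
    then obtain z where z: "X < z" "z < X + y" "(X + y) powr q - X powr q = y * (q * z powr (q - 1))" by auto
    have "z powr (q - 1) \<le> (X + y) powr (q - 1)" using z X assms by (intro powr_mono2) auto
    also have "\<dots> \<le> X powr (q - 1) + y powr (q - 1)"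
    proof -
      have "(X + y) powr (q - 1) = (X + y) * (X + y) powr (q - 2)"
        using X y powr_mult_base[of "X + y" "q - 2"] by simp
      also have "\<dots> = X * (X + y) powr (q - 2) + y * (X + y) powr (q - 2)" by (simp add: algebra_simps)
      also have "\<dots> \<le> X * X powr (q - 2) + y * y powr (q - 2)"
        using X y assms by (intro add_mono mult_left_mono powr_mono2') auto
      also have "\<dots> = X powr (q - 1) + y powr (q - 1)"
        using X y powr_mult_base[of X "q - 2"] powr_mult_base[of y "q - 2"] by simp
      finally show ?thesis .
    qed
    finally have "q * z powr (q - 1) \<le> 2 * (X powr (q - 1) + y powr (q - 1))"
      using assms by (intro mult_mono) auto
    then have "y * (q * z powr (q - 1)) \<le> y * (2 * (X powr (q - 1) + y powr (q - 1)))"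
      using y by (intro mult_left_mono) auto
    then show ?thesis using z(3) by (simp add: algebra_simps)
  qed
qed (use assms in auto)

text \<open>Bernoulli's inequality for the k-th root of x. It turns a defect of the power e powr
  (m/k) into a bound on the missing energy 1 - e.\<close>

lemma one_minus_le_power_root:
  fixes x :: real and k :: nat
  assumes "0 \<le> x" "x \<le> 1" "k \<ge> 1" "1 / real k \<le> q"
  shows "1 - x \<le> real k * (1 - x powr q)"
proof (cases "x = 0")
  case False
  then have x: "x > 0" using assms by simp
  define y where "y = x powr (1 / real k)"
  have y: "0 < y" "y \<le> 1" using x assms powr_le1[of "1/real k" x] by (auto simp: y_def)
  have "y ^ k = x" using x assms by (simp add: y_def powr_power)
  have "1 + real k * (y - 1) \<le> (1 + (y - 1)) ^ k" using y by (intro Bernoulli_inequality) auto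
  then have "1 - x \<le> real k * (1 - y)" using \<open>y ^ k = x\<close> by (simp add: algebra_simps)
  also have "x powr q \<le> y" unfolding y_def using x assms by (intro powr_mono') auto
  then have "real k * (1 - y) \<le> real k * (1 - x powr q)" by (intro mult_left_mono) auto
  finally show ?thesis by simp
qed (use assms in auto)

text \<open>
  Moser's argument in the variable \<open>T = t powr (1 - \<beta>)\<close>, which removes the weight: if the defect
  \<open>t - Y t powr \<gamma>\<close> is at most \<open>\<Lambda>\<close> at \<open>t\<^sub>1 < t\<^sub>2\<close>, then hardly any energy is left after \<open>t\<^sub>1\<close>, so that
  \<open>Y\<close> grows too slowly for \<open>t\<^sub>2 - t\<^sub>1\<close> to be large.
\<close>

lemma Moser_gap:
  fixes k :: nat and m p t\<^sub>1 t\<^sub>2 Y\<^sub>1 Y\<^sub>2 e\<^sub>1 e\<^sub>2 \<Lambda> :: real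
  assumes k: "k \<ge> 1" and p: "p = real k + 1" and m: "m \<ge> 1" and L: "0 < \<Lambda>"
    and t: "real k * 8 ^ k * \<Lambda> \<le> t\<^sub>1" "t\<^sub>1 \<le> t\<^sub>2"
    and e: "0 \<le> e\<^sub>1" "e\<^sub>1 \<le> e\<^sub>2" "e\<^sub>2 \<le> 1"
    and Y: "0 \<le> Y\<^sub>1" "0 \<le> Y\<^sub>2"
    and Y1: "Y\<^sub>1 \<le> e\<^sub>1 powr (1 / p) * (t\<^sub>1 powr (1 / m)) powr (k / p)"
    and Y2: "Y\<^sub>2 \<le> e\<^sub>2 powr (1 / p) * (t\<^sub>2 powr (1 / m)) powr (k / p)"
    and Y12: "Y\<^sub>2 \<le> Y\<^sub>1 + (e\<^sub>2 - e\<^sub>1) powr (1 / p) * (t\<^sub>2 powr (1 / m) - t\<^sub>1 powr (1 / m)) powr (k / p)"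
    and F1: "t\<^sub>1 - Y\<^sub>1 powr (p / k * m) \<le> \<Lambda>" and F2: "t\<^sub>2 - Y\<^sub>2 powr (p / k * m) \<le> \<Lambda>"
  shows "t\<^sub>2 - t\<^sub>1 \<le> m * 9 powr (m - 1) * real k * 8 powr p * \<Lambda>"
proof -
  have k0: "real k > 0" and p0: "p > 0" using k p by auto
  have t1: "t\<^sub>1 > 0" using t(1) L k by (smt (verit) mult_pos_pos of_nat_0_less_iff zero_less_power k0)
  then have t2: "t\<^sub>2 > 0" using t by simp
  define T\<^sub>1 T\<^sub>2 where "T\<^sub>1 = t\<^sub>1 powr (1 / m)" and "T\<^sub>2 = t\<^sub>2 powr (1 / m)"
  have T: "T\<^sub>1 > 0" "T\<^sub>2 > 0" "T\<^sub>1 \<le> T\<^sub>2" unfolding T\<^sub>1_def T\<^sub>2_def using t1 t2 t(2) m by (auto intro: powr_mono2)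
  have tT: "T\<^sub>1 powr m = t\<^sub>1" "T\<^sub>2 powr m = t\<^sub>2" unfolding T\<^sub>1_def T\<^sub>2_def using t1 t2 m by (simp_all add: powr_powr)
  define q where "q = p / k"
  have q: "1 \<le> q" "q \<le> 2" using k unfolding q_def p by (auto simp: field_simps)
  define D where "D = T\<^sub>2 - T\<^sub>1"
  have D: "D \<ge> 0" using T D_def by simp
  \<comment> \<open>dt/dT is m T powr (m - 1), so a defect \<Lambda> in the scale of t amounts to
    one of order \<open>A\<close> in the scale of T.\<close>
  define A where "A = \<Lambda> * T\<^sub>1 powr (1 - m)"
  have A: "A > 0" using L T unfolding A_def by simp
  have At: "\<Lambda> / t\<^sub>1 * T\<^sub>1 = A" unfolding A_def tT(1)[symmetric] using T by (simp add: powr_diff field_simps)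
  have "Y\<^sub>1 powr q \<le> (e\<^sub>1 powr (1 / p) * T\<^sub>1 powr (k / p)) powr q"
    using Y1 Y q unfolding T\<^sub>1_def by (intro powr_mono2) auto
  also have "\<dots> = e\<^sub>1 powr (1 / k) * T\<^sub>1"
    using e T k0 p0 by (simp add: powr_mult powr_powr q_def)
  finally have S1: "Y\<^sub>1 powr q \<le> e\<^sub>1 powr (1 / k) * T\<^sub>1" .
  have "Y\<^sub>2 powr q \<le> (e\<^sub>2 powr (1 / p) * T\<^sub>2 powr (k / p)) powr q"
    using Y2 Y q unfolding T\<^sub>2_def by (intro powr_mono2) auto
  also have "\<dots> = e\<^sub>2 powr (1 / k) * T\<^sub>2"
    using e T k0 p0 by (simp add: powr_mult powr_powr q_def)
  also have "\<dots> \<le> T\<^sub>2" using T e powr_le1[of "1/k" e\<^sub>2] by (intro mult_left_le_one_le) auto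
  finally have S2: "Y\<^sub>2 powr q \<le> T\<^sub>2" .
  have "Y\<^sub>1 powr (q * m) \<le> (e\<^sub>1 powr (1 / k) * T\<^sub>1) powr m"
    unfolding powr_powr[symmetric] using S1 m by (intro powr_mono2) auto
  also have "\<dots> = e\<^sub>1 powr (m / k) * t\<^sub>1" using e T m by (simp add: powr_mult powr_powr tT)
  finally have "t\<^sub>1 * (1 - e\<^sub>1 powr (m / k)) \<le> \<Lambda>" using F1 unfolding q_def by (simp add: algebra_simps)
  then have "1 - e\<^sub>1 powr (m / k) \<le> \<Lambda> / t\<^sub>1" using t1 by (simp add: field_simps)
  moreover have "1 - e\<^sub>1 \<le> k * (1 - e\<^sub>1 powr (m / k))"
    using e k m by (intro one_minus_le_power_root) (auto simp: divide_right_mono)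
  ultimately have e1: "1 - e\<^sub>1 \<le> k * (\<Lambda> / t\<^sub>1)"
    using k0 by (meson mult_left_mono order_trans less_imp_le)
  \<comment> \<open>A bound on the energy beyond \<open>t\<^sub>1\<close>. The assumed size of
    \<open>t\<^sub>1\<close> makes it at most (1/8)^k, so that its k-th root is at most 1/8.\<close>
  define d where "d = k * (\<Lambda> / t\<^sub>1)"
  have d: "0 \<le> e\<^sub>2 - e\<^sub>1" "e\<^sub>2 - e\<^sub>1 \<le> d" "d > 0" using e e1 k0 L t1 unfolding d_def by auto
  have d8: "d \<le> (1/8) ^ k"
    using t(1) t1 L unfolding d_def by (simp add: field_simps power_divide)
  have gap: "T\<^sub>2 - Y\<^sub>2 powr q \<le> A"
  proof -
    define S where "S = Y\<^sub>2 powr q"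
    have S: "0 \<le> S" "S \<le> T\<^sub>2" using S2 unfolding S_def by auto
    have "S powr m = S powr (m - 1) * S" using S m by (cases "S = 0") (auto simp: powr_diff)
    also have "\<dots> \<le> T\<^sub>2 powr (m - 1) * S" using S m by (intro mult_right_mono powr_mono2) auto
    finally have "T\<^sub>2 powr (m - 1) * (T\<^sub>2 - S) \<le> T\<^sub>2 powr m - S powr m"
      using T by (simp add: powr_diff field_simps)
    also have "\<dots> \<le> \<Lambda>" using F2 unfolding tT S_def powr_powr q_def by simp
    finally have "T\<^sub>2 - S \<le> \<Lambda> * T\<^sub>2 powr (1 - m)" using T by (simp add: powr_diff field_simps)
    also have "\<dots> \<le> A" unfolding A_def using L T m by (intro mult_left_mono powr_mono2') auto
    finally show ?thesis unfolding S_def .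
  qed
  \<comment> \<open>\<open>y\<close> bounds the growth of the profile from \<open>t\<^sub>1\<close>
    to \<open>t\<^sub>2\<close>, and \<open>X\<close> below bounds its value at
    \<open>t\<^sub>1\<close>. As X powr q is \<open>T\<^sub>1\<close>, the small defect at
    \<open>t\<^sub>2\<close> becomes an inequality between \<open>D\<close> and
    \<open>A\<close>.\<close>
  define y where "y = d powr (1 / p) * D powr (k / p)"
  define X where "X = T\<^sub>1 powr (k / p)"
  have "Y\<^sub>1 \<le> X"
  proof -
    have "e\<^sub>1 powr (1 / p) \<le> 1" using e p0 by (intro powr_le1) auto
    then have "e\<^sub>1 powr (1 / p) * X \<le> X" unfolding X_def by (intro mult_left_le_one_le) auto
    then show ?thesis using Y1 unfolding X_def T\<^sub>1_def by simp
  qed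
  moreover have "(e\<^sub>2 - e\<^sub>1) powr (1 / p) * D powr (k / p) \<le> y"
    unfolding y_def using d p0 by (intro mult_right_mono powr_mono2) auto
  ultimately have "Y\<^sub>2 \<le> X + y" using Y12 unfolding D_def T\<^sub>1_def T\<^sub>2_def by simp
  then have "Y\<^sub>2 powr q \<le> (X + y) powr q" using Y q by (intro powr_mono2) auto
  also have "\<dots> \<le> X powr q + 2 * y * (X powr (q - 1) + y powr (q - 1))"
    using q by (intro powr_add_le_linear) (auto simp: X_def y_def)
  also have "X powr q = T\<^sub>1" unfolding X_def q_def using T k0 p0 by (simp add: powr_powr)
  also have "X powr (q - 1) = T\<^sub>1 powr (1 / p)"
    unfolding X_def q_def powr_powr p using k0 by (simp add: field_simps)
  also have "2 * y * (T\<^sub>1 powr (1 / p) + y powr (q - 1)) = 2 * (d * T\<^sub>1) powr (1 / p) * D powr (k / p) + 2 * y powr q"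
  proof -
    have "y * y powr (q - 1) = y powr q" by (cases "y = 0") (auto simp: powr_mult_base y_def)
    moreover have "y * T\<^sub>1 powr (1 / p) = (d * T\<^sub>1) powr (1 / p) * D powr (k / p)"
      using d T unfolding y_def by (simp add: powr_mult)
    ultimately show ?thesis by (simp add: algebra_simps)
  qed
  also have "y powr q = d powr (1 / k) * D"
    unfolding y_def q_def using d D k0 p0 by (simp add: powr_mult powr_powr)
  also have "d powr (1 / k) \<le> ((1/8) ^ k) powr (1 / k)" using d d8 by (intro powr_mono2) auto
  also have "((1/8) ^ k) powr (1 / k) = (1/8::real)"
    using k by (simp add: powr_powr flip: powr_realpow)
  finally have S2': "Y\<^sub>2 powr q \<le> T\<^sub>1 + (2 * (d * T\<^sub>1) powr (1 / p) * D powr (k / p) + 2 * (1/8 * D))"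
    using D by (simp add: mult_right_mono)
  have dT: "d * T\<^sub>1 = k * A" unfolding d_def At[symmetric] by simp
  have D1: "D \<le> A + 2 * (k * A) powr (1 / p) * D powr (k / p) + D / 4"
    using gap S2' D_def unfolding dT by linarith
  \<comment> \<open>In \<open>D1\<close> the exponents 1/p and k/p of the mixed term add up to 1. If
    \<open>D\<close> exceeded the claimed bound, that term would be at most D/4 as well, leaving D
    \<le> 2 A.\<close>
  have Dk: "D \<le> k * 8 powr p * A"
  proof (rule ccontr)
    assume "\<not> ?thesis"
    then have *: "k * A * 8 powr p < D" by (simp add: mult_ac)
    have kA: "k * A > 0" using k0 A by simp
    then have D0: "D > 0" using * by (smt (verit) mult_pos_pos powr_gt_zero)
    have "(k * A) powr (1 / p) * 8 = (k * A * 8 powr p) powr (1 / p)"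
      using kA p0 by (simp add: powr_mult powr_powr)
    also have "\<dots> \<le> D powr (1 / p)" using * kA p0 by (intro powr_mono2) auto
    finally have "(k * A) powr (1 / p) \<le> D powr (1 / p) / 8" by simp
    then have "2 * (k * A) powr (1 / p) * D powr (k / p) \<le> 2 * (D powr (1 / p) / 8) * D powr (k / p)"
      by (intro mult_right_mono mult_left_mono) auto
    also have "\<dots> = D powr (1 / p + k / p) / 4" by (simp add: powr_add)
    also have "1 / p + k / p = 1" unfolding p using k0 by (simp add: field_simps)
    finally have "D \<le> 2 * A" using D1 D0 by simp
    moreover have "2 * A < k * A * 8 powr p"
    proof -
      have "(8::real) powr 1 \<le> 8 powr p" using p by (intro powr_mono) auto
      then have "2 < 1 * (8::real) powr p" by simp
      also have "\<dots> \<le> k * 8 powr p" using k by (intro mult_right_mono) auto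
      finally show ?thesis using A by (simp add: mult_ac)
    qed
    ultimately show False using * by simp
  qed
  \<comment> \<open>8 powr p times (1/8)^k is 8, so \<open>D\<close> is at most 8 times
    \<open>T\<^sub>1\<close>. T thus changes by a bounded factor only, and T powr (m - 1) may be
    evaluated at \<open>T\<^sub>1\<close>, where it cancels against the power in
    \<open>A\<close>.\<close>
  have T9: "T\<^sub>2 \<le> 9 * T\<^sub>1"
  proof -
    have "k * 8 powr p * A = 8 powr p * d * T\<^sub>1" using dT by (simp add: mult_ac)
    also have "\<dots> \<le> 8 powr p * (1/8) ^ k * T\<^sub>1" using d8 T by (intro mult_right_mono mult_left_mono) auto
    also have "8 powr p * (1/8) ^ k = (8::real)" unfolding p by (simp add: powr_add powr_realpow power_divide)
    finally show ?thesis using Dk unfolding D_def by simp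
  qed
  have "t\<^sub>2 - t\<^sub>1 \<le> m * T\<^sub>2 powr (m - 1) * D"
  proof (cases "T\<^sub>1 = T\<^sub>2")
    case False
    then have lt: "T\<^sub>1 < T\<^sub>2" using T by simp
    have "\<exists>z>T\<^sub>1. z < T\<^sub>2 \<and> T\<^sub>2 powr m - T\<^sub>1 powr m = (T\<^sub>2 - T\<^sub>1) * (m * z powr (m - 1))"
    proof (rule MVT2[OF lt])
      show "((\<lambda>x. x powr m) has_real_derivative m * x powr (m - 1)) (at x)" if "T\<^sub>1 \<le> x" for x
        using that T by (auto intro!: derivative_eq_intros)
    qed
    then obtain z where z: "T\<^sub>1 < z" "z < T\<^sub>2" "t\<^sub>2 - t\<^sub>1 = D * (m * z powr (m - 1))" unfolding tT D_def by auto
    have "D * (m * z powr (m - 1)) \<le> D * (m * T\<^sub>2 powr (m - 1))"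
      using z T m D by (intro mult_left_mono powr_mono2) auto
    then show ?thesis using z(3) by (simp add: mult_ac)
  qed (use tT D m in simp)
  also have "\<dots> \<le> m * (9 * T\<^sub>1) powr (m - 1) * (k * 8 powr p * A)"
    using T9 Dk D T m by (intro mult_mono powr_mono2 mult_nonneg_nonneg) auto
  also have "\<dots> = m * 9 powr (m - 1) * real k * 8 powr p * \<Lambda>"
    using T unfolding A_def by (simp add: powr_mult powr_diff field_simps)
  finally show ?thesis .
qed


section \<open>The critical exponential integral\<close>

text \<open>Young's inequality after normalisation. Real bounds \<open>I\<close> and
  \<open>J\<close> in place of the integrals avoid roots of extended reals; if one of them is 0 the
  normalisation breaks down, but then the product vanishes almost everywhere.\<close>

lemma nn_integral_Hoelder:
  fixes f g :: "'a \<Rightarrow> real"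
  assumes meas [measurable]: "f \<in> borel_measurable M" "g \<in> borel_measurable M"
    and nonneg: "\<And>x. 0 \<le> f x" "\<And>x. 0 \<le> g x"
    and pq: "1 < p" "1 < q" "1 / p + 1 / q = 1"
    and IJ: "0 \<le> I" "0 \<le> J"
    and f: "(\<integral>\<^sup>+x. ennreal (f x powr p) \<partial>M) \<le> ennreal I"
    and g: "(\<integral>\<^sup>+x. ennreal (g x powr q) \<partial>M) \<le> ennreal J"
  shows "(\<integral>\<^sup>+x. ennreal (f x * g x) \<partial>M) \<le> ennreal (I powr (1 / p) * J powr (1 / q))"
proof -
  consider "I = 0" | "J = 0" | "I > 0" "J > 0" using IJ by linarith
  then show ?thesis
  proof cases
    case 1
    then have "(\<integral>\<^sup>+x. ennreal (f x powr p) \<partial>M) = 0" using f by simp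
    then have "AE x in M. ennreal (f x powr p) = 0" by (subst (asm) nn_integral_0_iff_AE) auto
    then have "AE x in M. ennreal (f x * g x) = 0" by eventually_elim (auto simp: ennreal_eq_0_iff)
    then have "(\<integral>\<^sup>+x. ennreal (f x * g x) \<partial>M) = 0" by (subst nn_integral_0_iff_AE) auto
    then show ?thesis by simp
  next
    case 2
    then have "(\<integral>\<^sup>+x. ennreal (g x powr q) \<partial>M) = 0" using g by simp
    then have "AE x in M. ennreal (g x powr q) = 0" by (subst (asm) nn_integral_0_iff_AE) auto
    then have "AE x in M. ennreal (f x * g x) = 0" by eventually_elim (auto simp: ennreal_eq_0_iff)
    then have "(\<integral>\<^sup>+x. ennreal (f x * g x) \<partial>M) = 0" by (subst nn_integral_0_iff_AE) auto
    then show ?thesis by simp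
  next
    case 3
    define a where "a = I powr (1 / p)"
    define b where "b = J powr (1 / q)"
    have ab: "a > 0" "b > 0" "a powr p = I" "b powr q = J"
      using 3 pq by (auto simp: a_def b_def powr_powr)
    have pt: "f x * g x \<le> a * b * (1 / (p * I) * f x powr p + 1 / (q * J) * g x powr q)" for x
    proof -
      have "f x / a * (g x / b) \<le> (f x / a) powr p / p + (g x / b) powr q / q"
        using pq nonneg ab by (intro Youngs_inequality) auto
      also have "\<dots> = 1 / (p * I) * f x powr p + 1 / (q * J) * g x powr q"
        using nonneg ab by (simp add: powr_divide mult_ac)
      finally show ?thesis using ab by (simp add: field_simps)
    qed
    have "(\<integral>\<^sup>+x. ennreal (f x * g x) \<partial>M) \<le>
      (\<integral>\<^sup>+x. ennreal (a * b) * (ennreal (1 / (p * I)) * ennreal (f x powr p) + ennreal (1 / (q * J)) * ennreal (g x powr q)) \<partial>M)"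
      using pt ab 3 pq by (intro nn_integral_mono) (simp flip: ennreal_mult ennreal_plus)
    also have "\<dots> = ennreal (a * b) * (ennreal (1 / (p * I)) * (\<integral>\<^sup>+x. ennreal (f x powr p) \<partial>M) +
        ennreal (1 / (q * J)) * (\<integral>\<^sup>+x. ennreal (g x powr q) \<partial>M))"
      by (simp add: nn_integral_cmult nn_integral_add)
    also have "\<dots> \<le> ennreal (a * b) * (ennreal (1 / (p * I)) * ennreal I + ennreal (1 / (q * J)) * ennreal J)"
      using f g by (intro mult_left_mono add_mono) auto
    also have "\<dots> = ennreal (a * b * (1 / p + 1 / q))"
      using 3 pq ab by (simp flip: ennreal_mult ennreal_plus)
    finally show ?thesis using pq unfolding a_def b_def by simp
  qed
qed

section \<open>From counting shells to the integral over the ball\<close>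

text \<open>A discrete layer-cake argument. Grouped by the integer part j of \<open>m i\<close>, at
  most C (j + 1) indices contribute at most exp (- j) each, and (j + 1) exp (- j) is at most 2 exp
  (- j / 2), which sums as a geometric series.\<close>

lemma suminf_exp_counting:
  fixes m :: "nat \<Rightarrow> real"
  assumes m: "\<And>i. 0 \<le> m i" and C: "0 \<le> C"
    and count: "\<And>L. 1 \<le> L \<Longrightarrow> finite {i. m i < L} \<and> real (card {i. m i < L}) \<le> C * L"
  shows "(\<Sum>i. ennreal (exp (- m i))) \<le> ennreal (C * (2 / (1 - exp (- 1 / 2))))"
proof -
  have fin: "(\<Sum>i<N. exp (- m i)) \<le> C * (2 / (1 - exp (- 1 / 2)))" for N
  proof -
    define g where "g i = nat \<lfloor>m i\<rfloor>" for i
    have g: "real (g i) \<le> m i" "m i < real (g i) + 1" for i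
      unfolding g_def using m[of i] by linarith+
    define T where "T = Suc (Max (insert 0 (g ` {..<N})))"
    have gT: "g ` {..<N} \<subseteq> {..<T}" unfolding T_def by (auto simp: less_Suc_eq_le)
    have "(\<Sum>i<N. exp (- m i)) \<le> (\<Sum>i<N. exp (- real (g i)))" using g(1) by (intro sum_mono) simp
    also have "\<dots> = (\<Sum>j<T. \<Sum>i\<in>{i. i \<in> {..<N} \<and> g i = j}. exp (- real (g i)))"
      by (rule sum.group[symmetric, OF _ _ gT]) auto
    also have "\<dots> \<le> (\<Sum>j<T. 2 * C * exp (- 1 / 2) ^ j)"
    proof (rule sum_mono)
      fix j
      let ?S = "{i. i \<in> {..<N} \<and> g i = j}"
      have cnt: "finite {i. m i < real j + 1} \<and> real (card {i. m i < real j + 1}) \<le> C * (real j + 1)"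
        by (rule count) simp
      have "card ?S \<le> card {i. m i < real j + 1}"
        using g(2) cnt by (intro card_mono) auto
      then have S: "real (card ?S) \<le> C * (real j + 1)" using cnt by linarith
      have "real j + 1 \<le> 2 * exp (real j / 2)" using exp_ge_add_one_self[of "real j / 2"] by linarith
      have "(\<Sum>i\<in>?S. exp (- real (g i))) = real (card ?S) * exp (- real j)" by simp
      also have "\<dots> \<le> C * (real j + 1) * exp (- real j)" using S by (intro mult_right_mono) auto
      also have "\<dots> \<le> C * (2 * exp (real j / 2)) * exp (- real j)"
        using \<open>real j + 1 \<le> 2 * exp (real j / 2)\<close> C by (intro mult_right_mono mult_left_mono) auto
      also have "\<dots> = 2 * C * exp (- 1 / 2) ^ j" by (simp flip: exp_of_nat_mult exp_add)
      finally show "(\<Sum>i\<in>?S. exp (- real (g i))) \<le> 2 * C * exp (- 1 / 2) ^ j" .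
    qed
    also have "\<dots> = 2 * C * (\<Sum>j<T. exp (- 1 / 2) ^ j)" by (simp add: sum_distrib_left)
    also have "\<dots> \<le> 2 * C * (1 / (1 - exp (- 1 / 2)))"
    proof (rule mult_left_mono)
      have "(\<Sum>j<T. exp (- 1 / 2 :: real) ^ j) \<le> (\<Sum>j. exp (- 1 / 2) ^ j)"
        by (rule sum_le_suminf) (auto intro: summable_geometric)
      then show "(\<Sum>j<T. exp (- 1 / 2 :: real) ^ j) \<le> 1 / (1 - exp (- 1 / 2))"
        by (subst (asm) suminf_geometric) auto
    qed (use C in auto)
    finally show ?thesis by (simp add: mult_ac)
  qed
  have "(\<Sum>i. ennreal (exp (- m i))) + 0 \<le> ennreal (C * (2 / (1 - exp (- 1 / 2))))"
    by (rule ennreal_suminf_bound_add) (use fin in \<open>simp add: ennreal_leI\<close>)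
  then show ?thesis by simp
qed

text \<open>Shell i is enlarged to the ball of radius exp (- i); its volume, a constant times exp (-
  n i), cancels exp (n (i + 1)) up to the factor exp n. The comparison with a series of indicator
  functions admits an arbitrary \<open>G\<close> and replaces polar coordinates.\<close>

lemma ball_exp_integral_le:
  fixes G :: "real ^ 'n::finite \<Rightarrow> real" and m :: "nat \<Rightarrow> real"
  assumes n: "n = CARD('n)"
    and G: "\<And>x i. x \<noteq> 0 \<Longrightarrow> norm x < 1 \<Longrightarrow> real i \<le> - ln (norm x) \<Longrightarrow> - ln (norm x) < real i + 1 \<Longrightarrow>
        G x \<le> real n * (real i + 1) - m i"
  shows "(\<integral>\<^sup>+x\<in>ball 0 1. ennreal (exp (G x)) \<partial>lborel) \<le>
         ennreal (unit_ball_vol n * exp n) * (\<Sum>i. ennreal (exp (- m i)))"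
proof -
  define a where "a i = exp (real n * (real i + 1) - m i)" for i
  define B where "B i = cball (0 :: real ^ 'n) (exp (- real i))" for i :: nat
  have [measurable]: "B i \<in> sets borel" for i unfolding B_def by simp
  have "(\<integral>\<^sup>+x\<in>ball 0 1. ennreal (exp (G x)) \<partial>lborel) \<le> (\<integral>\<^sup>+x. (\<Sum>i. ennreal (a i) * indicator (B i) x) \<partial>lborel)"
  proof (rule nn_integral_mono_AE)
    have "AE x in lborel. x \<noteq> (0 :: real ^ 'n)" by (rule AE_lborel_singleton)
    then show "AE x in lborel. ennreal (exp (G x)) * indicator (ball 0 1) x \<le> (\<Sum>i. ennreal (a i) * indicator (B i) x)"
    proof eventually_elim
      fix x :: "real ^ 'n" assume x: "x \<noteq> 0"
      show "ennreal (exp (G x)) * indicator (ball 0 1) x \<le> (\<Sum>i. ennreal (a i) * indicator (B i) x)"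
      proof (cases "norm x < 1")
        case True
        define i where "i = nat \<lfloor>- ln (norm x)\<rfloor>"
        have "0 \<le> - ln (norm x)" using True x by simp
        then have i: "real i \<le> - ln (norm x)" "- ln (norm x) < real i + 1" unfolding i_def by linarith+
        then have "ln (norm x) \<le> - real i" by simp
        then have "norm x \<le> exp (- real i)" using x by (metis exp_le_cancel_iff exp_ln zero_less_norm_iff)
        then have "ennreal (exp (G x)) * indicator (ball 0 1) x \<le> ennreal (a i) * indicator (B i) x"
          using G[OF x True i] True unfolding a_def B_def by (simp add: ennreal_leI)
        also have "\<dots> \<le> (\<Sum>i. ennreal (a i) * indicator (B i) x)"
        proof -
          define h where "h i = ennreal (a i) * indicator (B i) x" for i
          have "h i \<le> (\<Sum>i. h i)" using sum_le_suminf[OF summableI, of "{i}" h] by simp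
          then show ?thesis unfolding h_def .
        qed
        finally show ?thesis .
      qed simp
    qed
  qed
  also have "\<dots> = (\<Sum>i. \<integral>\<^sup>+x. ennreal (a i) * indicator (B i) x \<partial>lborel)"
    by (rule nn_integral_suminf) measurable
  also have "\<dots> = (\<Sum>i. ennreal (unit_ball_vol n * exp n) * ennreal (exp (- m i)))"
  proof (rule suminf_cong)
    fix i
    have "(\<integral>\<^sup>+x. ennreal (a i) * indicator (B i) x \<partial>lborel) = ennreal (a i) * emeasure lborel (B i)"
      by (rule nn_integral_cmult_indicator) (auto simp: B_def)
    also have "emeasure lborel (B i) = ennreal (unit_ball_vol n * exp (- real i) ^ n)"
      unfolding B_def by (subst emeasure_cball) (auto simp: n)
    also have "ennreal (a i) * \<dots> = ennreal (a i * (unit_ball_vol n * exp (- real i) ^ n))"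
      by (rule ennreal_mult[symmetric]) (auto simp: a_def)
    also have "a i * (unit_ball_vol n * exp (- real i) ^ n) = unit_ball_vol n * exp n * exp (- m i)"
      unfolding a_def by (simp add: exp_add exp_diff exp_minus field_simps flip: exp_of_nat_mult)
    also have "ennreal \<dots> = ennreal (unit_ball_vol n * exp n) * ennreal (exp (- m i))"
      by (rule ennreal_mult) auto
    finally show "(\<integral>\<^sup>+x. ennreal (a i) * indicator (B i) x \<partial>lborel) = ennreal (unit_ball_vol n * exp n) * ennreal (exp (- m i))" .
  qed
  finally show ?thesis by simp
qed

text \<open>
  Hoelder's inequality, with \<open>p = k + 1\<close> and
  \<open>\<bar>g\<bar> = \<bar>g\<bar> (r (ln (1/r)) powr \<beta>) powr (k/p) \<cdot> (r (ln (1/r)) powr \<beta>) powr (-k/p)\<close>.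
\<close>

lemma increment_le_energy:
  fixes v g :: "real \<Rightarrow> real" and k :: nat and c \<beta> a b p I :: real
  assumes k: "k \<ge> 1" and p: "p = real k + 1" and beta: "0 \<le> \<beta>" "\<beta> < 1" and c: "c > 0"
    and ab: "0 < a" "a \<le> b" "b < 1" and g [measurable]: "g \<in> borel_measurable borel"
    and v: "ennreal \<bar>v b - v a\<bar> \<le> (\<integral>\<^sup>+x\<in>{a..b}. ennreal \<bar>g x\<bar> \<partial>lborel)"
    and I: "0 \<le> I" "(\<integral>\<^sup>+r\<in>{a..b}. ennreal (c * (r ^ k * \<bar>g r\<bar> ^ (k + 1) * ln (1 / r) powr (\<beta> * k))) \<partial>lborel) \<le> ennreal I"
  shows "c powr (1 / p) * (1 - \<beta>) powr (k / p) * \<bar>v b - v a\<bar> \<le>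
         I powr (1 / p) * (ln (1 / a) powr (1 - \<beta>) - ln (1 / b) powr (1 - \<beta>)) powr (k / p)"
proof -
  have k0: "real k > 0" and p0: "p > 1" using k p by auto
  define \<rho> where "\<rho> r = r * ln (1 / r) powr \<beta>" for r :: real
  have \<rho>: "\<rho> r > 0" if "r \<in> {a..b}" for r
    using that ab unfolding \<rho>_def by auto
  define A where "A r = \<bar>g r\<bar> * \<rho> r powr (k / p) * c powr (1 / p) * indicator {a..b} r" for r
  define B where "B r = \<rho> r powr (- k / p) * indicator {a..b} r" for r
  have [measurable]: "\<rho> \<in> borel_measurable borel" unfolding \<rho>_def by measurable
  have [measurable]: "A \<in> borel_measurable borel" "B \<in> borel_measurable borel" unfolding A_def B_def by measurable
  have AB: "A r * B r = c powr (1 / p) * \<bar>g r\<bar> * indicator {a..b} r" for r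
    using \<rho>[of r] unfolding A_def B_def by (auto simp: indicator_def powr_minus field_simps)
  have Ap: "A r powr p = c * (r ^ k * \<bar>g r\<bar> ^ (k + 1) * ln (1 / r) powr (\<beta> * k)) * indicator {a..b} r" for r
  proof (cases "r \<in> {a..b}")
    case True
    then have r: "r > 0" "r < 1" using ab by auto
    have "A r powr p = \<bar>g r\<bar> powr p * \<rho> r powr k * c"
      using True \<rho>[OF True] p0 c unfolding A_def by (simp add: powr_mult powr_powr)
    also have "\<bar>g r\<bar> powr p = \<bar>g r\<bar> ^ (k + 1)"
      unfolding p using powr_realpow'[of "\<bar>g r\<bar>" "k + 1"] by (simp add: add.commute)
    also have "\<rho> r powr k = r ^ k * ln (1 / r) powr (\<beta> * k)"
      unfolding \<rho>_def using r by (simp add: powr_mult powr_powr powr_realpow)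
    finally show ?thesis using True by (simp add: mult_ac)
  qed (simp add: A_def)
  \<comment> \<open>The integral of 1/\<rho>. In the variable t it is the integral of t powr (-
    \<beta>), which is where the factor 1 - \<beta> of the critical constant comes from.\<close>
  define J where "J = (ln (1 / a) powr (1 - \<beta>) - ln (1 / b) powr (1 - \<beta>)) / (1 - \<beta>)"
  have Bq: "B r powr (p / k) = 1 / \<rho> r * indicator {a..b} r" for r
  proof (cases "r \<in> {a..b}")
    case True
    then have "B r powr (p / k) = \<rho> r powr (- 1)" using k0 p0 unfolding B_def by (simp add: powr_powr)
    then show ?thesis using True \<rho>[OF True] by (simp add: powr_minus_divide)
  qed (simp add: B_def)
  have Jint: "(\<integral>\<^sup>+r. ennreal (1 / \<rho> r) * indicator {a..b} r \<partial>lborel) = ennreal J"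
  proof -
    define F where "F r = - (ln (1 / r) powr (1 - \<beta>) / (1 - \<beta>))" for r :: real
    have "(\<integral>\<^sup>+r. ennreal (1 / \<rho> r) * indicator {a..b} r \<partial>lborel) = ennreal (F b - F a)"
    proof (rule nn_integral_FTC_Icc)
      show "(\<lambda>r. 1 / \<rho> r) \<in> borel_measurable borel" by measurable
      show "0 \<le> 1 / \<rho> r" if "r \<in> {a..b}" for r using \<rho>[OF that] by simp
      show "(F has_real_derivative 1 / \<rho> r) (at r)" if "r \<in> {a..b}" for r
      proof -
        have r: "r > 0" "ln (1 / r) > 0" using that ab by auto
        have "((\<lambda>x. ln (1 / x)) has_real_derivative - (1 / r)) (at r)"
          using r by (auto intro!: derivative_eq_intros simp: field_simps power2_eq_square)
        then have "((\<lambda>x. ln (1 / x) powr (1 - \<beta>)) has_real_derivative (1 - \<beta>) * ln (1 / r) powr (1 - \<beta> - of_nat 1) * - (1 / r)) (at r)"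
          using r(2) by (rule DERIV_fun_powr)
        then have "(F has_real_derivative - ((1 - \<beta>) * ln (1 / r) powr (1 - \<beta> - of_nat 1) * - (1 / r) / (1 - \<beta>))) (at r)"
          unfolding F_def by (intro DERIV_minus DERIV_cdivide)
        also have "- ((1 - \<beta>) * ln (1 / r) powr (1 - \<beta> - of_nat 1) * - (1 / r) / (1 - \<beta>)) = 1 / \<rho> r"
          using r beta unfolding \<rho>_def by (simp add: powr_minus_divide)
        finally show ?thesis .
      qed
    qed (use ab in auto)
    also have "F b - F a = J" unfolding F_def J_def by (simp add: diff_divide_distrib)
    finally show ?thesis .
  qed
  have lnab: "0 < ln (1 / b)" "ln (1 / b) \<le> ln (1 / a)" using ab by (auto simp: ln_div)
  then have T0: "ln (1 / b) powr (1 - \<beta>) \<le> ln (1 / a) powr (1 - \<beta>)" using beta by (intro powr_mono2) auto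
  then have J0: "0 \<le> J" using beta unfolding J_def by simp
  have "ennreal (c powr (1 / p)) * ennreal \<bar>v b - v a\<bar> \<le> ennreal (c powr (1 / p)) * (\<integral>\<^sup>+x\<in>{a..b}. ennreal \<bar>g x\<bar> \<partial>lborel)"
    using v by (rule mult_left_mono) simp
  also have "\<dots> = (\<integral>\<^sup>+r. ennreal (A r * B r) \<partial>lborel)"
    by (subst nn_integral_cmult[symmetric]) (auto simp: AB indicator_def ennreal_mult intro!: nn_integral_cong)
  also have "\<dots> \<le> ennreal (I powr (1 / p) * J powr (1 / (p / k)))"
  proof (rule nn_integral_Hoelder[OF _ _ _ _ p0 _ _ I(1) J0])
    show "1 < p / k" "1 / p + 1 / (p / k) = 1" using k0 unfolding p by (auto simp: field_simps)
    show "(\<integral>\<^sup>+x. ennreal (A x powr p) \<partial>lborel) \<le> ennreal I"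
    proof -
      have "ennreal (A r powr p) = ennreal (c * (r ^ k * \<bar>g r\<bar> ^ (k + 1) * ln (1 / r) powr (\<beta> * k))) * indicator {a..b} r" for r
        unfolding Ap by (simp add: indicator_def)
      then show ?thesis using I(2) by simp
    qed
    show "(\<integral>\<^sup>+x. ennreal (B x powr (p / k)) \<partial>lborel) \<le> ennreal J"
      unfolding Bq Jint[symmetric] by (intro nn_integral_mono) (auto simp: indicator_def)
  qed (auto simp: A_def B_def)
  finally have "c powr (1 / p) * \<bar>v b - v a\<bar> \<le> I powr (1 / p) * J powr (k / p)"
    by (simp flip: ennreal_mult)
  then have "(1 - \<beta>) powr (k / p) * (c powr (1 / p) * \<bar>v b - v a\<bar>) \<le> (1 - \<beta>) powr (k / p) * (I powr (1 / p) * J powr (k / p))"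
    by (rule mult_left_mono) simp
  also have "\<dots> = I powr (1 / p) * ((1 - \<beta>) * J) powr (k / p)"
    using beta J0 by (simp add: powr_mult)
  also have "(1 - \<beta>) * J = ln (1 / a) powr (1 - \<beta>) - ln (1 / b) powr (1 - \<beta>)" unfolding J_def using beta by simp
  finally show ?thesis by (simp add: mult_ac)
qed

text \<open>The factors come from \<open>ball_exp_integral_le\<close>, from the counting of shells
  (threshold, \<open>Moser_gap\<close>, and 3 for rounding) and from
  \<open>suminf_exp_counting\<close>. Only \<open>k\<close> and \<beta> enter, so the bound is
  uniform on the unit ball of the norm.\<close>

definition Moser_const :: "nat \<Rightarrow> real \<Rightarrow> real" where
  "Moser_const k \<beta> = unit_ball_vol (2 * k) * exp (2 * k) *
     ((k * 8 ^ k + 1 / (1 - \<beta>) * 9 powr (1 / (1 - \<beta>) - 1) * k * 8 powr (k + 1) + 3) * (2 / (1 - exp (- 1 / 2))))"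

text \<open>
  \<open>\<gamma>\<close> and \<open>\<alpha>\<close> below are \<open>\<gamma>\<^bsub>n,\<beta>\<^esub>\<close> and \<open>\<alpha>\<^bsub>n,\<beta>\<^esub>\<close> for \<open>n = 2 k\<close>.
\<close>

lemma critical_exp_integral_bound:
  fixes c \<beta> \<alpha> \<gamma> :: real and k n :: nat and u :: "real ^ 'n::finite \<Rightarrow> real" and v g :: "real \<Rightarrow> real"
  assumes n: "n = CARD('n)" "n = 2 * k" and k: "k \<ge> 1" and beta: "0 \<le> \<beta>" "\<beta> < 1" and c: "c > 0"
    and gamma: "\<gamma> = (real k + 1) / (real k * (1 - \<beta>))"
    and alpha: "\<alpha> = real n * (c powr (1 / real k) * (1 - \<beta>)) powr (1 / (1 - \<beta>))"
    and u: "\<And>x. x \<noteq> 0 \<Longrightarrow> norm x < 1 \<Longrightarrow> u x = v (norm x)"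
    and g [measurable]: "g \<in> borel_measurable borel"
    and v: "\<And>a b. 0 < a \<Longrightarrow> a \<le> b \<Longrightarrow> b < 1 \<Longrightarrow> ennreal \<bar>v b - v a\<bar> \<le> (\<integral>\<^sup>+x\<in>{a..b}. ennreal \<bar>g x\<bar> \<partial>lborel)"
    and v1: "(v \<longlongrightarrow> 0) (at_left 1)"
    and E: "ennreal c * (\<integral>\<^sup>+r\<in>{0<..<1}. ennreal (r ^ k * \<bar>g r\<bar> ^ (k + 1) * ln (1 / r) powr (\<beta> * k)) \<partial>lborel) \<le> 1"
  shows "(\<integral>\<^sup>+x\<in>ball 0 1. ennreal (exp (\<alpha> * \<bar>u x\<bar> powr \<gamma>)) \<partial>lborel) \<le> ennreal (Moser_const k \<beta>)"
proof -
  define p where "p = real k + 1"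
  define m where "m = 1 / (1 - \<beta>)"
  have k0: "real k > 0" and p0: "p > 1" using k p_def by auto
  have m1: "m \<ge> 1" unfolding m_def using beta by simp
  have \<gamma>: "\<gamma> = p / k * m" unfolding gamma p_def m_def by simp
  have n1: "n \<ge> 1" using n k by simp
  define C\<^sub>1 where "C\<^sub>1 = real k * 8 ^ k"
  define C\<^sub>2 where "C\<^sub>2 = m * 9 powr (m - 1) * real k * 8 powr p"
  have C0: "C\<^sub>1 > 0" "C\<^sub>2 > 0" unfolding C\<^sub>1_def C\<^sub>2_def using k0 m1 by auto
  define w where "w r = ennreal (c * (r ^ k * \<bar>g r\<bar> ^ (k + 1) * ln (1 / r) powr (\<beta> * k)))" for r
  have [measurable]: "w \<in> borel_measurable borel" unfolding w_def by measurable
  have "w r * indicator {0<..<1} r = ennreal c * (ennreal (r ^ k * \<bar>g r\<bar> ^ (k + 1) * ln (1 / r) powr (\<beta> * k)) * indicator {0<..<1} r)" for r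
    unfolding w_def using c by (auto simp: indicator_def ennreal_mult)
  then have Ew: "(\<integral>\<^sup>+r\<in>{0<..<1}. w r \<partial>lborel) \<le> 1"
    using E by (simp add: nn_integral_cmult)
  \<comment> \<open>The energy as a measure on the radii, of total mass at most 1;
    \<open>e t\<close> below is the part carried by radii above exp (- t).\<close>
  define \<mu> where "\<mu> = density lborel (\<lambda>r. w r * indicator {0<..<1} r)"
  have \<mu>s: "sets \<mu> = sets borel" "space \<mu> = UNIV" unfolding \<mu>_def by auto
  have \<mu>: "emeasure \<mu> A = (\<integral>\<^sup>+r\<in>A. (w r * indicator {0<..<1} r) \<partial>lborel)" if "A \<in> sets borel" for A
    unfolding \<mu>_def using that by (subst emeasure_density) auto
  have \<mu>1: "emeasure \<mu> UNIV \<le> 1" using Ew by (subst \<mu>) auto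
  interpret \<mu>: finite_measure \<mu>
    by (rule finite_measureI) (use \<mu>1 \<mu>s in \<open>auto simp: top_unique\<close>)
  define e where "e t = measure \<mu> {exp (- t)<..}" for t :: real
  have e01: "0 \<le> e t" "e t \<le> 1" for t
  proof -
    have "measure \<mu> {exp (- t)<..} \<le> measure \<mu> UNIV" by (rule \<mu>.finite_measure_mono) (auto simp: \<mu>s)
    also have "\<dots> \<le> 1" using \<mu>1 unfolding measure_def by (simp add: enn2real_leI)
    finally show "e t \<le> 1" unfolding e_def .
  qed (simp add: e_def)
  \<comment> \<open>Half-open intervals make \<open>e\<close> exactly additive; the closed interval
    in Hoelder's bound differs from them by a null point.\<close>
  have e_diff: "e t - e s = measure \<mu> {exp (- t)<..exp (- s)}" if "s \<le> t" for s t
  proof -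
    have "{a<..} = {a<..b} \<union> {b<..}" if "a \<le> b" for a b :: real using that by auto
    then have eq: "{exp (- t)<..} = {exp (- t)<..exp (- s)} \<union> {exp (- s)<..}" using that by simp
    have "measure \<mu> ({exp (- t)<..exp (- s)} \<union> {exp (- s)<..}) = measure \<mu> {exp (- t)<..exp (- s)} + measure \<mu> {exp (- s)<..}"
      by (rule \<mu>.finite_measure_Union) (auto simp: \<mu>s)
    then have "e t = measure \<mu> {exp (- t)<..exp (- s)} + e s" unfolding e_def eq .
    then show ?thesis by simp
  qed
  have e_mono: "e s \<le> e t" if "s \<le> t" for s t using e_diff[OF that] by (metis diff_ge_0_iff_ge measure_nonneg)
  \<comment> \<open>Normalised so that Hoelder's inequality holds without constants and \<alpha> |v|
    powr \<gamma> becomes n times Y powr \<gamma>, as \<open>\<alpha>Y\<close> shows.\<close>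
  define Y where "Y t = c powr (1 / p) * (1 - \<beta>) powr (k / p) * \<bar>v (exp (- t))\<bar>" for t
  have Y0: "Y t \<ge> 0" for t unfolding Y_def by simp
  have Ydiff: "Y t \<le> Y s + (e t - e s) powr (1 / p) * (t powr (1 / m) - s powr (1 / m)) powr (k / p)" if "0 < s" "s \<le> t" for s t
  proof -
    have ab: "0 < exp (- t)" "exp (- t) \<le> exp (- s)" "exp (- s) < 1" using that by auto
    have "(\<integral>\<^sup>+r\<in>{exp (- t)..exp (- s)}. w r \<partial>lborel) = (\<integral>\<^sup>+r\<in>{exp (- t)<..exp (- s)}. (w r * indicator {0<..<1} r) \<partial>lborel)"
    proof (rule nn_integral_cong_AE)
      have "AE r in lborel. r \<noteq> exp (- t)" by (rule AE_lborel_singleton)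
      then show "AE r in lborel. w r * indicator {exp (- t)..exp (- s)} r = w r * indicator {0<..<1} r * indicator {exp (- t)<..exp (- s)} r"
      proof eventually_elim
        fix r assume "r \<noteq> exp (- t)"
        moreover have "r \<in> {0<..<1}" if "exp (- t) \<le> r" "r \<le> exp (- s)"
          using that ab by (meson greaterThanLessThan_iff le_less_trans less_le_trans)
        ultimately show "w r * indicator {exp (- t)..exp (- s)} r = w r * indicator {0<..<1} r * indicator {exp (- t)<..exp (- s)} r"
          by (auto simp: indicator_def)
      qed
    qed
    also have "\<dots> = ennreal (e t - e s)"
      unfolding e_diff[OF that(2)] \<mu>.emeasure_eq_measure[symmetric] by (subst \<mu>) auto
    finally have en: "(\<integral>\<^sup>+r\<in>{exp (- t)..exp (- s)}. w r \<partial>lborel) \<le> ennreal (e t - e s)" by simp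
    have "c powr (1 / p) * (1 - \<beta>) powr (k / p) * \<bar>v (exp (- s)) - v (exp (- t))\<bar> \<le>
       (e t - e s) powr (1 / p) * (ln (1 / exp (- t)) powr (1 - \<beta>) - ln (1 / exp (- s)) powr (1 - \<beta>)) powr (k / p)"
      by (rule increment_le_energy[OF k p_def beta c ab g]) (use v ab en e_mono[OF that(2)] in \<open>auto simp: w_def\<close>)
    then have d: "c powr (1 / p) * (1 - \<beta>) powr (k / p) * \<bar>v (exp (- s)) - v (exp (- t))\<bar> \<le>
       (e t - e s) powr (1 / p) * (t powr (1 / m) - s powr (1 / m)) powr (k / p)"
      by (simp add: ln_div m_def)
    have "\<bar>v (exp (- t))\<bar> \<le> \<bar>v (exp (- s))\<bar> + \<bar>v (exp (- s)) - v (exp (- t))\<bar>" by linarith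
    then have "Y t \<le> c powr (1 / p) * (1 - \<beta>) powr (k / p) * (\<bar>v (exp (- s))\<bar> + \<bar>v (exp (- s)) - v (exp (- t))\<bar>)"
      unfolding Y_def by (intro mult_left_mono) auto
    then show ?thesis using d unfolding Y_def by (simp add: distrib_left)
  qed
  \<comment> \<open>\<open>Ydiff\<close> in the limit of s tending to 0, where Y s tends to 0
    because the profile vanishes at the boundary.\<close>
  have Ybound: "Y t \<le> e t powr (1 / p) * (t powr (1 / m)) powr (k / p)" if "0 < t" for t
  proof -
    have "\<forall>\<^sub>F s in at_right 0. Y t \<le> Y s + e t powr (1 / p) * (t powr (1 / m)) powr (k / p)"
      unfolding eventually_at_right_field
    proof (intro exI[of _ t] conjI allI impI that)
      fix s assume s: "0 < s" "s < t"
      have "s powr (1 / m) \<le> t powr (1 / m)" using s m1 by (intro powr_mono2) auto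
      then have "(e t - e s) powr (1 / p) * (t powr (1 / m) - s powr (1 / m)) powr (k / p) \<le> e t powr (1 / p) * (t powr (1 / m)) powr (k / p)"
        using e_mono[of s t] s e01 p0 by (intro mult_mono powr_mono2) auto
      then show "Y t \<le> Y s + e t powr (1 / p) * (t powr (1 / m)) powr (k / p)" using Ydiff[of s t] s by linarith
    qed
    moreover have "(Y \<longlongrightarrow> 0) (at_right 0)"
    proof -
      have "filterlim (\<lambda>s::real. exp (- s)) (at_left 1) (at_right 0)" by real_asymp
      then have "((\<lambda>s. v (exp (- s))) \<longlongrightarrow> 0) (at_right 0)" using v1 by (rule filterlim_compose[rotated])
      then have "((\<lambda>s. c powr (1 / p) * (1 - \<beta>) powr (k / p) * \<bar>v (exp (- s))\<bar>) \<longlongrightarrow> c powr (1 / p) * (1 - \<beta>) powr (k / p) * \<bar>0\<bar>) (at_right 0)"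
        by (intro tendsto_intros)
      then show ?thesis unfolding Y_def[abs_def] by simp
    qed
    then have "((\<lambda>s. Y s + e t powr (1 / p) * (t powr (1 / m)) powr (k / p)) \<longlongrightarrow> 0 + e t powr (1 / p) * (t powr (1 / m)) powr (k / p)) (at_right 0)"
      by (intro tendsto_intros)
    ultimately have "Y t \<le> 0 + e t powr (1 / p) * (t powr (1 / m)) powr (k / p)"
      by (intro tendsto_lowerbound) auto
    then show ?thesis by simp
  qed
  define F where "F t = t - Y t powr \<gamma>" for t
  have F0: "F t \<ge> 0" if "0 < t" for t
  proof -
    have "e t powr (1 / p) \<le> 1" using e01 p0 by (intro powr_le1) auto
    then have "Y t \<le> (t powr (1 / m)) powr (k / p)"
      using Ybound[OF that] mult_right_mono[of "e t powr (1 / p)" 1 "(t powr (1 / m)) powr (k / p)"] by simp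
    then have "Y t powr \<gamma> \<le> ((t powr (1 / m)) powr (k / p)) powr \<gamma>"
      using Y0 k0 p0 m1 unfolding \<gamma> by (intro powr_mono2) auto
    also have "\<dots> = t" unfolding powr_powr \<gamma> using k0 p0 m1 that by simp
    finally show ?thesis unfolding F_def by simp
  qed
  have gap: "t\<^sub>2 - t\<^sub>1 \<le> C\<^sub>2 * L" if "C\<^sub>1 * L \<le> t\<^sub>1" "t\<^sub>1 \<le> t\<^sub>2" "F t\<^sub>1 \<le> L" "F t\<^sub>2 \<le> L" "0 < L" for t\<^sub>1 t\<^sub>2 L
  proof -
    have t1: "0 < t\<^sub>1" using that C0 by (meson less_le_trans mult_pos_pos)
    show ?thesis
      unfolding C\<^sub>2_def
      by (rule Moser_gap[OF k p_def m1 \<open>0 < L\<close> _ that(2) e01(1) e_mono[OF that(2)] e01(2) Y0 Y0 Ybound Ybound Ydiff])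
        (use that t1 in \<open>auto simp: C\<^sub>1_def F_def \<gamma>\<close>)
  qed
  \<comment> \<open>The infimum of the defect over one shell. t = 0 is removed from the first shell
    because it corresponds to r = 1, about which \<open>F0\<close> says nothing.\<close>
  define m' where "m' i = (INF t\<in>{real i..<real i + 1} \<inter> {0<..}. F t)" for i :: nat
  have ne: "{real i..<real i + 1} \<inter> {0<..} \<noteq> {}" for i :: nat
  proof -
    have "real i + 1/2 \<in> {real i..<real i + 1} \<inter> {0<..}" by auto
    then show ?thesis by blast
  qed
  have bdd: "bdd_below (F ` ({real i..<real i + 1} \<inter> {0<..}))" for i :: nat
    by (rule bdd_belowI2[of _ 0]) (use F0 in auto)
  have m'0: "0 \<le> m' i" for i
    unfolding m'_def by (rule cINF_greatest[OF ne]) (use F0 in auto)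
  have m'F: "m' i \<le> F t" if "0 < t" "real i \<le> t" "t < real i + 1" for i t
    unfolding m'_def using that by (intro cINF_lower bdd) auto
  have m'L: "\<exists>t. real i \<le> t \<and> t < real i + 1 \<and> 0 < t \<and> F t \<le> L" if "m' i < L" for i L
    using that cINF_less_iff[OF ne bdd, of i L] unfolding m'_def by fastforce
  \<comment> \<open>\<open>J\<^sub>1\<close> collects the shells below the threshold of
    \<open>gap\<close>; the others form \<open>J\<^sub>2\<close> and by \<open>gap\<close> have
    representatives within a distance \<open>C\<^sub>2 * L\<close> of the first. The summand 3 pays
    for rounding, one in \<open>J\<^sub>1\<close> and two in \<open>J\<^sub>2\<close>.\<close>
  have count: "finite {i. m' i < L} \<and> real (card {i. m' i < L}) \<le> (C\<^sub>1 + C\<^sub>2 + 3) * L" if L: "1 \<le> L" for L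
  proof -
    define \<tau> where "\<tau> i = (SOME t. real i \<le> t \<and> t < real i + 1 \<and> 0 < t \<and> F t \<le> L)" for i
    have \<tau>: "real i \<le> \<tau> i \<and> \<tau> i < real i + 1 \<and> 0 < \<tau> i \<and> F (\<tau> i) \<le> L" if "m' i < L" for i
      using someI_ex[OF m'L[OF that]] unfolding \<tau>_def .
    define J\<^sub>1 where "J\<^sub>1 = {i. m' i < L \<and> \<tau> i < C\<^sub>1 * L}"
    define J\<^sub>2 where "J\<^sub>2 = {i. m' i < L \<and> C\<^sub>1 * L \<le> \<tau> i}"
    have J: "{i. m' i < L} = J\<^sub>1 \<union> J\<^sub>2" unfolding J\<^sub>1_def J\<^sub>2_def by auto
    have CL: "C\<^sub>1 * L > 0" "C\<^sub>2 * L > 0" using C0 L by auto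
    have J1: "J\<^sub>1 \<subseteq> {..nat \<lfloor>C\<^sub>1 * L\<rfloor>}"
    proof
      fix i assume "i \<in> J\<^sub>1"
      then have "real i < C\<^sub>1 * L" using \<tau>[of i] unfolding J\<^sub>1_def by auto
      then show "i \<in> {..nat \<lfloor>C\<^sub>1 * L\<rfloor>}" by (simp add: le_nat_floor)
    qed
    then have 1: "finite J\<^sub>1" "real (card J\<^sub>1) \<le> C\<^sub>1 * L + 1"
    proof -
      show "finite J\<^sub>1" using J1 finite_subset by blast
      have "card J\<^sub>1 \<le> nat \<lfloor>C\<^sub>1 * L\<rfloor> + 1" using card_mono[OF _ J1] by simp
      moreover have "real (nat \<lfloor>C\<^sub>1 * L\<rfloor>) \<le> C\<^sub>1 * L" using CL by (simp add: of_nat_floor)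
      ultimately show "real (card J\<^sub>1) \<le> C\<^sub>1 * L + 1" by linarith
    qed
    have 2: "finite J\<^sub>2 \<and> real (card J\<^sub>2) \<le> C\<^sub>2 * L + 2"
    proof (cases "J\<^sub>2 = {}")
      case False
      define i\<^sub>0 where "i\<^sub>0 = (LEAST i. i \<in> J\<^sub>2)"
      have i0: "i\<^sub>0 \<in> J\<^sub>2" "\<And>i. i \<in> J\<^sub>2 \<Longrightarrow> i\<^sub>0 \<le> i" unfolding i\<^sub>0_def using False by (auto intro: LeastI Least_le)
      have J2: "J\<^sub>2 \<subseteq> {i\<^sub>0..i\<^sub>0 + nat \<lfloor>C\<^sub>2 * L + 1\<rfloor>}"
      proof
        fix i assume i: "i \<in> J\<^sub>2"
        have a: "m' i < L" "C\<^sub>1 * L \<le> \<tau> i" "m' i\<^sub>0 < L" "C\<^sub>1 * L \<le> \<tau> i\<^sub>0" using i i0(1) unfolding J\<^sub>2_def by auto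
        have "\<tau> i - \<tau> i\<^sub>0 \<le> C\<^sub>2 * L"
        proof (cases "\<tau> i\<^sub>0 \<le> \<tau> i")
          case True
          then show ?thesis using gap[of L "\<tau> i\<^sub>0" "\<tau> i"] a \<tau>[OF a(1)] \<tau>[OF a(3)] L by auto
        qed (use CL in linarith)
        then have "real i - real i\<^sub>0 \<le> C\<^sub>2 * L + 1" using \<tau>[OF a(1)] \<tau>[OF a(3)] by linarith
        then have "real (i - i\<^sub>0) \<le> C\<^sub>2 * L + 1" using i0(2)[OF i] by simp
        then have "i - i\<^sub>0 \<le> nat \<lfloor>C\<^sub>2 * L + 1\<rfloor>" by (rule le_nat_floor)
        then show "i \<in> {i\<^sub>0..i\<^sub>0 + nat \<lfloor>C\<^sub>2 * L + 1\<rfloor>}" using i0(2)[OF i] by auto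
      qed
      have "card J\<^sub>2 \<le> nat \<lfloor>C\<^sub>2 * L + 1\<rfloor> + 1" using card_mono[OF _ J2] by simp
      moreover have "real (nat \<lfloor>C\<^sub>2 * L + 1\<rfloor>) \<le> C\<^sub>2 * L + 1" using CL by (simp add: of_nat_floor)
      ultimately show ?thesis using J2 finite_subset by fastforce
    qed (use CL in auto)
    have "card (J\<^sub>1 \<union> J\<^sub>2) \<le> card J\<^sub>1 + card J\<^sub>2" by (rule card_Un_le)
    then have "real (card (J\<^sub>1 \<union> J\<^sub>2)) \<le> C\<^sub>1 * L + C\<^sub>2 * L + 3" using 1 2 by linarith
    also have "\<dots> \<le> (C\<^sub>1 + C\<^sub>2 + 3) * L" using L by (simp add: distrib_right)
    finally show ?thesis unfolding J using 1 2 by auto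
  qed
  have \<alpha>Y: "\<alpha> * \<bar>v (exp (- t))\<bar> powr \<gamma> = real n * Y t powr \<gamma>" for t
  proof -
    have "Y t powr \<gamma> = (c powr (1 / p)) powr \<gamma> * ((1 - \<beta>) powr (k / p)) powr \<gamma> * \<bar>v (exp (- t))\<bar> powr \<gamma>"
      unfolding Y_def by (simp add: powr_mult)
    also have "(c powr (1 / p)) powr \<gamma> = (c powr (1 / k)) powr (1 / (1 - \<beta>))"
      unfolding powr_powr \<gamma> m_def using p0 by simp
    also have "((1 - \<beta>) powr (k / p)) powr \<gamma> = (1 - \<beta>) powr (1 / (1 - \<beta>))"
      unfolding powr_powr \<gamma> m_def using p0 k0 by simp
    finally show ?thesis unfolding alpha using beta by (simp add: powr_mult)
  qed
  have "(\<integral>\<^sup>+x\<in>ball 0 1. ennreal (exp (\<alpha> * \<bar>u x\<bar> powr \<gamma>)) \<partial>lborel) \<le>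
       ennreal (unit_ball_vol n * exp n) * (\<Sum>i. ennreal (exp (- m' i)))"
  proof (rule ball_exp_integral_le[OF n(1)])
    fix x :: "real ^ 'n" and i :: nat
    assume x: "x \<noteq> 0" "norm x < 1" and i: "real i \<le> - ln (norm x)" "- ln (norm x) < real i + 1"
    define t where "t = - ln (norm x)"
    have t: "0 < t" "norm x = exp (- t)" using x by (auto simp: t_def)
    have ux: "u x = v (exp (- t))" using u x t by auto
    have "m' i \<le> real n * m' i" using n1 m'0[of i] by (simp add: mult_le_cancel_right1)
    also have "\<dots> \<le> real n * F t" using m'F[OF t(1)] i unfolding t_def by (intro mult_left_mono) auto
    also have "\<dots> = real n * t - \<alpha> * \<bar>u x\<bar> powr \<gamma>" unfolding ux \<alpha>Y F_def by (simp add: right_diff_distrib)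
    also have "real n * t \<le> real n * (real i + 1)" using i unfolding t_def by (intro mult_left_mono) auto
    finally show "\<alpha> * \<bar>u x\<bar> powr \<gamma> \<le> real n * (real i + 1) - m' i" by simp
  qed
  also have "\<dots> \<le> ennreal (unit_ball_vol n * exp n) * ennreal ((C\<^sub>1 + C\<^sub>2 + 3) * (2 / (1 - exp (- 1 / 2))))"
    using C0 by (intro mult_left_mono suminf_exp_counting m'0 count) auto
  also have "\<dots> = ennreal (unit_ball_vol n * exp n * ((C\<^sub>1 + C\<^sub>2 + 3) * (2 / (1 - exp (- 1 / 2)))))"
    using C0 by (intro ennreal_mult[symmetric]) auto
  also have "unit_ball_vol n * exp n * ((C\<^sub>1 + C\<^sub>2 + 3) * (2 / (1 - exp (- 1 / 2)))) = Moser_const k \<beta>"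
    unfolding Moser_const_def C\<^sub>1_def C\<^sub>2_def m_def p_def n(2) by (simp add: add.commute)
  finally show ?thesis .
qed


section \<open>Radial admissible functions\<close>

text \<open>Identity rows outside \<open>I\<close> annihilate every permutation that moves a point
  there. As a full determinant the minor becomes accessible to multilinearity in the rows.\<close>

lemma principal_minor_eq_det:
  fixes A :: "real ^ 'n::finite ^ 'n"
  shows "principal_minor I A = det (\<chi> i. if i \<in> I then A $ i else axis i 1)"
proof -
  let ?M = "(\<chi> i. if i \<in> I then A $ i else axis i 1) :: real ^ 'n ^ 'n"
  let ?f = "\<lambda>p. of_int (sign p) * (\<Prod>i\<in>UNIV. ?M $ i $ p i)"
  have "det ?M = (\<Sum>p | p permutes UNIV. ?f p)" unfolding det_def by simp
  also have "\<dots> = (\<Sum>p | p permutes I. ?f p)"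
  proof (rule sum.mono_neutral_right)
    show "{p. p permutes I} \<subseteq> {p. p permutes (UNIV :: 'n set)}" using permutes_subset by blast
    show "\<forall>p\<in>{p. p permutes UNIV} - {p. p permutes I}. ?f p = 0"
    proof
      fix p assume p: "p \<in> {p. p permutes UNIV} - {p. p permutes I}"
      then obtain i where i: "i \<notin> I" "p i \<noteq> i" by (auto simp: permutes_def)
      then have "?M $ i $ p i = 0" by (simp add: axis_def)
      then have "(\<Prod>i\<in>UNIV. ?M $ i $ p i) = 0" by (meson UNIV_I finite_class.finite_UNIV prod_zero)
      then show "?f p = 0" by simp
    qed
  qed simp
  also have "\<dots> = principal_minor I A"
    unfolding principal_minor_def
  proof (rule sum.cong[OF refl])
    fix p assume "p \<in> {p. p permutes I}"
    then have p: "p i = i" if "i \<notin> I" for i using that by (simp add: permutes_def)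
    have "(\<Prod>i\<in>UNIV. ?M $ i $ p i) = (\<Prod>i\<in>I. A $ i $ p i)"
      by (rule prod.mono_neutral_cong_right) (auto simp: p axis_def)
    then show "?f p = of_int (sign p) * (\<Prod>i\<in>I. A $ i $ p i)" by simp
  qed
  finally show ?thesis by simp
qed

lemma det_identity_row:
  fixes x :: "real ^ 'n::finite"
  shows "det ((\<chi> i. if i = m then x else axis i 1) :: real ^ 'n ^ 'n) = x $ m"
proof -
  have row: "row i (mat 1 :: real ^ 'n ^ 'n) = axis i 1" for i
    by (simp add: row_def mat_def axis_def vec_eq_iff)
  show ?thesis
    using cramer_lemma_transpose[of m x "mat 1 :: real ^ 'n ^ 'n"] unfolding row basis_expansion by simp
qed

text \<open>Since \<open>x\<close> itself is row \<open>m\<close>, the multiples of \<open>x\<close>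
  in the other rows produce determinants with two proportional rows, and \<open>b\<close> drops
  out.\<close>

lemma det_rank_one_rows_aux:
  fixes x :: "real ^ 'n::finite" and a b :: real
  assumes "finite I" "m \<notin> I"
  shows "det ((\<chi> i. if i = m then x else if i \<in> I then a *s axis i 1 + (b * x $ i) *s x else axis i 1) :: real ^ 'n ^ 'n)
    = a ^ card I * x $ m"
  using assms
proof (induction I rule: finite_induct)
  case empty
  then show ?case by (simp add: det_identity_row cong: if_cong)
next
  case (insert j I)
  let ?R = "\<lambda>i. if i = m then x else if i \<in> I then a *s axis i 1 + (b * x $ i) *s x else axis i 1"
  have jm: "j \<noteq> m" using insert by auto
  have 1: "(\<chi> i. if i = m then x else if i \<in> insert j I then a *s axis i 1 + (b * x $ i) *s x else axis i 1)
      = ((\<chi> i. if i = j then a *s axis i 1 + (b * x $ i) *s x else ?R i) :: real ^ 'n ^ 'n)"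
    using jm by (auto simp: vec_eq_iff)
  have 2: "det ((\<chi> i. if i = j then a *s axis i 1 + (b * x $ i) *s x else ?R i) :: real ^ 'n ^ 'n) =
      a * det ((\<chi> i. if i = j then axis i 1 else ?R i) :: real ^ 'n ^ 'n) +
      det ((\<chi> i. if i = j then (b * x $ i) *s x else ?R i) :: real ^ 'n ^ 'n)"
    by (simp only: det_row_add det_row_mul)
  have 3: "(\<chi> i. if i = j then (b * x $ i) *s x else ?R i) = ((\<chi> i. if i = j then (b * x $ j) *s x else ?R i) :: real ^ 'n ^ 'n)"
    by (auto simp: vec_eq_iff)
  have 4: "det ((\<chi> i. if i = j then (b * x $ j) *s x else ?R i) :: real ^ 'n ^ 'n) = (b * x $ j) * det ((\<chi> i. if i = j then x else ?R i) :: real ^ 'n ^ 'n)"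
    by (simp only: det_row_mul)
  have 5: "det ((\<chi> i. if i = j then x else ?R i) :: real ^ 'n ^ 'n) = 0"
    using jm by (intro det_identical_rows[of j m]) (auto simp: row_def)
  have 6: "(\<chi> i. if i = j then axis i 1 else ?R i) = ((\<chi> i. ?R i) :: real ^ 'n ^ 'n)"
    using insert(2) jm by (auto simp: vec_eq_iff)
  have "m \<notin> I" using insert by blast
  then show ?case unfolding 1 2 3 4 5 6 insert.IH[OF \<open>m \<notin> I\<close>] using insert(1,2) by simp
qed

text \<open>The matrix determinant lemma in a form free of division, so that a = 0 is covered. For
  empty \<open>I\<close> the truncated exponent \<open>card I - 1\<close> meets an empty
  sum.\<close>

lemma det_rank_one_rows:
  fixes x :: "real ^ 'n::finite" and a b :: real
  assumes "finite I"
  shows "det ((\<chi> i. if i \<in> I then a *s axis i 1 + (b * x $ i) *s x else axis i 1) :: real ^ 'n ^ 'n)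
    = a ^ card I + b * a ^ (card I - 1) * (\<Sum>i\<in>I. (x $ i)\<^sup>2)"
  using assms
proof (induction I rule: finite_induct)
  case empty
  have "(\<chi> i. axis i 1) = (mat 1 :: real ^ 'n ^ 'n)" by (simp add: mat_def axis_def vec_eq_iff)
  then show ?case by simp
next
  case (insert j I)
  let ?R = "\<lambda>i. if i \<in> I then a *s axis i 1 + (b * x $ i) *s x else axis i 1"
  have 1: "(\<chi> i. if i \<in> insert j I then a *s axis i 1 + (b * x $ i) *s x else axis i 1)
      = ((\<chi> i. if i = j then a *s axis i 1 + (b * x $ i) *s x else ?R i) :: real ^ 'n ^ 'n)"
    by (auto simp: vec_eq_iff)
  have 2: "det ((\<chi> i. if i = j then a *s axis i 1 + (b * x $ i) *s x else ?R i) :: real ^ 'n ^ 'n) =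
      a * det ((\<chi> i. if i = j then axis i 1 else ?R i) :: real ^ 'n ^ 'n) +
      det ((\<chi> i. if i = j then (b * x $ i) *s x else ?R i) :: real ^ 'n ^ 'n)"
    by (simp only: det_row_add det_row_mul)
  have 3: "(\<chi> i. if i = j then (b * x $ i) *s x else ?R i) = ((\<chi> i. if i = j then (b * x $ j) *s x else ?R i) :: real ^ 'n ^ 'n)"
    by (auto simp: vec_eq_iff)
  have 4: "det ((\<chi> i. if i = j then (b * x $ j) *s x else ?R i) :: real ^ 'n ^ 'n) = (b * x $ j) * det ((\<chi> i. if i = j then x else ?R i) :: real ^ 'n ^ 'n)"
    by (simp only: det_row_mul)
  have 5: "det ((\<chi> i. if i = j then x else ?R i) :: real ^ 'n ^ 'n) = a ^ card I * x $ j"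
    using insert by (intro det_rank_one_rows_aux) auto
  have 6: "(\<chi> i. if i = j then axis i 1 else ?R i) = ((\<chi> i. ?R i) :: real ^ 'n ^ 'n)"
    using insert(2) by (auto simp: vec_eq_iff)
  have "det ((\<chi> i. if i \<in> insert j I then a *s axis i 1 + (b * x $ i) *s x else axis i 1) :: real ^ 'n ^ 'n)
     = a * (a ^ card I + b * a ^ (card I - 1) * (\<Sum>i\<in>I. (x $ i)\<^sup>2)) + b * x $ j * (a ^ card I * x $ j)"
    unfolding 1 2 3 4 5 6 insert.IH ..
  also have "a * (a ^ card I + b * a ^ (card I - 1) * (\<Sum>i\<in>I. (x $ i)\<^sup>2)) = a ^ card (insert j I) + b * a ^ card I * (\<Sum>i\<in>I. (x $ i)\<^sup>2)"
  proof (cases "I = {}")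
    case False
    then have "card I > 0" using insert(1) by (simp add: card_gt_0_iff)
    then have "a * a ^ (card I - 1) = a ^ card I" by (metis power_eq_if not_gr_zero)
    then show ?thesis using insert by (simp add: distrib_left mult_ac)
  qed simp
  finally show ?case using insert by (simp add: algebra_simps power2_eq_square)
qed

lemma card_subsets_containing:
  assumes "finite A" "i \<in> A"
  shows "card {I. I \<subseteq> A \<and> card I = Suc j \<and> i \<in> I} = (card A - 1) choose j"
proof -
  have "bij_betw (insert i) {J. J \<subseteq> A - {i} \<and> card J = j} {I. I \<subseteq> A \<and> card I = Suc j \<and> i \<in> I}"
  proof (rule bij_betw_byWitness[where f' = "\<lambda>I. I - {i}"])
    show "insert i ` {J. J \<subseteq> A - {i} \<and> card J = j} \<subseteq> {I. I \<subseteq> A \<and> card I = Suc j \<and> i \<in> I}"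
    proof
      fix I assume "I \<in> insert i ` {J. J \<subseteq> A - {i} \<and> card J = j}"
      then obtain J where J: "I = insert i J" "J \<subseteq> A - {i}" "card J = j" by blast
      then have "finite J" "i \<notin> J" using assms finite_subset by blast+
      then have "card I = Suc j" using J by simp
      moreover have "I \<subseteq> A" "i \<in> I" using J assms by blast+
      ultimately show "I \<in> {I. I \<subseteq> A \<and> card I = Suc j \<and> i \<in> I}" by blast
    qed
    show "(\<lambda>I. I - {i}) ` {I. I \<subseteq> A \<and> card I = Suc j \<and> i \<in> I} \<subseteq> {J. J \<subseteq> A - {i} \<and> card J = j}"
      by auto
  qed auto
  then have "card {I. I \<subseteq> A \<and> card I = Suc j \<and> i \<in> I} = card {J. J \<subseteq> A - {i} \<and> card J = j}"
    by (rule bij_betw_same_card[symmetric])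
  also have "\<dots> = card (A - {i}) choose j" using assms by (intro n_subsets) auto
  finally show ?thesis using assms by simp
qed

text \<open>Double counting: the square of the i-th coordinate occurs once for each of the C(n - 1,
  j - 1) index sets that contain i.\<close>

lemma S_minors_rank_one:
  fixes x :: "real ^ 'n::finite" and a b :: real
  assumes "j \<ge> 1"
  shows "S_minors j ((\<chi> i l. (if i = l then a else 0) + b * x $ i * x $ l) :: real ^ 'n ^ 'n)
    = a ^ (j - 1) * (real (CARD('n) choose j) * a + real ((CARD('n) - 1) choose (j - 1)) * b * (x \<bullet> x))"
proof -
  obtain j' where j: "j = Suc j'" using assms by (cases j) auto
  let ?A = "(\<chi> i l. (if i = l then a else 0) + b * x $ i * x $ l) :: real ^ 'n ^ 'n"
  have "principal_minor I ?A = a ^ card I + b * a ^ (card I - 1) * (\<Sum>i\<in>I. (x $ i)\<^sup>2)" for I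
  proof -
    have "principal_minor I ?A = det ((\<chi> i. if i \<in> I then a *s axis i 1 + (b * x $ i) *s x else axis i 1) :: real ^ 'n ^ 'n)"
      unfolding principal_minor_eq_det by (rule arg_cong[of _ _ det]) (auto simp: vec_eq_iff axis_def)
    then show ?thesis by (simp add: det_rank_one_rows)
  qed
  then have "S_minors j ?A = (\<Sum>I | I \<subseteq> (UNIV :: 'n set) \<and> card I = j. a ^ j + b * a ^ (j - 1) * (\<Sum>i\<in>I. (x $ i)\<^sup>2))"
    unfolding S_minors_def by (intro sum.cong) auto
  also have "\<dots> = real (CARD('n) choose j) * a ^ j + b * a ^ (j - 1) * (\<Sum>I | I \<subseteq> (UNIV :: 'n set) \<and> card I = j. \<Sum>i\<in>I. (x $ i)\<^sup>2)"
    by (simp only: sum.distrib sum_distrib_left sum_constant n_subsets[OF finite_class.finite_UNIV])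
  also have "(\<Sum>I | I \<subseteq> (UNIV :: 'n set) \<and> card I = j. \<Sum>i\<in>I. (x $ i)\<^sup>2) =
     (\<Sum>I | I \<subseteq> (UNIV :: 'n set) \<and> card I = j. \<Sum>i | i \<in> UNIV \<and> i \<in> I. (x $ i)\<^sup>2)" by simp
  also have "\<dots> = (\<Sum>i\<in>UNIV. \<Sum>I | I \<in> {I. I \<subseteq> (UNIV :: 'n set) \<and> card I = j} \<and> i \<in> I. (x $ i)\<^sup>2)"
    by (rule sum.swap_restrict) auto
  also have "\<dots> = (\<Sum>i\<in>UNIV. real ((CARD('n) - 1) choose (j - 1)) * (x $ i)\<^sup>2)"
  proof (rule sum.cong[OF refl])
    fix i :: 'n
    have "{I. I \<in> {I. I \<subseteq> (UNIV :: 'n set) \<and> card I = j} \<and> i \<in> I} = {I. I \<subseteq> (UNIV :: 'n set) \<and> card I = Suc j' \<and> i \<in> I}"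
      using j by auto
    then show "(\<Sum>I | I \<in> {I. I \<subseteq> (UNIV :: 'n set) \<and> card I = j} \<and> i \<in> I. (x $ i)\<^sup>2) = real ((CARD('n) - 1) choose (j - 1)) * (x $ i)\<^sup>2"
      using card_subsets_containing[of "UNIV :: 'n set" i j'] j by simp
  qed
  also have "\<dots> = real ((CARD('n) - 1) choose (j - 1)) * (x \<bullet> x)"
    by (simp add: sum_distrib_left[symmetric] inner_vec_def power2_eq_square)
  finally show ?thesis unfolding j by (simp add: algebra_simps)
qed

text \<open>From n C(n - 1, j - 1) = j C(n, j) and 2 j \<le> n one gets 2 C(n - 1, j - 1) \<le> C(n,
  j), with equality for j = n/2. A single condition on \<open>a\<close> and \<open>b\<close> thus
  settles all j up to n/2.\<close>

lemma S_minors_rank_one_nonneg: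
  fixes x :: "real ^ 'n::finite" and a b :: real
  assumes j: "1 \<le> j" "2 * j \<le> CARD('n)" and a: "0 \<le> a" and ab: "0 \<le> 2 * a + b * (x \<bullet> x)"
  shows "0 \<le> S_minors j ((\<chi> i l. (if i = l then a else 0) + b * x $ i * x $ l) :: real ^ 'n ^ 'n)"
proof -
  obtain j' where j': "j = Suc j'" using j by (cases j) auto
  let ?N = "(CARD('n) - 1) choose (j - 1)"
  have "Suc (CARD('n) - 1) * ((CARD('n) - 1) choose j') = Suc j' * (Suc (CARD('n) - 1) choose Suc j')"
    by (rule Suc_times_binomial_eq[simplified mult.commute[of _ "Suc _"]])
  then have "CARD('n) * ?N = j * (CARD('n) choose j)" using j j' by simp
  then have eq: "real CARD('n) * real ?N = real j * real (CARD('n) choose j)" by (metis of_nat_mult)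
  have "real (2 * j) * real ?N \<le> real CARD('n) * real ?N"
    using j(2) by (intro mult_right_mono of_nat_mono) auto
  then have "real j * (2 * real ?N) \<le> real CARD('n) * real ?N" by simp
  then have "2 * real ?N \<le> real (CARD('n) choose j)" unfolding eq using j by (metis mult_le_cancel_left_pos of_nat_0_less_iff zero_less_one order_less_le_trans less_numeral_extra(1))
  then have "2 * real ?N * a \<le> real (CARD('n) choose j) * a" using a by (rule mult_right_mono)
  moreover have "0 \<le> real ?N * (2 * a + b * (x \<bullet> x))" using ab by simp
  ultimately have "0 \<le> real (CARD('n) choose j) * a + real ?N * b * (x \<bullet> x)" by (simp add: algebra_simps)
  then show ?thesis unfolding S_minors_rank_one[OF j(1)] using a by simp
qed

section \<open>Hessians of functions of |x|^2\<close>

lemma frechet_derivativeI: "(f has_derivative f') (at x) \<Longrightarrow> frechet_derivative f (at x) = f'"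
  using frechet_derivative_at by metis

lemma inner_self_ball: "x \<in> ball 0 1 \<Longrightarrow> 0 \<le> x \<bullet> x \<and> x \<bullet> x < (1::real)" for x :: "real ^ 'n::finite"
  by (simp add: power2_norm_eq_inner[symmetric] power_less_one_iff abs_square_less_1)

context
  fixes g g' g'' :: "real \<Rightarrow> real"
  assumes g': "\<And>s. 0 \<le> s \<Longrightarrow> s < 1 \<Longrightarrow> (g has_real_derivative g' s) (at s)"
    and g'': "\<And>s. 0 \<le> s \<Longrightarrow> s < 1 \<Longrightarrow> (g' has_real_derivative g'' s) (at s)"
    and cont: "continuous_on {0..<1} g''"
begin

lemma has_derivative_radial:
  fixes x :: "real ^ 'n::finite"
  assumes "x \<in> ball 0 1"
  shows "((\<lambda>x. g (x \<bullet> x)) has_derivative (\<lambda>h. g' (x \<bullet> x) * (2 * (x \<bullet> h)))) (at x)"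
proof -
  have "((\<lambda>x. x \<bullet> x) has_derivative (\<lambda>h. 2 * (x \<bullet> h))) (at x)"
    by (auto intro!: derivative_eq_intros simp: inner_commute)
  moreover have "(g has_derivative (*) (g' (x \<bullet> x))) (at (x \<bullet> x))"
    using g' inner_self_ball[OF assms] by (simp add: has_field_derivative_def)
  ultimately show ?thesis using has_derivative_compose by fastforce
qed

lemma partial_deriv_radial:
  fixes x :: "real ^ 'n::finite"
  assumes "x \<in> ball 0 1"
  shows "partial_deriv i (\<lambda>x. g (x \<bullet> x)) x = 2 * x $ i * g' (x \<bullet> x)"
  unfolding partial_deriv_def frechet_derivativeI[OF has_derivative_radial[OF assms]]
  by (simp add: inner_axis)

lemma has_derivative_partial_deriv_radial:
  fixes x :: "real ^ 'n::finite"
  assumes x: "x \<in> ball 0 1"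
  shows "(partial_deriv j (\<lambda>x. g (x \<bullet> x)) has_derivative
     (\<lambda>h. 2 * h $ j * g' (x \<bullet> x) + 2 * x $ j * (g'' (x \<bullet> x) * (2 * (x \<bullet> h))))) (at x)"
proof (rule has_derivative_transform_within_open[OF _ open_ball x])
  have "((\<lambda>x. x \<bullet> x) has_derivative (\<lambda>h. 2 * (x \<bullet> h))) (at x)"
    by (auto intro!: derivative_eq_intros simp: inner_commute)
  moreover have "(g' has_derivative (*) (g'' (x \<bullet> x))) (at (x \<bullet> x))"
    using g'' inner_self_ball[OF x] by (simp add: has_field_derivative_def)
  ultimately have *: "((\<lambda>x. g' (x \<bullet> x)) has_derivative (\<lambda>h. g'' (x \<bullet> x) * (2 * (x \<bullet> h)))) (at x)"
    using has_derivative_compose by fastforce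
  have "((\<lambda>x. x $ j) has_derivative (\<lambda>h. h $ j)) (at x)"
    by (rule bounded_linear_imp_has_derivative) (rule bounded_linear_vec_nth)
  from has_derivative_mult[OF has_derivative_mult[OF has_derivative_const[of 2] this] *]
  show "((\<lambda>x. 2 * x $ j * g' (x \<bullet> x)) has_derivative
     (\<lambda>h. 2 * h $ j * g' (x \<bullet> x) + 2 * x $ j * (g'' (x \<bullet> x) * (2 * (x \<bullet> h))))) (at x)"
    by (simp add: add.commute)
qed (simp add: partial_deriv_radial)

text \<open>Writing a radial function in s = |x|^2 keeps the chain rule valid at the origin, where
  |x| is not differentiable, and exhibits the Hessian as a multiple of the identity plus a rank one
  matrix.\<close>

lemma hessian_radial:
  fixes x :: "real ^ 'n::finite"
  assumes x: "x \<in> ball 0 1"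
  shows "hessian (\<lambda>x. g (x \<bullet> x)) x = (\<chi> i l. (if i = l then 2 * g' (x \<bullet> x) else 0) + 4 * g'' (x \<bullet> x) * x $ i * x $ l)"
  unfolding hessian_def partial_deriv_def[of _ "partial_deriv _ _"]
    frechet_derivativeI[OF has_derivative_partial_deriv_radial[OF x]]
  by (simp add: vec_eq_iff inner_axis) (auto simp: axis_def)

lemma C2_on_radial: "C2_on (ball 0 1) (\<lambda>x :: real ^ 'n::finite. g (x \<bullet> x))"
  unfolding C2_on_def
proof (intro conjI allI)
  show "(\<lambda>x :: real ^ 'n. g (x \<bullet> x)) differentiable_on ball 0 1"
    unfolding differentiable_on_def using has_derivative_radial has_derivative_at_withinI differentiable_def by blast
  show "partial_deriv j (\<lambda>x :: real ^ 'n. g (x \<bullet> x)) differentiable_on ball 0 1" for j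
    unfolding differentiable_on_def using has_derivative_partial_deriv_radial has_derivative_at_withinI differentiable_def by blast
  fix i j :: 'n
  have cg': "continuous_on {0..<1} g'"
    by (rule DERIV_continuous_on, rule has_field_derivative_at_within) (use g'' in auto)
  have "continuous_on (ball 0 1) (\<lambda>x :: real ^ 'n. (if i = j then 2 * g' (x \<bullet> x) else 0) + 4 * g'' (x \<bullet> x) * x $ i * x $ j)"
    using inner_self_ball
    by (cases "i = j") (auto intro!: continuous_intros continuous_on_compose2[OF cg'] continuous_on_compose2[OF cont])
  moreover have "partial_deriv i (partial_deriv j (\<lambda>x. g (x \<bullet> x))) x = (if i = j then 2 * g' (x \<bullet> x) else 0) + 4 * g'' (x \<bullet> x) * x $ i * x $ j"
    if "x \<in> ball 0 1" for x :: "real ^ 'n"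
    using hessian_radial[OF that] unfolding hessian_def vec_eq_iff by simp
  ultimately show "continuous_on (ball 0 1) (partial_deriv i (partial_deriv j (\<lambda>x :: real ^ 'n. g (x \<bullet> x))))"
    by (subst continuous_on_cong[OF refl]) auto
qed

text \<open>
  For \<open>k \<le> n/2\<close> all the conditions \<open>S\<^sub>j \<ge> 0\<close> reduce to monotonicity of \<open>g\<close> and of \<open>s g' s\<close>.
\<close>

lemma Phi0_rad_radial:
  assumes k: "2 * k \<le> CARD('n::finite)"
    and mono: "\<And>s. 0 \<le> s \<Longrightarrow> s < 1 \<Longrightarrow> 0 \<le> g' s" "\<And>s. 0 \<le> s \<Longrightarrow> s < 1 \<Longrightarrow> 0 \<le> g' s + s * g'' s"
    and g: "continuous_on {0..1} g" "g 1 = 0"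
  shows "(\<lambda>x :: real ^ 'n. g (x \<bullet> x)) \<in> Phi0_rad k"
proof -
  \<comment> \<open>Here a = 2 g' and b = 4 g'', so 2 a + b s is 4 (g' + s g''), the derivative of s
    g' up to the factor 4.\<close>
  have "0 \<le> S_minors j (hessian (\<lambda>x. g (x \<bullet> x)) x)" if "j \<in> {1..k}" "x \<in> ball 0 1" for j and x :: "real ^ 'n"
    unfolding hessian_radial[OF that(2)]
    using that k inner_self_ball[OF that(2)] mono[of "x \<bullet> x"]
    by (intro S_minors_rank_one_nonneg) (auto simp: algebra_simps)
  moreover have "continuous_on (cball 0 1) (\<lambda>x :: real ^ 'n. g (x \<bullet> x))"
    by (intro continuous_on_compose2[OF g(1)] continuous_intros)
      (auto simp: power2_norm_eq_inner[symmetric] power_le_one_iff abs_square_le_1)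
  moreover have "radial_on (cball 0 1) (\<lambda>x :: real ^ 'n. g (x \<bullet> x))"
    unfolding radial_on_def by (auto simp: power2_norm_eq_inner[symmetric])
  moreover have "g (x \<bullet> x) = 0" if "x \<in> sphere 0 1" for x :: "real ^ 'n"
    using that g(2) by (simp add: power2_norm_eq_inner[symmetric])
  ultimately show ?thesis unfolding Phi0_rad_def admissible_def using C2_on_radial by simp
qed

end

section \<open>Profiles of radial functions\<close>

lemma radial_profile_eqI:
  fixes u :: "real ^ 'n::finite \<Rightarrow> real"
  assumes "\<And>x. norm x = r \<Longrightarrow> u x = y" and "0 \<le> r"
  shows "radial_profile u r = y"
proof -
  obtain x :: "real ^ 'n" where "norm x = r" using vector_choose_size[OF assms(2)] by blast
  then have "norm (SOME x :: real ^ 'n. norm x = r) = r" by (rule someI)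
  then show ?thesis unfolding radial_profile_def by (rule assms(1))
qed

lemma radial_profile_diff:
  "radial_profile (\<lambda>x. u x - v x) = (\<lambda>r. radial_profile u r - radial_profile v r)"
  unfolding radial_profile_def by (rule refl)

lemma DERIV_eq_open:
  fixes f g :: "real \<Rightarrow> real"
  assumes "(f has_real_derivative D) (at x)" "open S" "x \<in> S" "\<And>y. y \<in> S \<Longrightarrow> f y = g y"
  shows "(g has_real_derivative D) (at x)"
  using assms has_field_derivative_transform_within_open by blast

lemma locally_abs_continuous_C1:
  assumes d: "\<And>r. 0 < r \<Longrightarrow> r < 1 \<Longrightarrow> (f has_real_derivative f' r) (at r)"
    and cont: "continuous_on {0<..<1} f'"
  shows "locally_abs_continuous f"
  unfolding locally_abs_continuous_def abs_continuous_on_def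
proof (intro allI impI; elim conjE)
  fix a b \<epsilon> :: real assume ab: "0 < a" "a \<le> b" "b < 1" and \<epsilon>: "0 < \<epsilon>"
  have "compact (f' ` {a..b})"
    using ab by (intro compact_continuous_image continuous_on_subset[OF cont]) auto
  then obtain M where M: "\<And>r. r \<in> {a..b} \<Longrightarrow> \<bar>f' r\<bar> \<le> M"
    using compact_imp_bounded bounded_iff by (metis image_eqI real_norm_def)
  have M0: "0 \<le> M" using M[of a] ab by auto
  have lip: "\<bar>f y - f x\<bar> \<le> M * (y - x)" if "a \<le> x" "x \<le> y" "y \<le> b" for x y
  proof (cases "x = y")
    case False
    then have "x < y" using that by simp
    have "\<exists>z>x. z < y \<and> f y - f x = (y - x) * f' z"
      by (rule MVT2[OF \<open>x < y\<close>]) (use d that ab in auto)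
    then obtain z where z: "x < z" "z < y" "f y - f x = (y - x) * f' z" by auto
    then have "\<bar>f y - f x\<bar> = (y - x) * \<bar>f' z\<bar>" using that by (simp add: abs_mult)
    also have "\<dots> \<le> (y - x) * M" using M[of z] z that by (intro mult_left_mono) auto
    finally show ?thesis by (simp add: mult.commute)
  qed simp
  show "\<exists>\<delta>>0. \<forall>D. D division_of \<Union>D \<and> \<Union>D \<subseteq> {a..b} \<and> (\<Sum>K\<in>D. Sup K - Inf K) < \<delta> \<longrightarrow>
      (\<Sum>K\<in>D. \<bar>f (Sup K) - f (Inf K)\<bar>) < \<epsilon>"
  proof (intro exI[of _ "\<epsilon> / (M + 1)"] conjI allI impI; (elim conjE)?)
    show "0 < \<epsilon> / (M + 1)" using \<epsilon> M0 by simp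
    fix D assume D: "D division_of \<Union>D" "\<Union>D \<subseteq> {a..b}" "(\<Sum>K\<in>D. Sup K - Inf K) < \<epsilon> / (M + 1)"
    have K: "Inf K \<le> Sup K \<and> \<bar>f (Sup K) - f (Inf K)\<bar> \<le> M * (Sup K - Inf K)" if "K \<in> D" for K
    proof -
      obtain c e where "K = cbox c e" "K \<noteq> {}" using division_ofD(3,4)[OF D(1) \<open>K \<in> D\<close>] by metis
      moreover have "K \<subseteq> {a..b}" using D(2) that by blast
      ultimately show ?thesis using lip[of c e] by auto
    qed
    have "(\<Sum>K\<in>D. \<bar>f (Sup K) - f (Inf K)\<bar>) \<le> (\<Sum>K\<in>D. M * (Sup K - Inf K))"
      using K by (intro sum_mono) auto
    also have "\<dots> = M * (\<Sum>K\<in>D. Sup K - Inf K)" by (simp add: sum_distrib_left)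
    also have "\<dots> \<le> (M + 1) * (\<Sum>K\<in>D. Sup K - Inf K)"
      using K by (intro mult_right_mono sum_nonneg) auto
    also have "\<dots> < \<epsilon>" using D(3) M0 by (simp add: field_simps)
    finally show "(\<Sum>K\<in>D. \<bar>f (Sup K) - f (Inf K)\<bar>) < \<epsilon>" .
  qed
qed

lemma locally_abs_continuous_diff:
  assumes f: "locally_abs_continuous f" and g: "locally_abs_continuous g"
  shows "locally_abs_continuous (\<lambda>r. f r - g r)"
  unfolding locally_abs_continuous_def abs_continuous_on_def
proof (intro allI impI; elim conjE)
  fix a b \<epsilon> :: real assume ab: "0 < a" "a \<le> b" "b < 1" and \<epsilon>: "0 < \<epsilon>"
  then have e2: "0 < \<epsilon>/2" and "abs_continuous_on a b f" "abs_continuous_on a b g"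
    using f g unfolding locally_abs_continuous_def by auto
  obtain \<delta>\<^sub>1 where d1: "\<delta>\<^sub>1 > 0" "\<forall>D. D division_of \<Union>D \<and> \<Union>D \<subseteq> {a..b} \<and> (\<Sum>K\<in>D. Sup K - Inf K) < \<delta>\<^sub>1
     \<longrightarrow> (\<Sum>K\<in>D. \<bar>f (Sup K) - f (Inf K)\<bar>) < \<epsilon>/2"
    using abs_continuous_onD[OF \<open>abs_continuous_on a b f\<close> e2] by blast
  obtain \<delta>\<^sub>2 where d2: "\<delta>\<^sub>2 > 0" "\<forall>D. D division_of \<Union>D \<and> \<Union>D \<subseteq> {a..b} \<and> (\<Sum>K\<in>D. Sup K - Inf K) < \<delta>\<^sub>2
     \<longrightarrow> (\<Sum>K\<in>D. \<bar>g (Sup K) - g (Inf K)\<bar>) < \<epsilon>/2"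
    using abs_continuous_onD[OF \<open>abs_continuous_on a b g\<close> e2] by blast
  show "\<exists>\<delta>>0. \<forall>D. D division_of \<Union>D \<and> \<Union>D \<subseteq> {a..b} \<and> (\<Sum>K\<in>D. Sup K - Inf K) < \<delta> \<longrightarrow>
      (\<Sum>K\<in>D. \<bar>f (Sup K) - g (Sup K) - (f (Inf K) - g (Inf K))\<bar>) < \<epsilon>"
  proof (intro exI[of _ "min \<delta>\<^sub>1 \<delta>\<^sub>2"] conjI allI impI; (elim conjE)?)
    show "0 < min \<delta>\<^sub>1 \<delta>\<^sub>2" using d1(1) d2(1) by simp
    fix D assume D: "D division_of \<Union>D" "\<Union>D \<subseteq> {a..b}" "(\<Sum>K\<in>D. Sup K - Inf K) < min \<delta>\<^sub>1 \<delta>\<^sub>2"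
    have "(\<Sum>K\<in>D. \<bar>f (Sup K) - g (Sup K) - (f (Inf K) - g (Inf K))\<bar>) \<le>
       (\<Sum>K\<in>D. \<bar>f (Sup K) - f (Inf K)\<bar> + \<bar>g (Sup K) - g (Inf K)\<bar>)" by (intro sum_mono) linarith
    also have "\<dots> < \<epsilon>/2 + \<epsilon>/2"
      unfolding sum.distrib using D by (intro add_strict_mono d1(2)[rule_format] d2(2)[rule_format] conjI) auto
    finally show "(\<Sum>K\<in>D. \<bar>f (Sup K) - g (Sup K) - (f (Inf K) - g (Inf K))\<bar>) < \<epsilon>" by simp
  qed
qed

text \<open>Along a coordinate axis \<open>u\<close> is its own profile, with a partial derivative
  of \<open>u\<close> as derivative; this is continuous, and the limit at 1 is the boundary value
  0.\<close>

lemma Phi0_rad_profile: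
  fixes u :: "real ^ 'n::finite \<Rightarrow> real"
  assumes u: "u \<in> Phi0_rad k"
  shows "locally_abs_continuous (radial_profile u)" "(radial_profile u \<longlongrightarrow> 0) (at_left 1)"
proof -
  define i :: 'n where "i = undefined"
  define e :: "real ^ 'n" where "e = axis i 1"
  have e: "norm (r *\<^sub>R e) = r" if "0 \<le> r" for r unfolding e_def using that by simp
  have C2: "C2_on (ball 0 1) u" and cont: "continuous_on (cball 0 1) u" and rad: "radial_on (cball 0 1) u"
    and z: "\<And>x. x \<in> sphere 0 1 \<Longrightarrow> u x = 0"
    using u unfolding Phi0_rad_def admissible_def by auto
  have prof: "radial_profile u r = u (r *\<^sub>R e)" if "0 \<le> r" "r \<le> 1" for r
  proof (rule radial_profile_eqI[OF _ that(1)])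
    fix x :: "real ^ 'n" assume "norm x = r"
    moreover from this have "x \<in> cball 0 1" "r *\<^sub>R e \<in> cball 0 1" "norm x = norm (r *\<^sub>R e)"
      using e[OF that(1)] that(2) by simp_all
    ultimately show "u x = u (r *\<^sub>R e)" using rad unfolding radial_on_def by blast
  qed
  define f' where "f' r = partial_deriv i u (r *\<^sub>R e)" for r
  have d: "(radial_profile u has_real_derivative f' r) (at r)" if r: "0 < r" "r < 1" for r
  proof (rule DERIV_eq_open)
    have "r *\<^sub>R e \<in> ball 0 1" using e[of r] r by simp
    then have "u differentiable (at (r *\<^sub>R e))"
      using C2 unfolding C2_on_def differentiable_on_eq_differentiable_at[OF open_ball] by blast
    then have "(u has_derivative frechet_derivative u (at (r *\<^sub>R e))) (at (r *\<^sub>R e))" by (rule frechet_derivative_works[THEN iffD1])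
    moreover have "((\<lambda>r. r *\<^sub>R e) has_derivative (\<lambda>h. h *\<^sub>R e)) (at r)" by (auto intro!: derivative_eq_intros)
    ultimately have "((\<lambda>r. u (r *\<^sub>R e)) has_derivative (\<lambda>h. frechet_derivative u (at (r *\<^sub>R e)) (h *\<^sub>R e))) (at r)"
      by (rule has_derivative_compose[rotated])
    moreover have "frechet_derivative u (at (r *\<^sub>R e)) (h *\<^sub>R e) = f' r * h" for h
      unfolding f'_def partial_deriv_def e_def[symmetric]
      using linear_frechet_derivative[OF \<open>u differentiable _\<close>] by (simp add: linear_cmul)
    ultimately show "((\<lambda>r. u (r *\<^sub>R e)) has_real_derivative f' r) (at r)"
      unfolding has_field_derivative_def by simp
    show "open {0<..<1::real}" "r \<in> {0<..<1}" using r by auto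
  qed (simp add: prof)
  have "continuous_on (ball 0 1) (partial_deriv i u)"
    using C2 unfolding C2_on_def by (intro differentiable_imp_continuous_on) blast
  then have "continuous_on {0<..<1} f'"
    unfolding f'_def[abs_def] by (rule continuous_on_compose2) (auto intro!: continuous_intros simp: e_def)
  with d show "locally_abs_continuous (radial_profile u)" by (rule locally_abs_continuous_C1)
  have "continuous_on {0..1} (\<lambda>r. u (r *\<^sub>R e))"
    by (rule continuous_on_compose2[OF cont]) (auto intro!: continuous_intros simp: e_def)
  then have "((\<lambda>r. u (r *\<^sub>R e)) \<longlongrightarrow> u (1 *\<^sub>R e)) (at 1 within {0..1})"
    unfolding continuous_on_def by (rule bspec) simp
  then have "((\<lambda>r. u (r *\<^sub>R e)) \<longlongrightarrow> 0) (at 1 within {0..1})" using z[of e] e[of 1] by simp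
  then have "((\<lambda>r. u (r *\<^sub>R e)) \<longlongrightarrow> 0) (at_left 1)"
    by (simp add: at_within_Icc_at_left)
  moreover have "\<forall>\<^sub>F r in at_left 1. u (r *\<^sub>R e) = radial_profile u r"
    unfolding eventually_at_left_field by (intro exI[of _ 0]) (simp add: prof)
  ultimately show "(radial_profile u \<longlongrightarrow> 0) (at_left 1)" by (rule Lim_transform_eventually)
qed


section \<open>Finiteness on the weighted space\<close>

text \<open>For functions about whose measurability nothing is known, such as the integrands in
  \<open>exp_integral_finite\<close>: a simple function below c f, divided by c, lies below
  f.\<close>

lemma nn_integral_cmult_le:
  fixes f :: "'a \<Rightarrow> ennreal"
  assumes c: "c > 0"
  shows "(\<integral>\<^sup>+x. ennreal c * f x \<partial>M) \<le> ennreal c * (\<integral>\<^sup>+x. f x \<partial>M)"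
  unfolding nn_integral_def[of M "\<lambda>x. ennreal c * f x"]
proof (rule SUP_least)
  have c1: "ennreal (1 / c) * ennreal c = 1" "ennreal c * ennreal (1 / c) = 1"
    using c by (simp_all flip: ennreal_mult)
  fix s assume s: "s \<in> {s. simple_function M s \<and> s \<le> (\<lambda>x. ennreal c * f x)}"
  then have sm: "s \<in> borel_measurable M" and le: "\<And>x. s x \<le> ennreal c * f x"
    by (auto simp: le_fun_def borel_measurable_simple_function)
  have "ennreal (1 / c) * s x \<le> f x" for x
    using mult_left_mono[OF le[of x], of "ennreal (1 / c)"] c1 by (simp add: mult.assoc[symmetric])
  then have "(\<integral>\<^sup>+x. ennreal (1 / c) * s x \<partial>M) \<le> (\<integral>\<^sup>+x. f x \<partial>M)" by (intro nn_integral_mono)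
  then have "ennreal (1 / c) * (\<integral>\<^sup>+x. s x \<partial>M) \<le> (\<integral>\<^sup>+x. f x \<partial>M)" using sm by (simp add: nn_integral_cmult)
  then have "ennreal c * (ennreal (1 / c) * (\<integral>\<^sup>+x. s x \<partial>M)) \<le> ennreal c * (\<integral>\<^sup>+x. f x \<partial>M)" by (rule mult_left_mono) simp
  then show "integral\<^sup>S M s \<le> ennreal c * (\<integral>\<^sup>+x. f x \<partial>M)"
    using s c1 by (simp add: mult.assoc[symmetric] nn_integral_eq_simple_integral)
qed

lemma norm_const_pos:
  assumes "1 \<le> k" "k \<le> CARD('n::finite)"
  shows "0 < norm_const TYPE('n) k"
proof -
  have "(CARD('n) - 1) choose (k - 1) > 0" using assms by (intro zero_less_binomial) auto
  then show ?thesis using assms unfolding norm_const_def sphere_area_eq by simp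
qed

definition Phi_energy :: "nat \<Rightarrow> (real \<Rightarrow> real) \<Rightarrow> (real ^ 'n::finite \<Rightarrow> real) \<Rightarrow> ennreal" where
  "Phi_energy k w u =
     (\<integral>\<^sup>+r\<in>{0<..<1}. ennreal (r ^ (CARD('n) - k) * \<bar>deriv (radial_profile u) r\<bar> ^ (k + 1) * w r) \<partial>lborel)"

lemma Phi_norm_energy:
  fixes u :: "real ^ 'n::finite \<Rightarrow> real"
  shows "Phi_norm k w u = (let E = ennreal (norm_const TYPE('n) k) * Phi_energy k w u in
     if E = \<infinity> then \<infinity> else ennreal (enn2real E powr (1 / real (k + 1))))"
  unfolding Phi_norm_def Phi_energy_def ..

lemma Phi_norm_le_iff:
  fixes u :: "real ^ 'n::finite \<Rightarrow> real"
  assumes \<delta>: "0 \<le> \<delta>"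
  shows "Phi_norm k w u \<le> ennreal \<delta> \<longleftrightarrow> ennreal (norm_const TYPE('n) k) * Phi_energy k w u \<le> ennreal (\<delta> ^ (k + 1))"
proof -
  define E where "E = ennreal (norm_const TYPE('n) k) * Phi_energy k w u"
  show ?thesis
  proof (cases "E = \<infinity>")
    case False
    then obtain x where x: "E = ennreal x" "0 \<le> x" by (cases E) auto
    have pow: "\<delta> ^ (k + 1) = \<delta> powr real (k + 1)" using \<delta> powr_realpow'[of \<delta> "k + 1"] by simp
    have "x powr (1 / real (k + 1)) \<le> \<delta> \<longleftrightarrow> x \<le> \<delta> powr real (k + 1)"
    proof
      assume "x powr (1 / real (k + 1)) \<le> \<delta>"
      then have "(x powr (1 / real (k + 1))) powr real (k + 1) \<le> \<delta> powr real (k + 1)" by (intro powr_mono2) auto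
      then show "x \<le> \<delta> powr real (k + 1)" unfolding powr_powr using x(2) by simp
    next
      assume "x \<le> \<delta> powr real (k + 1)"
      then have "x powr (1 / real (k + 1)) \<le> (\<delta> powr real (k + 1)) powr (1 / real (k + 1))"
        using x(2) by (intro powr_mono2) auto
      then show "x powr (1 / real (k + 1)) \<le> \<delta>" unfolding powr_powr using \<delta> by simp
    qed
    then show ?thesis unfolding Phi_norm_energy E_def[symmetric] Let_def pow using x \<delta> by simp
  qed (simp add: Phi_norm_energy Let_def top_unique flip: E_def)
qed

lemma weight0_le:
  assumes "w = weight0 n \<beta> \<or> w = weight1 n \<beta>" "0 \<le> \<beta>" "0 < r" "r < 1"
  shows "weight0 n \<beta> r \<le> w r" "w r \<le> weight1 n \<beta> r"
proof -
  have "ln (1 / r) powr (\<beta> * real n / 2) \<le> ln (exp 1 / r) powr (\<beta> * real n / 2)"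
    using assms by (intro powr_mono2) (auto simp: ln_div)
  then show "weight0 n \<beta> r \<le> w r" "w r \<le> weight1 n \<beta> r"
    using assms(1) by (auto simp: weight0_def weight1_def)
qed

text \<open>The energy is homogeneous of degree k + 1, so dividing by \<delta> brings it down to at
  most 1. The Borel derivative agrees with \<open>deriv\<close> almost everywhere, and the energy
  for the weight w_0 is the smaller one.\<close>

lemma critical_exp_integral_bound_Phi_norm:
  fixes n k :: nat and \<beta> \<gamma> \<alpha> \<delta> :: real and w :: "real \<Rightarrow> real" and u :: "real ^ 'n::finite \<Rightarrow> real"
  assumes n: "n = CARD('n)" "n = 2 * k" and k: "k \<ge> 1" and beta: "0 \<le> \<beta>" "\<beta> < 1"
    and w: "w = weight0 n \<beta> \<or> w = weight1 n \<beta>"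
    and gamma: "\<gamma> = (real k + 1) / (real k * (1 - \<beta>))"
    and alpha: "\<alpha> = real n * (norm_const TYPE('n) k powr (1 / real k) * (1 - \<beta>)) powr (1 / (1 - \<beta>))"
    and rad: "radial_on (ball 0 1) u" and ac: "locally_abs_continuous (radial_profile u)"
    and lim: "(radial_profile u \<longlongrightarrow> 0) (at_left 1)" and \<delta>: "0 < \<delta>" and N: "Phi_norm k w u \<le> ennreal \<delta>"
  shows "(\<integral>\<^sup>+x\<in>ball 0 1. ennreal (exp (\<alpha> * \<bar>u x / \<delta>\<bar> powr \<gamma>)) \<partial>lborel) \<le> ennreal (Moser_const k \<beta>)"
proof -
  define c where "c = norm_const TYPE('n) k"
  have c: "c > 0" unfolding c_def by (rule norm_const_pos) (use n k in auto)
  obtain g :: "real \<Rightarrow> real" where g [measurable]: "g \<in> borel_measurable borel"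
    and gd: "AE x in lborel. x \<in> {0<..<1} \<longrightarrow> (radial_profile u has_real_derivative g x) (at x)"
    and gi: "\<And>a b. 0 < a \<Longrightarrow> a \<le> b \<Longrightarrow> b < 1 \<Longrightarrow>
      ennreal \<bar>radial_profile u b - radial_profile u a\<bar> \<le> (\<integral>\<^sup>+x\<in>{a..b}. ennreal \<bar>g x\<bar> \<partial>lborel)"
    by (rule locally_abs_continuous_derivative[OF ac]) blast
  define f where "f r = r ^ k * \<bar>g r\<bar> ^ (k + 1) * ln (1 / r) powr (\<beta> * k)" for r
  have [measurable]: "f \<in> borel_measurable borel" unfolding f_def by measurable
  show ?thesis
  proof (rule critical_exp_integral_bound[OF n k beta c gamma alpha[folded c_def],
        where v = "\<lambda>r. radial_profile u r / \<delta>" and g = "\<lambda>r. g r / \<delta>"])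
    show "u x / \<delta> = radial_profile u (norm x) / \<delta>" if "norm x < 1" for x
      using radial_profile_norm[OF rad, of x] that by simp
    show "(\<lambda>r. g r / \<delta>) \<in> borel_measurable borel" by measurable
    show "((\<lambda>r. radial_profile u r / \<delta>) \<longlongrightarrow> 0) (at_left 1)"
      using tendsto_divide[OF lim tendsto_const[of \<delta>]] \<delta> by simp
    fix a b :: real assume ab: "0 < a" "a \<le> b" "b < 1"
    have "ennreal \<bar>radial_profile u b / \<delta> - radial_profile u a / \<delta>\<bar> = ennreal (1 / \<delta>) * ennreal \<bar>radial_profile u b - radial_profile u a\<bar>"
      using \<delta> by (simp flip: ennreal_mult diff_divide_distrib)
    also have "\<dots> \<le> ennreal (1 / \<delta>) * (\<integral>\<^sup>+x\<in>{a..b}. ennreal \<bar>g x\<bar> \<partial>lborel)"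
      using gi[OF ab] by (rule mult_left_mono) simp
    also have "\<dots> = (\<integral>\<^sup>+x. ennreal (1 / \<delta>) * (ennreal \<bar>g x\<bar> * indicator {a..b} x) \<partial>lborel)"
      by (rule nn_integral_cmult[symmetric]) measurable
    also have "\<dots> = (\<integral>\<^sup>+x\<in>{a..b}. ennreal \<bar>g x / \<delta>\<bar> \<partial>lborel)"
      using \<delta> by (intro nn_integral_cong) (simp add: mult.assoc[symmetric] flip: ennreal_mult)
    finally show "ennreal \<bar>radial_profile u b / \<delta> - radial_profile u a / \<delta>\<bar> \<le> (\<integral>\<^sup>+x\<in>{a..b}. ennreal \<bar>g x / \<delta>\<bar> \<partial>lborel)" .
  next
    define I where "I = (\<integral>\<^sup>+r\<in>{0<..<1}. ennreal (f r) \<partial>lborel)"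
    have "I \<le> Phi_energy k w u"
      unfolding I_def Phi_energy_def
    proof (rule nn_integral_mono_AE)
      from gd show "AE r in lborel. ennreal (f r) * indicator {0<..<1} r \<le>
         ennreal (r ^ (CARD('n) - k) * \<bar>deriv (radial_profile u) r\<bar> ^ (k + 1) * w r) * indicator {0<..<1} r"
      proof eventually_elim
        case (elim r)
        show ?case
        proof (cases "r \<in> {0<..<1}")
          case True
          then have "deriv (radial_profile u) r = g r" using elim by (simp add: DERIV_imp_deriv)
          moreover have "weight0 n \<beta> r \<le> w r" using weight0_le(1)[OF w beta(1)] True by auto
          moreover have "CARD('n) - k = k" using n by simp
          moreover have "weight0 n \<beta> r = ln (1 / r) powr (\<beta> * k)" unfolding weight0_def using n(2) by simp
          ultimately show ?thesis using True unfolding f_def by (auto intro!: ennreal_leI mult_left_mono)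
        qed simp
      qed
    qed
    then have "ennreal c * I \<le> ennreal c * Phi_energy k w u" by (rule mult_left_mono) simp
    also have "\<dots> \<le> ennreal (\<delta> ^ (k + 1))"
      using N \<delta> unfolding c_def by (simp only: Phi_norm_le_iff less_imp_le)
    finally have cI: "ennreal c * I \<le> ennreal (\<delta> ^ (k + 1))" .
    have "(\<integral>\<^sup>+r\<in>{0<..<1}. ennreal (r ^ k * \<bar>g r / \<delta>\<bar> ^ (k + 1) * ln (1 / r) powr (\<beta> * k)) \<partial>lborel)
        = (\<integral>\<^sup>+r. ennreal (1 / \<delta> ^ (k + 1)) * (ennreal (f r) * indicator {0<..<1} r) \<partial>lborel)"
    proof (rule nn_integral_cong)
      fix r :: real
      show "ennreal (r ^ k * \<bar>g r / \<delta>\<bar> ^ (k + 1) * ln (1 / r) powr (\<beta> * k)) * indicator {0<..<1} r =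
         ennreal (1 / \<delta> ^ (k + 1)) * (ennreal (f r) * indicator {0<..<1} r)"
      proof (cases "r \<in> {0<..<1}")
        case True
        have "r ^ k * \<bar>g r / \<delta>\<bar> ^ (k + 1) * ln (1 / r) powr (\<beta> * k) = 1 / \<delta> ^ (k + 1) * f r"
          using \<delta> by (simp add: power_divide f_def)
        moreover have "ennreal (1 / \<delta> ^ (k + 1) * f r) = ennreal (1 / \<delta> ^ (k + 1)) * ennreal (f r)"
          using True \<delta> unfolding f_def by (intro ennreal_mult) auto
        ultimately show ?thesis using True by simp
      qed simp
    qed
    also have "\<dots> = ennreal (1 / \<delta> ^ (k + 1)) * I"
      unfolding I_def by (rule nn_integral_cmult) measurable
    finally have "ennreal c * (\<integral>\<^sup>+r\<in>{0<..<1}. ennreal (r ^ k * \<bar>g r / \<delta>\<bar> ^ (k + 1) * ln (1 / r) powr (\<beta> * k)) \<partial>lborel)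
       = ennreal (1 / \<delta> ^ (k + 1)) * (ennreal c * I)" by (simp add: mult_ac)
    also have "\<dots> \<le> ennreal (1 / \<delta> ^ (k + 1)) * ennreal (\<delta> ^ (k + 1))" using cI by (rule mult_left_mono) simp
    also have "\<dots> = 1" using \<delta> by (simp flip: ennreal_mult)
    finally show "ennreal c * (\<integral>\<^sup>+r\<in>{0<..<1}. ennreal (r ^ k * \<bar>g r / \<delta>\<bar> ^ (k + 1) * ln (1 / r) powr (\<beta> * k)) \<partial>lborel) \<le> 1" .
  qed
qed

lemma exp_integral_finite:
  fixes n k :: nat and \<beta> \<gamma> \<gamma>' :: real and w :: "real \<Rightarrow> real" and u :: "real ^ 'n::finite \<Rightarrow> real"
  assumes n: "n = CARD('n)" "n = 2 * k" and k: "k \<ge> 1" and beta: "0 \<le> \<beta>" "\<beta> < 1"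
    and w: "w = weight0 n \<beta> \<or> w = weight1 n \<beta>"
    and gamma: "\<gamma> = (real k + 1) / (real k * (1 - \<beta>))" and \<gamma>': "0 < \<gamma>'" "\<gamma>' \<le> \<gamma>"
    and u: "u \<in> Phi0_rad_weighted k w"
  shows "(\<integral>\<^sup>+x\<in>ball 0 1. ennreal (exp (\<bar>u x\<bar> powr \<gamma>')) \<partial>lborel) < \<infinity>"
proof -
  define \<alpha> where "\<alpha> = real n * (norm_const TYPE('n) k powr (1 / real k) * (1 - \<beta>)) powr (1 / (1 - \<beta>))"
  have cpos: "norm_const TYPE('n) k > 0" by (rule norm_const_pos) (use n k in auto)
  have \<alpha>: "\<alpha> > 0" using n k cpos beta unfolding \<alpha>_def by simp
  have \<gamma>0: "\<gamma> > 0" using \<gamma>' by simp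
  \<comment> \<open>Chosen with (2 \<delta>) powr \<gamma> = \<alpha>, because |u| will be bounded
    by twice the larger of |h| and a constant.\<close>
  define \<delta> where "\<delta> = (\<alpha> / 2 powr \<gamma>) powr (1 / \<gamma>)"
  have \<delta>: "\<delta> > 0" using \<alpha> unfolding \<delta>_def by simp
  have \<delta>\<gamma>: "\<delta> powr \<gamma> = \<alpha> / 2 powr \<gamma>" using \<alpha> \<gamma>0 unfolding \<delta>_def by (simp add: powr_powr)
  have rad: "radial_on (ball 0 1) u" and ac: "locally_abs_continuous (radial_profile u)"
    and lim: "(radial_profile u \<longlongrightarrow> 0) (at_left 1)"
    using u unfolding Phi0_rad_weighted_def by auto
  have "\<exists>U. (\<forall>m::nat. U m \<in> Phi0_rad k \<and> Phi_norm k w (U m) < \<infinity>) \<and> (\<lambda>m. Phi_norm k w (\<lambda>x. U m x - u x)) \<longlonglongrightarrow> 0"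
    using u unfolding Phi0_rad_weighted_def by (elim CollectE conjE)
  then obtain U where U: "\<And>m::nat. U m \<in> Phi0_rad k" and conv: "(\<lambda>m. Phi_norm k w (\<lambda>x. U m x - u x)) \<longlonglongrightarrow> 0"
    by (elim exE conjE) (rule that, simp_all)
  have "\<forall>\<^sub>F m in sequentially. Phi_norm k w (\<lambda>x. U m x - u x) < ennreal \<delta>"
    using conv \<delta> by (intro order_tendstoD(2)) auto
  then have "\<exists>m. Phi_norm k w (\<lambda>x. U m x - u x) < ennreal \<delta>"
    by (rule eventually_happens'[OF sequentially_bot])
  then obtain m where m: "Phi_norm k w (\<lambda>x. U m x - u x) \<le> ennreal \<delta>"
    by (elim exE) (rule that, rule less_imp_le)
  define h where "h x = U m x - u x" for x
  have Um: "radial_on (cball 0 1) (U m)" "continuous_on (cball 0 1) (U m)"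
    using U[of m] unfolding Phi0_rad_def admissible_def by auto
  have "radial_on (ball 0 1) h"
    unfolding radial_on_def h_def
  proof (intro ballI impI)
    fix x y :: "real ^ 'n" assume "x \<in> ball 0 1" "y \<in> ball 0 1" "norm x = norm y"
    moreover then have "U m x = U m y" using Um(1) unfolding radial_on_def by auto
    moreover have "u x = u y" using rad calculation unfolding radial_on_def by blast
    ultimately show "U m x - u x = U m y - u y" by simp
  qed
  moreover have "locally_abs_continuous (radial_profile h)"
    unfolding h_def radial_profile_diff by (rule locally_abs_continuous_diff[OF Phi0_rad_profile(1)[OF U] ac])
  moreover have "(radial_profile h \<longlongrightarrow> 0) (at_left 1)"
    unfolding h_def radial_profile_diff using tendsto_diff[OF Phi0_rad_profile(2)[OF U] lim] by simp
  ultimately have hC: "(\<integral>\<^sup>+x\<in>ball 0 1. ennreal (exp (\<alpha> * \<bar>h x / \<delta>\<bar> powr \<gamma>)) \<partial>lborel) \<le> ennreal (Moser_const k \<beta>)"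
    using m[folded h_def] by (intro critical_exp_integral_bound_Phi_norm[OF n k beta w gamma \<alpha>_def] \<delta>)
  have "bounded (U m ` cball 0 1)" using Um(2) by (intro compact_imp_bounded compact_continuous_image) auto
  then obtain S where "\<forall>y\<in>U m ` cball 0 1. norm y \<le> S" using bounded_iff by blast
  then have S: "\<And>x. x \<in> cball 0 1 \<Longrightarrow> \<bar>U m x\<bar> \<le> S" by simp
  have S0: "0 \<le> S" using S[of 0] by simp
  define K where "K = exp (1 + 2 powr \<gamma> * S powr \<gamma>)"
  have pt: "exp (\<bar>u x\<bar> powr \<gamma>') \<le> K * exp (\<alpha> * \<bar>h x / \<delta>\<bar> powr \<gamma>)" if "x \<in> ball 0 1" for x
  proof -
    \<comment> \<open>The summand 1 covers |u x| \<le> 1, where lowering the exponent does not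
      decrease the power.\<close>
    have "\<bar>u x\<bar> powr \<gamma>' \<le> 1 + \<bar>u x\<bar> powr \<gamma>"
    proof (cases "\<bar>u x\<bar> \<le> 1")
      case True
      then have "\<bar>u x\<bar> powr \<gamma>' \<le> 1" using \<gamma>' by (intro powr_le1) auto
      then show ?thesis by (simp add: add_increasing2)
    next
      case False
      then have "\<bar>u x\<bar> powr \<gamma>' \<le> \<bar>u x\<bar> powr \<gamma>" using \<gamma>' by (intro powr_mono) auto
      then show ?thesis by simp
    qed
    also have "\<bar>u x\<bar> powr \<gamma> \<le> (2 * max \<bar>h x\<bar> S) powr \<gamma>"
      using S[of x] that \<gamma>0 unfolding h_def by (intro powr_mono2) (auto simp: max_def abs_if split: if_splits)
    also have "\<dots> = 2 powr \<gamma> * max \<bar>h x\<bar> S powr \<gamma>" using S0 by (simp add: powr_mult)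
    also have "\<dots> \<le> 2 powr \<gamma> * (\<bar>h x\<bar> powr \<gamma> + S powr \<gamma>)" by (intro mult_left_mono) (auto simp: max_def)
    also have "\<dots> = \<alpha> * \<bar>h x / \<delta>\<bar> powr \<gamma> + 2 powr \<gamma> * S powr \<gamma>"
      using \<delta> \<alpha> by (simp add: powr_divide \<delta>\<gamma> distrib_left)
    finally show ?thesis unfolding K_def by (simp flip: exp_add)
  qed
  have "(\<integral>\<^sup>+x\<in>ball 0 1. ennreal (exp (\<bar>u x\<bar> powr \<gamma>')) \<partial>lborel) \<le>
     (\<integral>\<^sup>+x. ennreal K * (ennreal (exp (\<alpha> * \<bar>h x / \<delta>\<bar> powr \<gamma>)) * indicator (ball 0 1) x) \<partial>lborel)"
  proof (rule nn_integral_mono)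
    fix x :: "real ^ 'n"
    show "ennreal (exp (\<bar>u x\<bar> powr \<gamma>')) * indicator (ball 0 1) x \<le>
       ennreal K * (ennreal (exp (\<alpha> * \<bar>h x / \<delta>\<bar> powr \<gamma>)) * indicator (ball 0 1) x)"
      using pt[of x] by (cases "x \<in> ball 0 1") (auto simp: K_def intro!: ennreal_leI simp flip: ennreal_mult)
  qed
  also have "\<dots> \<le> ennreal K * (\<integral>\<^sup>+x\<in>ball 0 1. ennreal (exp (\<alpha> * \<bar>h x / \<delta>\<bar> powr \<gamma>)) \<partial>lborel)"
    by (rule nn_integral_cmult_le) (simp add: K_def)
  also have "\<dots> \<le> ennreal K * ennreal (Moser_const k \<beta>)" using hC by (rule mult_left_mono) simp
  also have "\<dots> < \<infinity>" by (simp add: ennreal_mult_less_top)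
  finally show ?thesis .
qed


section \<open>Truncated logarithms and sharpness\<close>

text \<open>
  \<open>log_trunc \<epsilon> (\<bar>x\<bar>\<^sup>2)\<close> is a smooth truncation of \<open>t = ln (1/\<bar>x\<bar>)\<close>, concave and increasing as a function
  of \<open>t\<close>.
\<close>

definition log_trunc :: "real \<Rightarrow> real \<Rightarrow> real" where
  "log_trunc \<epsilon> s = ln ((1 + \<epsilon>) / (s + \<epsilon>)) / 2"

lemma log_trunc_nonneg: "0 < \<epsilon> \<Longrightarrow> 0 \<le> s \<Longrightarrow> s \<le> 1 \<Longrightarrow> 0 \<le> log_trunc \<epsilon> s"
  unfolding log_trunc_def by simp

lemma DERIV_log_trunc:
  assumes "0 < \<epsilon>" "- \<epsilon> < s"
  shows "(log_trunc \<epsilon> has_real_derivative - 1 / (2 * (s + \<epsilon>))) (at s)"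
proof (rule DERIV_eq_open[of "\<lambda>s. (ln (1 + \<epsilon>) - ln (s + \<epsilon>)) / 2" _ _ "{- \<epsilon><..}"])
  show "((\<lambda>s. (ln (1 + \<epsilon>) - ln (s + \<epsilon>)) / 2) has_real_derivative - 1 / (2 * (s + \<epsilon>))) (at s)"
  proof -
    have "((\<lambda>s. ln (s + \<epsilon>)) has_real_derivative 1 / (s + \<epsilon>)) (at s)"
      using assms by (auto intro!: derivative_eq_intros simp: divide_inverse)
    from DERIV_cdivide[OF DERIV_diff[OF DERIV_const[of "ln (1 + \<epsilon>)"] this], of 2]
    show ?thesis by (rule DERIV_cong) (simp add: mult.commute)
  qed
qed (use assms in \<open>auto simp: log_trunc_def ln_div\<close>)

text \<open>With \<open>t = ln (1/r)\<close> and \<open>L t\<close> the truncation, this is \<open>(1 + t) L' t \<le> 1 + L t\<close>; it follows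
  from \<open>L 0 = 0\<close>, \<open>L' \<le> 1\<close> and concavity.\<close>

lemma log_trunc_slope_le:
  assumes \<epsilon>: "0 < \<epsilon>" and r: "0 < r" "r < 1"
  shows "(1 + ln (1 / r)) * (r\<^sup>2 / (r\<^sup>2 + \<epsilon>)) \<le> 1 + log_trunc \<epsilon> (r\<^sup>2)"
proof -
  define q where "q = r\<^sup>2 / (r\<^sup>2 + \<epsilon>)"
  have r2: "r\<^sup>2 > 0" using r by simp
  have pos: "r\<^sup>2 + \<epsilon> > 0" using r2 \<epsilon> by (rule add_pos_pos)
  have q: "0 \<le> q" "q \<le> 1" unfolding q_def using \<epsilon> pos by simp_all
  have q1: "1 - q = \<epsilon> / (r\<^sup>2 + \<epsilon>)" unfolding q_def using pos by (simp add: field_simps)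
  have "(1 / r\<^sup>2) powr q * 1 powr (1 - q) \<le> q * (1 / r\<^sup>2) + (1 - q) * 1"
    using q r2 by (intro Youngs_inequality_0) auto
  also have "\<dots> = (1 + \<epsilon>) / (r\<^sup>2 + \<epsilon>)"
    unfolding q1 unfolding q_def using pos r2 r by (simp add: field_simps)
  finally have "ln ((1 / r\<^sup>2) powr q) \<le> ln ((1 + \<epsilon>) / (r\<^sup>2 + \<epsilon>))"
    using r2 by (intro ln_mono) (auto simp: powr_def)
  moreover have "ln ((1 / r\<^sup>2) powr q) = 2 * (q * ln (1 / r))"
    using r by (simp add: powr_def ln_div ln_realpow)
  ultimately have "q * ln (1 / r) \<le> log_trunc \<epsilon> (r\<^sup>2)" unfolding log_trunc_def by linarith
  then show ?thesis using q unfolding q_def[symmetric] by (simp add: algebra_simps)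
qed

section \<open>Powers of the truncated logarithm\<close>

text \<open>The sign makes the functions nonpositive and increasing in |x|. The 1 added to the
  truncated t matches the weight w_1, which is (1 + t) powr (\<beta> k), and keeps the base away
  from 0; the 1 subtracted outside produces the boundary value 0.\<close>

definition moser_fun :: "real \<Rightarrow> real \<Rightarrow> real \<Rightarrow> real \<Rightarrow> real" where
  "moser_fun C \<theta> \<epsilon> s = - (C * ((1 + log_trunc \<epsilon> s) powr \<theta> - 1))"

definition moser_deriv :: "real \<Rightarrow> real \<Rightarrow> real \<Rightarrow> real \<Rightarrow> real" where
  "moser_deriv C \<theta> \<epsilon> s = C * \<theta> / 2 * ((1 + log_trunc \<epsilon> s) powr (\<theta> - 1) / (s + \<epsilon>))"

definition moser_deriv2 :: "real \<Rightarrow> real \<Rightarrow> real \<Rightarrow> real \<Rightarrow> real" where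
  "moser_deriv2 C \<theta> \<epsilon> s = C * \<theta> / 2 * (((1 - \<theta>) / 2 * (1 + log_trunc \<epsilon> s) powr (\<theta> - 2) - (1 + log_trunc \<epsilon> s) powr (\<theta> - 1)) / (s + \<epsilon>)\<^sup>2)"

lemma DERIV_one_plus_log_trunc:
  assumes "0 < \<epsilon>" "0 \<le> s"
  shows "((\<lambda>s. 1 + log_trunc \<epsilon> s) has_real_derivative - 1 / (2 * (s + \<epsilon>))) (at s)"
  using DERIV_add[OF DERIV_const[of 1] DERIV_log_trunc[of \<epsilon> s]] assms by simp

lemma DERIV_moser_fun:
  assumes \<epsilon>: "0 < \<epsilon>" and s: "0 \<le> s" "s \<le> 1"
  shows "(moser_fun C \<theta> \<epsilon> has_real_derivative moser_deriv C \<theta> \<epsilon> s) (at s)"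
proof -
  have pos: "1 + log_trunc \<epsilon> s > 0" using log_trunc_nonneg[OF assms] by simp
  have "((\<lambda>s. (1 + log_trunc \<epsilon> s) powr \<theta>) has_real_derivative
      \<theta> * (1 + log_trunc \<epsilon> s) powr (\<theta> - of_nat 1) * (- 1 / (2 * (s + \<epsilon>)))) (at s)"
    by (rule DERIV_fun_powr[OF DERIV_one_plus_log_trunc pos]) (use assms in auto)
  then have "((\<lambda>s. - (C * ((1 + log_trunc \<epsilon> s) powr \<theta> - 1))) has_real_derivative
      - (C * (\<theta> * (1 + log_trunc \<epsilon> s) powr (\<theta> - of_nat 1) * (- 1 / (2 * (s + \<epsilon>))) - 0))) (at s)"
    by (intro DERIV_minus DERIV_cmult DERIV_diff DERIV_const)
  then show ?thesis unfolding moser_fun_def[abs_def] moser_deriv_def by (simp add: field_simps)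
qed

lemma DERIV_moser_deriv:
  assumes \<epsilon>: "0 < \<epsilon>" and s: "0 \<le> s" "s \<le> 1"
  shows "(moser_deriv C \<theta> \<epsilon> has_real_derivative moser_deriv2 C \<theta> \<epsilon> s) (at s)"
proof -
  have pos: "1 + log_trunc \<epsilon> s > 0" using log_trunc_nonneg[OF assms] by simp
  have se: "s + \<epsilon> \<noteq> 0" using assms by simp
  have "((\<lambda>s. (1 + log_trunc \<epsilon> s) powr (\<theta> - 1)) has_real_derivative
      (\<theta> - 1) * (1 + log_trunc \<epsilon> s) powr (\<theta> - 1 - of_nat 1) * (- 1 / (2 * (s + \<epsilon>)))) (at s)"
    by (rule DERIV_fun_powr[OF DERIV_one_plus_log_trunc pos]) (use assms in auto)
  moreover have "((\<lambda>s. s + \<epsilon>) has_real_derivative 1) (at s)" by (auto intro!: derivative_eq_intros)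
  ultimately have D: "((\<lambda>s. C * \<theta> / 2 * ((1 + log_trunc \<epsilon> s) powr (\<theta> - 1) / (s + \<epsilon>))) has_real_derivative
     C * \<theta> / 2 * (((\<theta> - 1) * (1 + log_trunc \<epsilon> s) powr (\<theta> - 1 - of_nat 1) * (- 1 / (2 * (s + \<epsilon>))) * (s + \<epsilon>) -
        (1 + log_trunc \<epsilon> s) powr (\<theta> - 1) * 1) / ((s + \<epsilon>) * (s + \<epsilon>)))) (at s)"
    by (intro DERIV_cmult DERIV_divide se)
  have eq: "(\<theta> - 1) * (1 + log_trunc \<epsilon> s) powr (\<theta> - 1 - of_nat 1) * (- 1 / (2 * (s + \<epsilon>))) * (s + \<epsilon>)
     = (1 - \<theta>) / 2 * (1 + log_trunc \<epsilon> s) powr (\<theta> - 2)"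
    using se by (simp add: field_simps)
  show ?thesis
    using D unfolding eq moser_deriv_def[abs_def] moser_deriv2_def power2_eq_square mult_1_right .
qed

lemma moser_fun_Phi0_rad:
  assumes \<epsilon>: "0 < \<epsilon>" and C: "0 \<le> C" and \<theta>: "0 < \<theta>" "\<theta> \<le> 1" and k: "2 * k \<le> CARD('n::finite)"
  shows "(\<lambda>x :: real ^ 'n. moser_fun C \<theta> \<epsilon> (x \<bullet> x)) \<in> Phi0_rad k"
proof (rule Phi0_rad_radial[where g' = "moser_deriv C \<theta> \<epsilon>" and g'' = "moser_deriv2 C \<theta> \<epsilon>"])
  show "(moser_fun C \<theta> \<epsilon> has_real_derivative moser_deriv C \<theta> \<epsilon> s) (at s)"
    "(moser_deriv C \<theta> \<epsilon> has_real_derivative moser_deriv2 C \<theta> \<epsilon> s) (at s)" if "0 \<le> s" "s < 1" for s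
    using DERIV_moser_fun[OF \<epsilon>] DERIV_moser_deriv[OF \<epsilon>] that by auto
  have cl: "continuous_on {0..<1} (log_trunc \<epsilon>)"
    by (rule DERIV_continuous_on, rule has_field_derivative_at_within, rule DERIV_log_trunc) (use \<epsilon> in auto)
  have "1 + log_trunc \<epsilon> s \<noteq> 0" if "s \<in> {0..<1}" for s using log_trunc_nonneg[OF \<epsilon>, of s] that by auto
  then show "continuous_on {0..<1} (moser_deriv2 C \<theta> \<epsilon>)"
    unfolding moser_deriv2_def[abs_def] using \<epsilon> by (auto intro!: continuous_intros cl)
  show "2 * k \<le> CARD('n)" by (rule k)
  show "0 \<le> moser_deriv C \<theta> \<epsilon> s" if "0 \<le> s" "s < 1" for s
    unfolding moser_deriv_def using that \<epsilon> C \<theta> by simp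
  \<comment> \<open>With X = s + \<epsilon> the sum is C \<theta> / 2 times L powr (\<theta> - 2)
    (\<epsilon> L + s (1 - \<theta>) / 2) / X^2, and \<theta> \<le> 1 makes both summands
    nonnegative.\<close>
  show "0 \<le> moser_deriv C \<theta> \<epsilon> s + s * moser_deriv2 C \<theta> \<epsilon> s" if s: "0 \<le> s" "s < 1" for s
  proof -
    define L where "L = 1 + log_trunc \<epsilon> s"
    have L: "L > 0" unfolding L_def using log_trunc_nonneg[OF \<epsilon>, of s] s by simp
    have "L powr (\<theta> - 1) = L powr (\<theta> - 2 + 1)" by simp
    also have "\<dots> = L powr (\<theta> - 2) * L" unfolding powr_add using L by simp
    finally have L1: "L powr (\<theta> - 1) = L powr (\<theta> - 2) * L" .
    define X where "X = s + \<epsilon>"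
    have X: "X > 0" unfolding X_def using s \<epsilon> by simp
    have "moser_deriv C \<theta> \<epsilon> s + s * moser_deriv2 C \<theta> \<epsilon> s =
       C * \<theta> / 2 * ((L powr (\<theta> - 2) * L * X + s * ((1 - \<theta>) / 2 * L powr (\<theta> - 2) - L powr (\<theta> - 2) * L)) / X\<^sup>2)"
      unfolding moser_deriv_def moser_deriv2_def L_def[symmetric] L1 X_def[symmetric] using X
      by (simp add: field_simps power2_eq_square)
    also have "L powr (\<theta> - 2) * L * X + s * ((1 - \<theta>) / 2 * L powr (\<theta> - 2) - L powr (\<theta> - 2) * L) =
       L powr (\<theta> - 2) * (\<epsilon> * L + s * (1 - \<theta>) / 2)"
      unfolding X_def by (simp add: algebra_simps)
    finally show ?thesis using C \<theta> L s \<epsilon> by simp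
  qed
  show "continuous_on {0..1} (moser_fun C \<theta> \<epsilon>)"
    by (rule DERIV_continuous_on, rule has_field_derivative_at_within, rule DERIV_moser_fun) (use \<epsilon> in auto)
  show "moser_fun C \<theta> \<epsilon> 1 = 0" unfolding moser_fun_def log_trunc_def using \<epsilon> by simp
qed

lemma moser_fun_profile:
  assumes \<epsilon>: "0 < \<epsilon>" and r: "0 < r" "r < 1"
  shows "(radial_profile (\<lambda>x :: real ^ 'n::finite. moser_fun C \<theta> \<epsilon> (x \<bullet> x)) has_real_derivative
     2 * r * moser_deriv C \<theta> \<epsilon> (r\<^sup>2)) (at r)"
proof (rule DERIV_eq_open[of "\<lambda>r. moser_fun C \<theta> \<epsilon> (r\<^sup>2)" _ _ "{0<..<1}"])
  have "0 \<le> r\<^sup>2" "r\<^sup>2 \<le> 1" using r by (auto simp: power_le_one)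
  then have "(moser_fun C \<theta> \<epsilon> has_real_derivative moser_deriv C \<theta> \<epsilon> (r\<^sup>2)) (at (r\<^sup>2))"
    by (rule DERIV_moser_fun[OF \<epsilon>])
  moreover have "((\<lambda>r. r\<^sup>2) has_real_derivative 2 * r) (at r)" by (auto intro!: derivative_eq_intros)
  ultimately have "((\<lambda>r. moser_fun C \<theta> \<epsilon> (r\<^sup>2)) has_real_derivative moser_deriv C \<theta> \<epsilon> (r\<^sup>2) * (2 * r)) (at r)"
    by (rule DERIV_chain2)
  then show "((\<lambda>r. moser_fun C \<theta> \<epsilon> (r\<^sup>2)) has_real_derivative 2 * r * moser_deriv C \<theta> \<epsilon> (r\<^sup>2)) (at r)"
    by (simp add: mult.commute)
  show "moser_fun C \<theta> \<epsilon> (y\<^sup>2) = radial_profile (\<lambda>x :: real ^ 'n. moser_fun C \<theta> \<epsilon> (x \<bullet> x)) y" if "y \<in> {0<..<1}" for y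
    by (rule radial_profile_eqI[symmetric]) (use that in \<open>auto simp: power2_norm_eq_inner[symmetric]\<close>)
qed (use r in auto)

text \<open>For a profile v, r v'(r) is minus the derivative in t = ln (1/r), and r^2 / (r^2 +
  \<epsilon>) is the slope of the truncation with respect to t.\<close>

lemma moser_slope:
  assumes "0 < \<epsilon>" "0 < r"
  shows "r * (2 * r * moser_deriv C \<theta> \<epsilon> (r\<^sup>2)) = C * \<theta> * ((1 + log_trunc \<epsilon> (r\<^sup>2)) powr (\<theta> - 1) * (r\<^sup>2 / (r\<^sup>2 + \<epsilon>)))"
proof -
  define X where "X = r\<^sup>2 + \<epsilon>"
  show ?thesis unfolding moser_deriv_def X_def[symmetric] by (simp add: power2_eq_square)
qed

text \<open>The slope is at most 1, so raising its exponent from \<open>a\<close> to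
  \<open>b\<close> only helps. The energy bound takes a = \<beta> k and b = k; the domination of the
  truncated derivatives takes a = 1 - \<theta> and b = 1.\<close>

lemma log_trunc_slope_powr_le:
  assumes \<epsilon>: "0 < \<epsilon>" and r: "0 < r" "r < 1" and a: "0 \<le> a" "a \<le> b"
  shows "(1 + ln (1 / r)) powr a * (r\<^sup>2 / (r\<^sup>2 + \<epsilon>)) powr b \<le> (1 + log_trunc \<epsilon> (r\<^sup>2)) powr a"
proof -
  define q where "q = r\<^sup>2 / (r\<^sup>2 + \<epsilon>)"
  have q: "0 < q" "q \<le> 1" unfolding q_def using \<epsilon> r by (simp_all add: add_pos_pos)
  have t: "0 < ln (1 / r)" using r by simp
  have "(1 + ln (1 / r)) powr a * q powr b \<le> (1 + ln (1 / r)) powr a * q powr a"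
    using q a by (intro mult_left_mono powr_mono') auto
  also have "\<dots> = ((1 + ln (1 / r)) * q) powr a" using q t by (simp add: powr_mult)
  also have "\<dots> \<le> (1 + log_trunc \<epsilon> (r\<^sup>2)) powr a"
  proof (rule powr_mono2[OF a(1)])
    show "(1 + ln (1 / r)) * q \<le> 1 + log_trunc \<epsilon> (r\<^sup>2)" unfolding q_def by (rule log_trunc_slope_le[OF \<epsilon> r])
    show "0 \<le> (1 + ln (1 / r)) * q" using q t by (intro mult_nonneg_nonneg) auto
  qed
  finally show ?thesis unfolding q_def .
qed

text \<open>Let L be the truncated t. Of the k + 1 factors given by its slope, k are spent on
  exchanging the weight (1 + t) powr (\<beta> k) for (1 + L) powr (\<beta> k), which cancels k
  factors (1 + L) powr (\<theta> - 1) because \<theta> - 1 = - \<beta>. What is left is (1 + L) powr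
  (\<theta> - 1) times the slope of L, an exact derivative.\<close>

lemma moser_energy_le:
  assumes \<epsilon>: "0 < \<epsilon>" and C: "0 \<le> C" and \<beta>: "0 \<le> \<beta>" "\<beta> < 1" and \<theta>: "\<theta> = 1 - \<beta>"
  shows "(\<integral>\<^sup>+r\<in>{0<..<1}. ennreal (r ^ k * \<bar>2 * r * moser_deriv C \<theta> \<epsilon> (r\<^sup>2)\<bar> ^ (k + 1) * (1 + ln (1 / r)) powr (\<beta> * k)) \<partial>lborel)
    \<le> ennreal (C ^ (k + 1) * \<theta> ^ k * ((1 + log_trunc \<epsilon> 0) powr \<theta> - 1))"
proof -
  have \<theta>0: "0 < \<theta>" using \<beta> \<theta> by simp
  define f where "f r = (C * \<theta>) ^ (k + 1) * ((1 + log_trunc \<epsilon> (r\<^sup>2)) powr (\<theta> - 1) * (r / (r\<^sup>2 + \<epsilon>)))" for r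
  define F where "F r = - ((C * \<theta>) ^ (k + 1) / \<theta> * (1 + log_trunc \<epsilon> (r\<^sup>2)) powr \<theta>)" for r
  have r2: "0 \<le> r\<^sup>2" "r\<^sup>2 \<le> 1" if "r \<in> {0..1}" for r :: real using that by (auto simp: power_le_one)
  have pos: "1 + log_trunc \<epsilon> (r\<^sup>2) > 0" if "r \<in> {0..1}" for r using log_trunc_nonneg[OF \<epsilon> r2[OF that]] by simp
  have "(\<integral>\<^sup>+r\<in>{0<..<1}. ennreal (r ^ k * \<bar>2 * r * moser_deriv C \<theta> \<epsilon> (r\<^sup>2)\<bar> ^ (k + 1) * (1 + ln (1 / r)) powr (\<beta> * k)) \<partial>lborel)
     \<le> (\<integral>\<^sup>+r\<in>{0..1}. ennreal (f r) \<partial>lborel)"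
  proof (rule nn_integral_mono)
    fix r :: real
    show "ennreal (r ^ k * \<bar>2 * r * moser_deriv C \<theta> \<epsilon> (r\<^sup>2)\<bar> ^ (k + 1) * (1 + ln (1 / r)) powr (\<beta> * k)) * indicator {0<..<1} r
      \<le> ennreal (f r) * indicator {0..1} r"
    proof (cases "r \<in> {0<..<1}")
      case True
      then have r: "0 < r" "r < 1" by auto
      define L where "L = 1 + log_trunc \<epsilon> (r\<^sup>2)"
      define q where "q = r\<^sup>2 / (r\<^sup>2 + \<epsilon>)"
      have L: "L > 0" using pos[of r] r unfolding L_def by simp
      have q: "q > 0" unfolding q_def using \<epsilon> r by (simp add: add_pos_pos)
      have slope: "r * (2 * r * moser_deriv C \<theta> \<epsilon> (r\<^sup>2)) = C * \<theta> * (L powr (\<theta> - 1) * q)"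
        unfolding L_def q_def by (rule moser_slope[OF \<epsilon> r(1)])
      have V0: "0 \<le> 2 * r * moser_deriv C \<theta> \<epsilon> (r\<^sup>2)" using r \<epsilon> C \<theta>0 unfolding moser_deriv_def by simp
      have "r * (r ^ k * \<bar>2 * r * moser_deriv C \<theta> \<epsilon> (r\<^sup>2)\<bar> ^ (k + 1) * (1 + ln (1 / r)) powr (\<beta> * k)) =
         (r * (2 * r * moser_deriv C \<theta> \<epsilon> (r\<^sup>2))) ^ (k + 1) * (1 + ln (1 / r)) powr (\<beta> * k)"
        using V0 by (simp add: power_mult_distrib)
      also have "\<dots> = (C * \<theta>) ^ (k + 1) * (L powr (\<theta> - 1)) ^ (k + 1) * q * ((1 + ln (1 / r)) powr (\<beta> * k) * q powr k)"
        unfolding slope using q by (simp add: power_mult_distrib powr_realpow mult_ac)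
      also have "\<dots> \<le> (C * \<theta>) ^ (k + 1) * (L powr (\<theta> - 1)) ^ (k + 1) * q * L powr (\<beta> * k)"
      proof (rule mult_left_mono)
        have "\<beta> * k \<le> k" using \<beta> by (simp add: mult_left_le_one_le)
        then show "(1 + ln (1 / r)) powr (\<beta> * k) * q powr k \<le> L powr (\<beta> * k)"
          unfolding L_def q_def using \<beta> by (intro log_trunc_slope_powr_le[OF \<epsilon> r]) auto
      qed (use C \<theta>0 q in auto)
      also have "\<dots> = (C * \<theta>) ^ (k + 1) * (L powr (\<theta> - 1) * q) * ((L powr (\<theta> - 1)) ^ k * L powr (\<beta> * k))"
        by (simp add: mult_ac)
      also have "(L powr (\<theta> - 1)) ^ k * L powr (\<beta> * k) = 1"
        using L unfolding \<theta> by (simp add: powr_power powr_add[symmetric])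
      also have "(C * \<theta>) ^ (k + 1) * (L powr (\<theta> - 1) * q) * 1 = r * f r"
        unfolding f_def L_def q_def using r by (simp add: power2_eq_square)
      finally have "r ^ k * \<bar>2 * r * moser_deriv C \<theta> \<epsilon> (r\<^sup>2)\<bar> ^ (k + 1) * (1 + ln (1 / r)) powr (\<beta> * k) \<le> f r"
        using r(1) by (simp only: mult_le_cancel_left_pos)
      then show ?thesis using True by (auto intro!: ennreal_leI)
    qed simp
  qed
  also have "\<dots> = ennreal (F 1 - F 0)"
  proof (rule nn_integral_FTC_Icc)
    show "f \<in> borel_measurable borel" unfolding f_def log_trunc_def by measurable
    show "0 \<le> f r" if "r \<in> {0..1}" for r unfolding f_def using that C \<theta>0 \<epsilon> by simp
    show "(F has_real_derivative f r) (at r)" if "r \<in> {0..1}" for r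
    proof -
      have "((\<lambda>r. r\<^sup>2) has_real_derivative 2 * r) (at r)" by (auto intro!: derivative_eq_intros)
      from DERIV_chain2[OF DERIV_one_plus_log_trunc[OF \<epsilon> r2(1)[OF that]] this]
      have "((\<lambda>r. 1 + log_trunc \<epsilon> (r\<^sup>2)) has_real_derivative - 1 / (2 * (r\<^sup>2 + \<epsilon>)) * (2 * r)) (at r)" .
      from DERIV_minus[OF DERIV_cmult[OF DERIV_fun_powr[OF this pos[OF that], of \<theta>], of "(C * \<theta>) ^ (k + 1) / \<theta>"]]
      have D: "(F has_real_derivative - ((C * \<theta>) ^ (k + 1) / \<theta> * (\<theta> * (1 + log_trunc \<epsilon> (r\<^sup>2)) powr (\<theta> - of_nat 1) * (- 1 / (2 * (r\<^sup>2 + \<epsilon>)) * (2 * r))))) (at r)"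
        unfolding F_def[abs_def] .
      define X where "X = r\<^sup>2 + \<epsilon>"
      define P where "P = (C * \<theta>) ^ (k + 1)"
      show ?thesis
        by (rule DERIV_cong[OF D]) (use \<theta>0 in \<open>simp add: f_def X_def[symmetric] P_def[symmetric]\<close>)
    qed
  qed auto
  also have "F 1 - F 0 = C ^ (k + 1) * \<theta> ^ k * ((1 + log_trunc \<epsilon> 0) powr \<theta> - 1)"
  proof -
    have "log_trunc \<epsilon> 1 = 0" unfolding log_trunc_def using \<epsilon> by simp
    then show ?thesis unfolding F_def using \<theta>0 by (simp add: power_mult_distrib algebra_simps)
  qed
  finally show ?thesis .
qed

section \<open>Lower bounds for the integrals and growth of the exponents\<close>

lemma ball_exp_integral_ge:
  fixes G :: "real ^ 'n::finite \<Rightarrow> real"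
  assumes R: "0 \<le> R" "R \<le> 1" and G: "\<And>x. x \<noteq> 0 \<Longrightarrow> norm x < R \<Longrightarrow> K \<le> G x"
  shows "ennreal (unit_ball_vol CARD('n) * R ^ CARD('n) * exp K) \<le> (\<integral>\<^sup>+x\<in>ball 0 1. ennreal (exp (G x)) \<partial>lborel)"
proof -
  have "ennreal (unit_ball_vol CARD('n) * R ^ CARD('n) * exp K) = ennreal (exp K) * ennreal (unit_ball_vol CARD('n) * R ^ CARD('n))"
    using R by (simp add: ennreal_mult[symmetric] mult.commute)
  also have "\<dots> = ennreal (exp K) * emeasure lborel (ball (0 :: real ^ 'n) R)"
    using R by (simp add: emeasure_ball)
  also have "\<dots> = (\<integral>\<^sup>+x. ennreal (exp K) * indicator (ball (0 :: real ^ 'n) R) x \<partial>lborel)"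
    by (rule nn_integral_cmult_indicator[symmetric]) simp
  also have "\<dots> \<le> (\<integral>\<^sup>+x\<in>ball 0 1. ennreal (exp (G x)) \<partial>lborel)"
  proof (rule nn_integral_mono_AE)
    have "AE x in lborel. x \<noteq> (0 :: real ^ 'n)" by (rule AE_lborel_singleton)
    then show "AE x in lborel. ennreal (exp K) * indicator (ball (0 :: real ^ 'n) R) x \<le> ennreal (exp (G x)) * indicator (ball 0 1) x"
    proof eventually_elim
      fix x :: "real ^ 'n" assume x: "x \<noteq> 0"
      show "ennreal (exp K) * indicator (ball (0 :: real ^ 'n) R) x \<le> ennreal (exp (G x)) * indicator (ball 0 1) x"
        using G[OF x] R by (cases "norm x < R") (auto intro!: ennreal_leI)
    qed
  qed
  finally show ?thesis .
qed

text \<open>The quotient behaves like T powr (k \<theta>), so its root is asymptotic to T and the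
  difference to (\<kappa> - 1) T. Comparing the normalised root with (1 + 1/\<kappa>) / 2 keeps half
  of this growth.\<close>

lemma moser_exponent_limit:
  fixes \<theta> \<kappa> c :: real and k :: nat
  assumes \<theta>: "0 < \<theta>" and k: "1 \<le> k" and \<kappa>: "1 < \<kappa>"
  shows "filterlim (\<lambda>T. \<kappa> * (((1 + T - c) powr \<theta> - 1) ^ (k + 1) / ((1 + T) powr \<theta> - 1)) powr (1 / (k * \<theta>)) - T) at_top at_top"
proof -
  define x where "x T = ((1 + T - c) powr \<theta> - 1) / T powr \<theta>" for T
  define y where "y T = ((1 + T) powr \<theta> - 1) / T powr \<theta>" for T
  have x: "(x \<longlongrightarrow> 1) at_top" unfolding x_def[abs_def] using \<theta> by real_asymp
  have y: "(y \<longlongrightarrow> 1) at_top" unfolding y_def[abs_def] using \<theta> by real_asymp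
  have "((\<lambda>T. (x T ^ (k + 1) / y T) powr (1 / (k * \<theta>))) \<longlongrightarrow> (1 ^ (k + 1) / 1) powr (1 / (k * \<theta>))) at_top"
    by (intro tendsto_intros x y) auto
  then have "((\<lambda>T. (x T ^ (k + 1) / y T) powr (1 / (k * \<theta>))) \<longlongrightarrow> 1) at_top" by simp
  moreover have "(1 + 1 / \<kappa>) / 2 < 1" using \<kappa> by simp
  ultimately have "\<forall>\<^sub>F T in at_top. (1 + 1 / \<kappa>) / 2 < (x T ^ (k + 1) / y T) powr (1 / (k * \<theta>))"
    by (rule order_tendstoD(1))
  moreover have "\<forall>\<^sub>F T in at_top. 0 < x T" "\<forall>\<^sub>F T in at_top. 0 < y T"
    using order_tendstoD(1)[OF x, of 0] order_tendstoD(1)[OF y, of 0] by auto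
  moreover have "\<forall>\<^sub>F T in at_top. 0 < (T::real)" by (rule eventually_gt_at_top)
  ultimately have ev: "\<forall>\<^sub>F T in at_top. (\<kappa> - 1) / 2 * T \<le>
     \<kappa> * (((1 + T - c) powr \<theta> - 1) ^ (k + 1) / ((1 + T) powr \<theta> - 1)) powr (1 / (k * \<theta>)) - T"
  proof eventually_elim
    fix T assume T: "(1 + 1 / \<kappa>) / 2 < (x T ^ (k + 1) / y T) powr (1 / (k * \<theta>))" "0 < x T" "0 < y T" "0 < T"
    have A: "(1 + T - c) powr \<theta> - 1 = x T * T powr \<theta>" "(1 + T) powr \<theta> - 1 = y T * T powr \<theta>"
      unfolding x_def y_def using T(4) by auto
    have "(x T * T powr \<theta>) ^ (k + 1) / (y T * T powr \<theta>) = x T ^ (k + 1) / y T * (T powr \<theta>) ^ k"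
      using T by (simp add: power_mult_distrib field_simps)
    also have "(T powr \<theta>) ^ k = T powr (k * \<theta>)" using T(4) by (simp add: powr_power)
    finally have e: "(x T * T powr \<theta>) ^ (k + 1) / (y T * T powr \<theta>) = x T ^ (k + 1) / y T * T powr (k * \<theta>)" .
    have "(((1 + T - c) powr \<theta> - 1) ^ (k + 1) / ((1 + T) powr \<theta> - 1)) powr (1 / (k * \<theta>)) =
        (x T ^ (k + 1) / y T) powr (1 / (k * \<theta>)) * (T powr (k * \<theta>)) powr (1 / (k * \<theta>))"
      unfolding A e by (rule powr_mult)
    also have "(T powr (k * \<theta>)) powr (1 / (k * \<theta>)) = T" unfolding powr_powr using T(4) k \<theta> by simp
    finally have eq: "(((1 + T - c) powr \<theta> - 1) ^ (k + 1) / ((1 + T) powr \<theta> - 1)) powr (1 / (k * \<theta>)) =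
        (x T ^ (k + 1) / y T) powr (1 / (k * \<theta>)) * T" .
    have "\<kappa> * ((1 + 1 / \<kappa>) / 2 * T) \<le> \<kappa> * ((x T ^ (k + 1) / y T) powr (1 / (k * \<theta>)) * T)"
      using T \<kappa> by (intro mult_left_mono mult_right_mono) auto
    moreover have "\<kappa> * ((1 + 1 / \<kappa>) / 2 * T) = (\<kappa> - 1) / 2 * T + T" using \<kappa> by (simp add: field_simps)
    ultimately show "(\<kappa> - 1) / 2 * T \<le>
       \<kappa> * (((1 + T - c) powr \<theta> - 1) ^ (k + 1) / ((1 + T) powr \<theta> - 1)) powr (1 / (k * \<theta>)) - T"
      unfolding eq by linarith
  qed
  have "filterlim (\<lambda>T. (\<kappa> - 1) / 2 * T) at_top at_top"
    using \<kappa> by (intro filterlim_tendsto_pos_mult_at_top[OF tendsto_const _ filterlim_ident]) auto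
  then show ?thesis using ev by (rule filterlim_at_top_mono)
qed

lemma power_exponent_limit:
  fixes \<theta> \<gamma> a :: real
  assumes \<theta>: "0 < \<theta>" "1 < \<theta> * \<gamma>" and \<gamma>: "0 < \<gamma>" and a: "0 < a"
  shows "filterlim (\<lambda>T. ((1 + T) powr \<theta> - 1) powr \<gamma> - a * T) at_top at_top"
proof -
  have "((\<lambda>T::real. ((1 + T) powr \<theta> - 1) / T powr \<theta>) \<longlongrightarrow> 1) at_top" using \<theta>(1) by real_asymp
  then have "\<forall>\<^sub>F T in at_top. 1 / 2 < ((1 + T) powr \<theta> - 1) / T powr \<theta>" by (rule order_tendstoD(1)) simp
  moreover have "\<forall>\<^sub>F T in at_top. 0 < (T::real)" by (rule eventually_gt_at_top)
  ultimately have ev: "\<forall>\<^sub>F T in at_top. (1 / 2) powr \<gamma> * T powr (\<theta> * \<gamma>) - a * T \<le> ((1 + T) powr \<theta> - 1) powr \<gamma> - a * T"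
  proof eventually_elim
    fix T :: real assume T: "1 / 2 < ((1 + T) powr \<theta> - 1) / T powr \<theta>" "0 < T"
    then have "1 / 2 * T powr \<theta> \<le> (1 + T) powr \<theta> - 1" by (simp add: field_simps)
    then have "(1 / 2 * T powr \<theta>) powr \<gamma> \<le> ((1 + T) powr \<theta> - 1) powr \<gamma>" using \<gamma> by (intro powr_mono2) auto
    then show "(1 / 2) powr \<gamma> * T powr (\<theta> * \<gamma>) - a * T \<le> ((1 + T) powr \<theta> - 1) powr \<gamma> - a * T"
      unfolding powr_mult powr_powr by simp
  qed
  define b :: real where "b = (1 / 2) powr \<gamma>"
  define e where "e = \<theta> * \<gamma>"
  have "0 < b" "1 < e" unfolding b_def e_def using \<theta>(2) by simp_all
  then have "filterlim (\<lambda>T. b * T powr e - a * T) at_top at_top" using a by real_asymp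
  then show ?thesis unfolding b_def e_def using ev by (rule filterlim_at_top_mono)
qed

section \<open>Convergence in norm and membership in the weighted space\<close>

lemma Phi_norm_tendsto_0I:
  fixes u :: "nat \<Rightarrow> real ^ 'n::finite \<Rightarrow> real"
  assumes "(\<lambda>m. Phi_energy k w (u m)) \<longlonglongrightarrow> 0"
  shows "(\<lambda>m. Phi_norm k w (u m)) \<longlonglongrightarrow> 0"
proof (rule order_tendstoI)
  fix a :: ennreal assume "0 < a"
  then obtain \<delta> where \<delta>: "0 < \<delta>" "\<delta> < a" using dense by blast
  then have "\<delta> \<noteq> \<infinity>" by auto
  then obtain d where d: "\<delta> = ennreal d" "0 \<le> d" by (cases \<delta>) auto
  then have d0: "0 < d" using \<delta>(1) by simp
  have "(\<lambda>m. ennreal (norm_const TYPE('n) k) * Phi_energy k w (u m)) \<longlonglongrightarrow> ennreal (norm_const TYPE('n) k) * 0"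
    by (rule tendsto_mult_ennreal[OF tendsto_const assms]) auto
  then have "\<forall>\<^sub>F m in sequentially. ennreal (norm_const TYPE('n) k) * Phi_energy k w (u m) < ennreal (d ^ (k + 1))"
    using d0 by (intro order_tendstoD(2)) auto
  then show "\<forall>\<^sub>F m in sequentially. Phi_norm k w (u m) < a"
  proof eventually_elim
    case (elim m)
    then have "Phi_norm k w (u m) \<le> ennreal d" unfolding Phi_norm_le_iff[OF d(2)] by (rule less_imp_le)
    then show ?case using \<delta>(2) d(1) by auto
  qed
qed simp

lemma Phi0_rad_in_weighted:
  fixes u :: "real ^ 'n::finite \<Rightarrow> real"
  assumes u: "u \<in> Phi0_rad k" and fin: "Phi_norm k w u < \<infinity>"
  shows "u \<in> Phi0_rad_weighted k w"
proof -
  have "radial_on (ball 0 1) u"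
    using u unfolding Phi0_rad_def radial_on_def by auto
  moreover have "Phi_norm k w (\<lambda>x :: real ^ 'n. u x - u x) = 0"
  proof -
    have "radial_profile (\<lambda>x :: real ^ 'n. u x - u x) = (\<lambda>r. 0)" unfolding radial_profile_def by simp
    then have "Phi_energy k w (\<lambda>x :: real ^ 'n. u x - u x) = 0" unfolding Phi_energy_def by simp
    then show ?thesis unfolding Phi_norm_energy by simp
  qed
  then have "(\<lambda>m. Phi_norm k w (\<lambda>x. (\<lambda>_::nat. u) m x - u x)) \<longlonglongrightarrow> 0" by simp
  ultimately show ?thesis
    unfolding Phi0_rad_weighted_def using Phi0_rad_profile[OF u] u fin
    by (intro CollectI conjI exI[of _ "\<lambda>_. u"]) auto
qed

lemma weight1_eq: "0 < r \<Longrightarrow> r < 1 \<Longrightarrow> n = 2 * k \<Longrightarrow> weight1 n \<beta> r = (1 + ln (1 / r)) powr (\<beta> * k)"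
  unfolding weight1_def by (simp add: ln_div)

lemma Phi_energy_le:
  fixes u :: "real ^ 'n::finite \<Rightarrow> real"
  assumes n: "n = CARD('n)" "n = 2 * k" and w: "w = weight0 n \<beta> \<or> w = weight1 n \<beta>" and \<beta>: "0 \<le> \<beta>"
    and d: "\<And>r. 0 < r \<Longrightarrow> r < 1 \<Longrightarrow> (radial_profile u has_real_derivative d r) (at r)"
  shows "Phi_energy k w u \<le> (\<integral>\<^sup>+r\<in>{0<..<1}. ennreal (r ^ k * \<bar>d r\<bar> ^ (k + 1) * (1 + ln (1 / r)) powr (\<beta> * k)) \<partial>lborel)"
  unfolding Phi_energy_def
proof (rule nn_integral_mono)
  fix r :: real
  show "ennreal (r ^ (CARD('n) - k) * \<bar>deriv (radial_profile u) r\<bar> ^ (k + 1) * w r) * indicator {0<..<1} r \<le>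
     ennreal (r ^ k * \<bar>d r\<bar> ^ (k + 1) * (1 + ln (1 / r)) powr (\<beta> * k)) * indicator {0<..<1} r"
  proof (cases "r \<in> {0<..<1}")
    case True
    then have r: "0 < r" "r < 1" by auto
    moreover have "w r \<le> (1 + ln (1 / r)) powr (\<beta> * k)"
      using weight0_le(2)[OF w \<beta> r] weight1_eq[OF r n(2)] by simp
    moreover have "CARD('n) - k = k" using n by simp
    ultimately show ?thesis using DERIV_imp_deriv[OF d[OF r]] by (auto intro!: ennreal_leI mult_left_mono)
  qed simp
qed

section \<open>Failure beyond the critical values\<close>

text \<open>The logarithm is truncated at height T and \<open>C\<close> spends the energy allowed.
  On the ball of radius sqrt \<epsilon>, about exp (- T), |u| is at least C A; the volume is of
  order exp (- n T), so the integral is at least a constant times exp (n (\<kappa> \<Phi>(T) - T)),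
  which is unbounded in T.\<close>

lemma supercritical_sup_infinite:
  fixes n k :: nat and \<beta> \<gamma> \<alpha> \<alpha>\<^sub>0 M :: real and w :: "real \<Rightarrow> real"
  assumes n: "n = CARD('n::finite)" "n = 2 * k" and k: "k \<ge> 1" and beta: "0 \<le> \<beta>" "\<beta> < 1"
    and w: "w = weight0 n \<beta> \<or> w = weight1 n \<beta>"
    and gamma: "\<gamma> = (real k + 1) / (real k * (1 - \<beta>))"
    and alpha0: "\<alpha>\<^sub>0 = real n * (norm_const TYPE('n) k powr (1 / real k) * (1 - \<beta>)) powr (1 / (1 - \<beta>))"
    and alpha: "\<alpha>\<^sub>0 < \<alpha>"
  shows "\<exists>u \<in> (Phi0_rad_weighted k w :: (real ^ 'n \<Rightarrow> real) set). Phi_norm k w u \<le> 1 \<and>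
     ennreal M \<le> (\<integral>\<^sup>+x\<in>ball 0 1. ennreal (exp (\<alpha> * \<bar>u x\<bar> powr \<gamma>)) \<partial>lborel)"
proof -
  define c where "c = norm_const TYPE('n) k"
  have c: "c > 0" unfolding c_def by (rule norm_const_pos) (use n k in auto)
  define \<theta> where "\<theta> = 1 - \<beta>"
  have \<theta>: "0 < \<theta>" "\<theta> \<le> 1" unfolding \<theta>_def using beta by auto
  have k0: "real k > 0" using k by simp
  have n0: "real n > 0" using n k by simp
  \<comment> \<open>Brings \<open>c\<close> and \<theta> under one root, matching the factor c
    \<theta>^k of the energy.\<close>
  have \<alpha>0: "\<alpha>\<^sub>0 = real n * (c * \<theta> ^ k) powr (1 / (k * \<theta>))"
  proof -
    have "\<theta> = (\<theta> ^ k) powr (1 / k)" using \<theta> k0 by (simp add: powr_power powr_powr flip: powr_realpow)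
    then have "c powr (1 / k) * \<theta> = (c * \<theta> ^ k) powr (1 / k)" by (simp add: powr_mult)
    then show ?thesis unfolding alpha0 c_def[symmetric] \<theta>_def[symmetric] by (simp add: powr_powr)
  qed
  have \<alpha>0_pos: "\<alpha>\<^sub>0 > 0" unfolding \<alpha>0 using n0 c \<theta> by simp
  define \<kappa> where "\<kappa> = \<alpha> / \<alpha>\<^sub>0"
  have \<kappa>: "1 < \<kappa>" unfolding \<kappa>_def using alpha \<alpha>0_pos by simp
  define V where "V = unit_ball_vol (real n)"
  have V: "V > 0" unfolding V_def by simp
  \<comment> \<open>ln 2 / 2 is the drop of the truncated logarithm between s = 0 and s =
    \<epsilon>.\<close>
  define \<Phi> where "\<Phi> T = (((1 + T - ln 2 / 2) powr \<theta> - 1) ^ (k + 1) / ((1 + T) powr \<theta> - 1)) powr (1 / (k * \<theta>))" for T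
  \<comment> \<open>Makes V exp (n K) equal to max M 1; the maximum keeps the argument of the
    logarithm positive.\<close>
  define K where "K = ln (max M 1 / V) / n"
  have "filterlim (\<lambda>T. \<kappa> * \<Phi> T - T) at_top at_top"
    unfolding \<Phi>_def by (rule moser_exponent_limit[OF \<theta>(1) k \<kappa>])
  then have "\<forall>\<^sub>F T in at_top. K \<le> \<kappa> * \<Phi> T - T" unfolding filterlim_at_top by blast
  moreover have "\<forall>\<^sub>F T in at_top. (1::real) \<le> T" by (rule eventually_ge_at_top)
  ultimately have "\<forall>\<^sub>F T in at_top. K \<le> \<kappa> * \<Phi> T - T \<and> 1 \<le> T" by (rule eventually_conj)
  then obtain T where T: "K \<le> \<kappa> * \<Phi> T - T" "1 \<le> T"
    unfolding eventually_at_top_linorder by blast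
  \<comment> \<open>The solution of (1 + \<epsilon>) / \<epsilon> = exp (2 T), so that the
    truncation takes the value T at the origin.\<close>
  define \<epsilon> where "\<epsilon> = 1 / (exp (2 * T) - 1)"
  have "1 + 2 * T \<le> exp (2 * T)" by (rule exp_ge_add_one_self)
  then have e2: "2 \<le> exp (2 * T) - 1" using T(2) by linarith
  have \<epsilon>: "0 < \<epsilon>" "\<epsilon> \<le> 1" unfolding \<epsilon>_def using e2 T(2) by (auto simp: divide_le_eq_1)
  have \<epsilon>T: "(1 + \<epsilon>) / \<epsilon> = exp (2 * T)" unfolding \<epsilon>_def using e2 T(2) by (simp add: field_simps)
  have L0: "log_trunc \<epsilon> 0 = T" unfolding log_trunc_def using \<epsilon>T by simp
  define B where "B = (1 + T) powr \<theta> - 1"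
  have B: "B > 0" unfolding B_def using T(2) \<theta> by simp
  define A where "A = (1 + T - ln 2 / 2) powr \<theta> - 1"
  have ln2: "ln 2 / 2 < (1::real)" using ln_2_less_1 by simp
  have "1 \<le> 1 + T - ln 2 / 2" using T(2) ln2 by linarith
  then have "1 \<le> (1 + T - ln 2 / 2) powr \<theta>" using \<theta> by (intro ge_one_powr_ge_zero) auto
  then have A: "A \<ge> 0" unfolding A_def by simp
  \<comment> \<open>Makes c C^(k + 1) \<theta>^k B equal to 1, which is \<open>c\<close> times the
    energy bound of \<open>moser_energy_le\<close>.\<close>
  define C where "C = (c * \<theta> ^ k * B) powr (- 1 / (k + 1))"
  have cB: "c * \<theta> ^ k * B > 0" using c \<theta> B by simp
  have C0: "C > 0" unfolding C_def using c \<theta> B by simp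
  have Ck: "C ^ (k + 1) = 1 / (c * \<theta> ^ k * B)"
  proof -
    have "C ^ (k + 1) = C powr real (k + 1)" using C0 by (rule powr_realpow[symmetric])
    also have "\<dots> = (c * \<theta> ^ k * B) powr (- 1)" unfolding C_def powr_powr by simp
    finally show ?thesis using c \<theta> B by (simp add: powr_minus_divide)
  qed
  define u :: "real ^ 'n \<Rightarrow> real" where "u x = moser_fun C \<theta> \<epsilon> (x \<bullet> x)" for x
  have uP: "u \<in> Phi0_rad k" unfolding u_def[abs_def] by (rule moser_fun_Phi0_rad) (use \<epsilon> C0 \<theta> n in auto)
  have "Phi_energy k w u \<le>
    (\<integral>\<^sup>+r\<in>{0<..<1}. ennreal (r ^ k * \<bar>2 * r * moser_deriv C \<theta> \<epsilon> (r\<^sup>2)\<bar> ^ (k + 1) * (1 + ln (1 / r)) powr (\<beta> * k)) \<partial>lborel)"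
    unfolding u_def[abs_def] by (rule Phi_energy_le[OF n w beta(1) moser_fun_profile[OF \<epsilon>(1)]])
  also have "\<dots> \<le> ennreal (C ^ (k + 1) * \<theta> ^ k * B)"
    using moser_energy_le[OF \<epsilon>(1) _ beta \<theta>_def, of C k] C0 unfolding L0 B_def by simp
  finally have "ennreal c * Phi_energy k w u \<le> ennreal c * ennreal (C ^ (k + 1) * \<theta> ^ k * B)"
    by (rule mult_left_mono) simp
  also have "\<dots> = ennreal (c * (C ^ (k + 1) * \<theta> ^ k * B))" using c C0 \<theta> B by (intro ennreal_mult[symmetric]) auto
  also have "c * (C ^ (k + 1) * \<theta> ^ k * B) = 1 ^ (k + 1)" unfolding Ck using c \<theta> B by simp
  finally have "Phi_norm k w u \<le> ennreal 1" unfolding c_def by (subst Phi_norm_le_iff) simp_all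
  then have N1: "Phi_norm k w u \<le> 1" by simp
  then have uW: "u \<in> Phi0_rad_weighted k w" using uP by (intro Phi0_rad_in_weighted) (auto simp: le_less_trans[OF N1])
  have \<gamma>0: "\<gamma> > 0" unfolding gamma using k0 beta by simp
  have expo: "\<alpha> * (C * A) powr \<gamma> = n * (\<kappa> * \<Phi> T)"
  proof -
    have \<gamma>: "\<gamma> = (k + 1) * (1 / (k * \<theta>))" unfolding gamma \<theta>_def by simp
    have "(C * A) powr \<gamma> = ((C * A) powr real (k + 1)) powr (1 / (k * \<theta>))" unfolding \<gamma> powr_powr by simp
    also have "(C * A) powr real (k + 1) = (C * A) ^ (k + 1)"
      using powr_realpow'[of "C * A" "k + 1"] C0 A by simp
    also have "\<dots> = A ^ (k + 1) / B * (1 / (c * \<theta> ^ k))" unfolding power_mult_distrib Ck by simp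
    also have "\<dots> powr (1 / (k * \<theta>)) = \<Phi> T * (1 / (c * \<theta> ^ k)) powr (1 / (k * \<theta>))"
      unfolding \<Phi>_def A_def B_def by (rule powr_mult)
    also have "(1 / (c * \<theta> ^ k)) powr (1 / (k * \<theta>)) = 1 / (c * \<theta> ^ k) powr (1 / (k * \<theta>))"
      using c \<theta> by (simp add: powr_divide)
    finally show ?thesis unfolding \<kappa>_def \<alpha>0 using n0 by simp
  qed
  have "ennreal (unit_ball_vol CARD('n) * sqrt \<epsilon> ^ CARD('n) * exp (n * (\<kappa> * \<Phi> T))) \<le>
     (\<integral>\<^sup>+x\<in>ball 0 1. ennreal (exp (\<alpha> * \<bar>u x\<bar> powr \<gamma>)) \<partial>lborel)"
  proof (rule ball_exp_integral_ge)
    show "0 \<le> sqrt \<epsilon>" "sqrt \<epsilon> \<le> 1" using \<epsilon> by auto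
    fix x :: "real ^ 'n" assume x: "x \<noteq> 0" "norm x < sqrt \<epsilon>"
    have s: "0 \<le> x \<bullet> x" "x \<bullet> x \<le> \<epsilon>"
    proof -
      have "(norm x)\<^sup>2 \<le> (sqrt \<epsilon>)\<^sup>2" using x by (intro power_mono) auto
      then show "x \<bullet> x \<le> \<epsilon>" using \<epsilon> by (simp add: power2_norm_eq_inner)
    qed simp
    have sp: "0 < x \<bullet> x + \<epsilon>" using s \<epsilon> by linarith
    have "(1 + \<epsilon>) / (\<epsilon> + \<epsilon>) \<le> (1 + \<epsilon>) / (x \<bullet> x + \<epsilon>)" using s sp \<epsilon> by (intro divide_left_mono mult_pos_pos) linarith+
    then have "ln ((1 + \<epsilon>) / (\<epsilon> + \<epsilon>)) \<le> ln ((1 + \<epsilon>) / (x \<bullet> x + \<epsilon>))"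
      using \<epsilon> sp by (intro ln_mono divide_pos_pos) linarith+
    moreover have "ln ((1 + \<epsilon>) / (\<epsilon> + \<epsilon>)) = 2 * T - ln 2"
    proof -
      have e: "(1 + \<epsilon>) / (\<epsilon> + \<epsilon>) = exp (2 * T) / 2" unfolding \<epsilon>T[symmetric] by simp
      show ?thesis unfolding e by (simp add: ln_div)
    qed
    ultimately have "T - ln 2 / 2 \<le> log_trunc \<epsilon> (x \<bullet> x)" unfolding log_trunc_def by simp
    then have "(1 + T - ln 2 / 2) powr \<theta> \<le> (1 + log_trunc \<epsilon> (x \<bullet> x)) powr \<theta>"
      using T(2) ln2 \<theta> by (intro powr_mono2) linarith+
    then have "C * A \<le> C * ((1 + log_trunc \<epsilon> (x \<bullet> x)) powr \<theta> - 1)"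
      unfolding A_def using C0 by (intro mult_left_mono) auto
    then have "C * A \<le> \<bar>u x\<bar>" unfolding u_def moser_fun_def by linarith
    then have "\<alpha> * (C * A) powr \<gamma> \<le> \<alpha> * \<bar>u x\<bar> powr \<gamma>"
      using \<gamma>0 C0 A alpha \<alpha>0_pos by (intro mult_left_mono powr_mono2) auto
    then show "n * (\<kappa> * \<Phi> T) \<le> \<alpha> * \<bar>u x\<bar> powr \<gamma>" unfolding expo .
  qed
  moreover have "M \<le> unit_ball_vol CARD('n) * sqrt \<epsilon> ^ CARD('n) * exp (n * (\<kappa> * \<Phi> T))"
  proof -
    \<comment> \<open>As n = 2 k, the n-th power of sqrt \<epsilon> is \<epsilon>^k, so \<epsilon>
      \<ge> exp (- 2 T) yields the factor exp (- n T).\<close>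
    have "exp (- (2 * T)) \<le> \<epsilon>" unfolding \<epsilon>_def exp_minus inverse_eq_divide using e2 by (intro divide_left_mono mult_pos_pos) linarith+
    then have "exp (- (2 * T)) ^ k \<le> \<epsilon> ^ k" by (intro power_mono) auto
    also have "\<epsilon> ^ k = sqrt \<epsilon> ^ CARD('n)"
    proof -
      have "sqrt \<epsilon> ^ CARD('n) = (sqrt \<epsilon> ^ 2) ^ k" unfolding n(1)[symmetric] n(2) by (rule power_mult)
      then show ?thesis using \<epsilon> by simp
    qed
    finally have s: "exp (- (n * T)) \<le> sqrt \<epsilon> ^ CARD('n)" using n(2) by (simp flip: exp_of_nat_mult add: mult_ac)
    have "M \<le> max M 1" by simp
    also have "max M 1 = V * exp (n * K)" unfolding K_def using n0 V by simp
    also have "\<dots> \<le> V * exp (n * (\<kappa> * \<Phi> T - T))" using T(1) n0 V by (simp add: mult_left_mono)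
    also have "\<dots> = V * exp (- (n * T)) * exp (n * (\<kappa> * \<Phi> T))" by (simp add: right_diff_distrib mult.assoc flip: exp_add)
    also have "\<dots> \<le> V * sqrt \<epsilon> ^ CARD('n) * exp (n * (\<kappa> * \<Phi> T))"
      using s V by (intro mult_right_mono mult_left_mono) auto
    finally show ?thesis unfolding V_def n(1) .
  qed
  ultimately have "ennreal M \<le> (\<integral>\<^sup>+x\<in>ball 0 1. ennreal (exp (\<alpha> * \<bar>u x\<bar> powr \<gamma>)) \<partial>lborel)"
    using ennreal_leI order_trans by blast
  then show ?thesis using uW N1 by blast
qed

text \<open>A power \<theta> strictly between 1/\<gamma> and \<open>1 / \<gamma>\<^sub>0\<close> is
  used: the upper bound makes the energy finite, the lower one makes |u| powr \<gamma> outgrow n t.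
  The function lies in the closure because its truncations converge to it by dominated
  convergence.\<close>

lemma supercritical_exp_integral_infinite:
  fixes n k :: nat and \<beta> \<gamma> \<gamma>\<^sub>0 :: real and w :: "real \<Rightarrow> real"
  assumes n: "n = CARD('n::finite)" "n = 2 * k" and k: "k \<ge> 1" and beta: "0 \<le> \<beta>" "\<beta> < 1"
    and w: "w = weight0 n \<beta> \<or> w = weight1 n \<beta>"
    and gamma0: "\<gamma>\<^sub>0 = (real k + 1) / (real k * (1 - \<beta>))" and gamma: "\<gamma>\<^sub>0 < \<gamma>"
  shows "\<exists>u \<in> (Phi0_rad_weighted k w :: (real ^ 'n \<Rightarrow> real) set).
     (\<integral>\<^sup>+x\<in>ball 0 1. ennreal (exp (\<bar>u x\<bar> powr \<gamma>)) \<partial>lborel) = \<infinity>"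
proof -
  have k0: "real k > 0" using k by simp
  have n0: "real n > 0" using n k by simp
  have \<gamma>0: "0 < \<gamma>\<^sub>0" "0 < \<gamma>" using gamma unfolding gamma0 using k0 beta by (auto intro: order.strict_trans[rotated])
  have "1 / \<gamma> < 1 / \<gamma>\<^sub>0" using \<gamma>0 gamma by (simp add: frac_less2)
  then obtain \<theta> where \<theta>': "1 / \<gamma> < \<theta>" "\<theta> < 1 / \<gamma>\<^sub>0" using dense by blast
  have "0 < 1 / \<gamma>" using \<gamma>0 by simp
  then have \<theta>0: "0 < \<theta>" using \<theta>'(1) by linarith
  have \<theta>\<gamma>: "1 < \<theta> * \<gamma>" using \<theta>'(1) \<gamma>0 by (simp add: field_simps)
  have "1 / \<gamma>\<^sub>0 = k * (1 - \<beta>) / (k + 1)" unfolding gamma0 by simp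
  then have "\<theta> < k * (1 - \<beta>) / (k + 1)" using \<theta>'(2) by linarith
  then have \<theta>k: "\<theta> * (k + 1) < k * (1 - \<beta>)" by (subst (asm) pos_less_divide_eq) auto
  have \<theta>1: "\<theta> < 1"
  proof -
    have "real k * (1 - \<beta>) \<le> real k" using beta by (simp add: mult_left_le)
    then have "\<theta> * real (k + 1) < real k" using \<theta>k by linarith
    then have "\<theta> * real (k + 1) < 1 * real (k + 1)" by (rule less_le_trans) simp
    then show ?thesis by (rule mult_right_less_imp_less) simp
  qed
  \<comment> \<open>In the variable t the energy density is \<theta>^(k + 1) (1 + t) powr (- \<eta>
    - 1), see \<open>h_eq\<close>; \<eta> > 0 is exactly integrability at infinity.\<close>
  define \<eta> where "\<eta> = k * (1 - \<beta>) - \<theta> * (k + 1)"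
  have \<eta>: "\<eta> > 0" using \<theta>k unfolding \<eta>_def by simp
  define V where "V r = - ((1 + ln (1 / r)) powr \<theta> - 1)" for r :: real
  define V' where "V' r = \<theta> * (1 + ln (1 / r)) powr (\<theta> - 1) / r" for r :: real
  have pos: "1 + ln (1 / r) > 0" if "0 < r" "r < 1" for r :: real
  proof -
    have "0 < ln (1 / r)" by (rule ln_gt_zero) (use that in simp)
    then show ?thesis by linarith
  qed
  have dln: "((\<lambda>r. 1 + ln (1 / r)) has_real_derivative - (1 / r)) (at r)" if "0 < r" for r :: real
    using that by (auto intro!: derivative_eq_intros simp: field_simps power2_eq_square)
  have dV: "(V has_real_derivative V' r) (at r)" if r: "0 < r" "r < 1" for r
  proof -
    have "(V has_real_derivative - (\<theta> * (1 + ln (1 / r)) powr (\<theta> - of_nat 1) * - (1 / r) - 0)) (at r)"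
      unfolding V_def[abs_def] by (intro DERIV_minus DERIV_diff DERIV_const DERIV_fun_powr dln pos r)
    then show ?thesis by (rule DERIV_cong) (simp add: V'_def)
  qed
  have V'0: "0 \<le> V' r" if "0 < r" for r unfolding V'_def using \<theta>0 that by simp
  have cV': "continuous_on {0<..<1} V'"
  proof -
    have "1 + ln (1 / r) \<noteq> 0" if "r \<in> {0<..<1}" for r :: real using pos[of r] that by auto
    then show ?thesis unfolding V'_def[abs_def] by (auto intro!: continuous_intros)
  qed
  define h where "h r = r ^ k * V' r ^ (k + 1) * (1 + ln (1 / r)) powr (\<beta> * k)" for r
  have [measurable]: "V' \<in> borel_measurable borel" unfolding V'_def by measurable
  have h_eq: "h r = \<theta> ^ (k + 1) * ((1 + ln (1 / r)) powr (- \<eta> - 1) / r)" if r: "0 < r" "r < 1" for r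
  proof -
    define t where "t = 1 + ln (1 / r)"
    have t: "t > 0" unfolding t_def by (rule pos[OF r])
    have "r * h r = (r * V' r) ^ (k + 1) * t powr (\<beta> * k)" unfolding h_def t_def by (simp add: power_mult_distrib)
    also have "r * V' r = \<theta> * t powr (\<theta> - 1)" unfolding V'_def t_def using r by simp
    also have "(\<theta> * t powr (\<theta> - 1)) ^ (k + 1) * t powr (\<beta> * k) = \<theta> ^ (k + 1) * ((t powr (\<theta> - 1)) ^ (k + 1) * t powr (\<beta> * k))"
      by (simp add: power_mult_distrib)
    also have "(t powr (\<theta> - 1)) ^ (k + 1) = t powr ((k + 1) * (\<theta> - 1))" using t by (simp add: powr_power del: power_Suc)
    also have "t powr ((k + 1) * (\<theta> - 1)) * t powr (\<beta> * k) = t powr ((k + 1) * (\<theta> - 1) + \<beta> * k)" by (rule powr_add[symmetric])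
    also have "(k + 1) * (\<theta> - 1) + \<beta> * k = - \<eta> - 1" unfolding \<eta>_def by (simp add: algebra_simps)
    finally show ?thesis using r unfolding t_def[symmetric] by (simp add: field_simps)
  qed
  have h_fin: "(\<integral>\<^sup>+r\<in>{0<..<1}. ennreal (h r) \<partial>lborel) < \<infinity>"
  proof -
    define F where "F r = \<theta> ^ (k + 1) * ((1 + ln (1 / r)) powr (- \<eta>) / \<eta>)" for r :: real
    have "set_integrable lborel (einterval 0 1) (\<lambda>r. \<theta> ^ (k + 1) * ((1 + ln (1 / r)) powr (- \<eta> - 1) / r))"
    proof (rule interval_integral_FTC_nonneg(1)[where F = F])
      fix r :: real assume "0 < ereal r" "ereal r < 1"
      then have r: "0 < r" "r < 1" by simp_all
      have "(F has_real_derivative \<theta> ^ (k + 1) * (- \<eta> * (1 + ln (1 / r)) powr (- \<eta> - of_nat 1) * - (1 / r) / \<eta>)) (at r)"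
        unfolding F_def[abs_def] by (intro DERIV_cmult DERIV_cdivide DERIV_fun_powr dln pos r)
      then show "(F has_real_derivative \<theta> ^ (k + 1) * ((1 + ln (1 / r)) powr (- \<eta> - 1) / r)) (at r)"
        by (rule DERIV_cong) (use \<eta> in simp)
      show "isCont (\<lambda>r. \<theta> ^ (k + 1) * ((1 + ln (1 / r)) powr (- \<eta> - 1) / r)) r"
        using pos[OF r] r by (auto intro!: continuous_intros)
    next
      show "AE r in lborel. 0 < ereal r \<longrightarrow> ereal r < 1 \<longrightarrow> 0 \<le> \<theta> ^ (k + 1) * ((1 + ln (1 / r)) powr (- \<eta> - 1) / r)"
        using \<theta>0 by auto
      have "(F \<longlongrightarrow> 0) (at_right 0)"
      proof -
        have "((\<lambda>r::real. (1 + ln (1 / r)) powr (- \<eta>)) \<longlongrightarrow> 0) (at_right 0)" using \<eta> by real_asymp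
        from tendsto_mult[OF tendsto_const tendsto_divide[OF this tendsto_const[of \<eta>]], of "\<theta> ^ (k + 1)"]
        show ?thesis unfolding F_def[abs_def] using \<eta> by simp
      qed
      then show "((F \<circ> real_of_ereal) \<longlongrightarrow> 0) (at_right 0)"
        unfolding zero_ereal_def by (simp add: ereal_tendsto_simps1)
      have "isCont F 1"
        unfolding F_def[abs_def] using \<eta> by (auto intro!: continuous_intros)
      then have "(F \<longlongrightarrow> F 1) (at_left 1)" by (rule continuous_within_tendsto_compose'[OF continuous_at_imp_continuous_at_within]) (auto simp: eventually_at_filter)
      then show "((F \<circ> real_of_ereal) \<longlongrightarrow> F 1) (at_left 1)"
        unfolding one_ereal_def by (simp add: ereal_tendsto_simps1)
    qed simp
    moreover have "einterval 0 1 = {0<..<1::real}"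
      using einterval_eq(1)[of 0 1] by (simp add: zero_ereal_def one_ereal_def)
    ultimately have "set_integrable lborel {0<..<1} (\<lambda>r. \<theta> ^ (k + 1) * ((1 + ln (1 / r)) powr (- \<eta> - 1) / r))" by simp
    then have "(\<integral>\<^sup>+r. ennreal (norm (indicat_real {0<..<1} r *\<^sub>R (\<theta> ^ (k + 1) * ((1 + ln (1 / r)) powr (- \<eta> - 1) / r)))) \<partial>lborel) < \<infinity>"
      unfolding set_integrable_def integrable_iff_bounded by blast
    also have "(\<integral>\<^sup>+r. ennreal (norm (indicat_real {0<..<1} r *\<^sub>R (\<theta> ^ (k + 1) * ((1 + ln (1 / r)) powr (- \<eta> - 1) / r)))) \<partial>lborel)
       = (\<integral>\<^sup>+r\<in>{0<..<1}. ennreal (h r) \<partial>lborel)"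
      using \<theta>0 by (intro nn_integral_cong) (auto simp: indicator_def h_eq)
    finally show ?thesis .
  qed
  define \<epsilon> where "\<epsilon> m = 1 / (real m + 1)" for m
  have \<epsilon>: "0 < \<epsilon> m" for m unfolding \<epsilon>_def by simp
  have \<epsilon>0: "\<epsilon> \<longlonglongrightarrow> 0" unfolding \<epsilon>_def[abs_def] by real_asymp
  define W where "W m r = 2 * r * moser_deriv 1 \<theta> (\<epsilon> m) (r\<^sup>2)" for m r
  have [measurable]: "W m \<in> borel_measurable borel" for m
    unfolding W_def moser_deriv_def log_trunc_def by measurable
  have W: "0 \<le> W m r" "W m r \<le> V' r" if r: "0 < r" "r < 1" for m r
  proof -
    define L where "L = 1 + log_trunc (\<epsilon> m) (r\<^sup>2)"
    define q where "q = r\<^sup>2 / (r\<^sup>2 + \<epsilon> m)"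
    define t where "t = 1 + ln (1 / r)"
    have t: "t > 0" unfolding t_def by (rule pos[OF r])
    have L: "L > 0" unfolding L_def using log_trunc_nonneg[OF \<epsilon>, of "r\<^sup>2" m] r by (simp add: power_le_one)
    have r2: "r\<^sup>2 + \<epsilon> m > 0" using r \<epsilon>[of m] by (simp add: add_pos_pos)
    have q: "0 < q" "q \<le> 1" unfolding q_def using \<epsilon>[of m] r r2 by simp_all
    have rW: "r * W m r = \<theta> * (L powr (\<theta> - 1) * q)"
      using moser_slope[OF \<epsilon> r(1), of 1 \<theta> m] unfolding W_def L_def q_def by simp
    then have "0 \<le> r * W m r" using \<theta>0 q by simp
    then show "0 \<le> W m r" using r by (simp add: zero_le_mult_iff)
    \<comment> \<open>Truncation lowers L and so raises L powr (\<theta> - 1), but its slope q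
      compensates: multiplied by L powr (\<theta> - 1) and t powr (\<theta> - 1), this inequality
      becomes L powr (\<theta> - 1) q \<le> t powr (\<theta> - 1). Here t and L include the added
      1.\<close>
    have "t powr (1 - \<theta>) * q powr 1 \<le> L powr (1 - \<theta>)"
      unfolding t_def q_def L_def using \<theta>0 \<theta>1 by (intro log_trunc_slope_powr_le \<epsilon> r) auto
    then have "t powr (1 - \<theta>) * q \<le> L powr (1 - \<theta>)" using q by simp
    then have le: "t powr (1 - \<theta>) * q * (L powr (\<theta> - 1) * t powr (\<theta> - 1)) \<le> L powr (1 - \<theta>) * (L powr (\<theta> - 1) * t powr (\<theta> - 1))"
      by (rule mult_right_mono) simp
    have inv: "t powr (1 - \<theta>) * t powr (\<theta> - 1) = 1" "L powr (1 - \<theta>) * L powr (\<theta> - 1) = 1"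
      using t L by (simp_all flip: powr_add)
    have eqs: "t powr (1 - \<theta>) * q * (L powr (\<theta> - 1) * t powr (\<theta> - 1)) = t powr (1 - \<theta>) * t powr (\<theta> - 1) * (L powr (\<theta> - 1) * q)"
      "L powr (1 - \<theta>) * (L powr (\<theta> - 1) * t powr (\<theta> - 1)) = L powr (1 - \<theta>) * L powr (\<theta> - 1) * t powr (\<theta> - 1)"
      by (simp_all only: mult_ac)
    have "L powr (\<theta> - 1) * q \<le> t powr (\<theta> - 1)" using le unfolding eqs inv mult_1_left .
    then have "r * W m r \<le> r * V' r" unfolding rW V'_def t_def[symmetric] using r \<theta>0 by (simp add: mult_left_mono)
    then show "W m r \<le> V' r" using r by simp
  qed
  have Wlim: "(\<lambda>m. W m r) \<longlonglongrightarrow> V' r" if r: "0 < r" "r < 1" for r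
  proof -
    have ln2: "ln (1 / r\<^sup>2) / 2 = ln (1 / r)" using r by (simp add: ln_div ln_realpow)
    have "(\<lambda>m. log_trunc (\<epsilon> m) (r\<^sup>2)) \<longlonglongrightarrow> ln ((1 + 0) / (r\<^sup>2 + 0)) / 2"
      unfolding log_trunc_def using r by (intro tendsto_intros \<epsilon>0) auto
    then have "(\<lambda>m. log_trunc (\<epsilon> m) (r\<^sup>2)) \<longlonglongrightarrow> ln (1 / r)" using ln2 by simp
    then have "(\<lambda>m. 2 * r * (1 * \<theta> / 2 * ((1 + log_trunc (\<epsilon> m) (r\<^sup>2)) powr (\<theta> - 1) / (r\<^sup>2 + \<epsilon> m)))) \<longlonglongrightarrow>
       2 * r * (1 * \<theta> / 2 * ((1 + ln (1 / r)) powr (\<theta> - 1) / (r\<^sup>2 + 0)))"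
      using r pos[OF r] by (intro tendsto_intros \<epsilon>0) auto
    moreover have "2 * r * (1 * \<theta> / 2 * ((1 + ln (1 / r)) powr (\<theta> - 1) / (r\<^sup>2 + 0))) = V' r"
      unfolding V'_def using r by (simp add: power2_eq_square)
    ultimately show ?thesis unfolding W_def moser_deriv_def by simp
  qed
  define u :: "real ^ 'n \<Rightarrow> real" where "u x = V (norm x)" for x
  define U :: "nat \<Rightarrow> real ^ 'n \<Rightarrow> real" where "U m x = moser_fun 1 \<theta> (\<epsilon> m) (x \<bullet> x)" for m x
  have pu: "radial_profile u r = V r" if "0 \<le> r" for r
    unfolding u_def[abs_def] by (rule radial_profile_eqI[OF _ that]) simp
  have du: "(radial_profile u has_real_derivative V' r) (at r)" if r: "0 < r" "r < 1" for r
    by (rule DERIV_eq_open[OF dV[OF r], of "{0<..<1}"]) (use r pu in auto)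
  have dU: "(radial_profile (U m) has_real_derivative W m r) (at r)" if r: "0 < r" "r < 1" for m r
    unfolding U_def[abs_def] W_def by (rule moser_fun_profile[OF \<epsilon> r])
  have dom: "ennreal (r ^ k * \<bar>d\<bar> ^ (k + 1) * (1 + ln (1 / r)) powr (\<beta> * k)) * indicator {0<..<1} r \<le> ennreal (h r) * indicator {0<..<1} r"
    if "0 < r" "\<bar>d\<bar> \<le> V' r" for r d
  proof -
    have "r ^ k * \<bar>d\<bar> ^ (k + 1) * (1 + ln (1 / r)) powr (\<beta> * k) \<le> h r"
      unfolding h_def using that by (intro mult_right_mono mult_left_mono power_mono) auto
    then show ?thesis by (intro mult_right_mono ennreal_leI) auto
  qed
  have UP: "U m \<in> Phi0_rad k" for m
    unfolding U_def[abs_def] by (rule moser_fun_Phi0_rad) (use \<epsilon> \<theta>0 \<theta>1 n in auto)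
  have Ufin: "Phi_norm k w (U m) < \<infinity>" for m
  proof -
    have "Phi_energy k w (U m) \<le> (\<integral>\<^sup>+r\<in>{0<..<1}. ennreal (r ^ k * \<bar>W m r\<bar> ^ (k + 1) * (1 + ln (1 / r)) powr (\<beta> * k)) \<partial>lborel)"
      by (rule Phi_energy_le[OF n w beta(1) dU])
    also have "\<dots> \<le> (\<integral>\<^sup>+r\<in>{0<..<1}. ennreal (h r) \<partial>lborel)"
    proof (rule nn_integral_mono)
      fix r :: real
      show "ennreal (r ^ k * \<bar>W m r\<bar> ^ (k + 1) * (1 + ln (1 / r)) powr (\<beta> * k)) * indicator {0<..<1} r \<le> ennreal (h r) * indicator {0<..<1} r"
        using dom[of r "W m r"] W[of r m] by (cases "r \<in> {0<..<1}") auto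
    qed
    finally have "Phi_energy k w (U m) < \<infinity>" using h_fin by (rule le_less_trans)
    then show ?thesis unfolding Phi_norm_energy Let_def by (simp add: ennreal_mult_eq_top_iff)
  qed
  have conv: "(\<lambda>m. Phi_norm k w (\<lambda>x. U m x - u x)) \<longlonglongrightarrow> 0"
  proof (rule Phi_norm_tendsto_0I)
    \<comment> \<open>From 0 \<le> W \<le> V' follows |W - V'| \<le> V', so \<open>h\<close>
      dominates the energy densities of the differences.\<close>
    define e where "e m r = ennreal (r ^ k * \<bar>W m r - V' r\<bar> ^ (k + 1) * (1 + ln (1 / r)) powr (\<beta> * k)) * indicator {0<..<1} r" for m r
    have "(\<lambda>m. \<integral>\<^sup>+r. e m r \<partial>lborel) \<longlonglongrightarrow> (\<integral>\<^sup>+(r::real). 0 \<partial>lborel)"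
    proof (rule nn_integral_dominated_convergence[where w = "\<lambda>r. ennreal (h r) * indicator {0<..<1} r"])
      show "e m \<in> borel_measurable lborel" for m unfolding e_def[abs_def] by measurable
      show "(\<lambda>r. ennreal (h r) * indicator {0<..<1} r) \<in> borel_measurable lborel" unfolding h_def by measurable
      show "AE r in lborel. e m r \<le> ennreal (h r) * indicator {0<..<1} r" for m
      proof (rule AE_I2)
        fix r :: real
        show "e m r \<le> ennreal (h r) * indicator {0<..<1} r"
          unfolding e_def using dom[of r "W m r - V' r"] W[of r m] by (cases "r \<in> {0<..<1}") auto
      qed
      show "AE r in lborel. (\<lambda>m. e m r) \<longlonglongrightarrow> 0"
      proof (rule AE_I2)
        fix r :: real
        show "(\<lambda>m. e m r) \<longlonglongrightarrow> 0"
        proof (cases "r \<in> {0<..<1}")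
          case True
          then have r: "0 < r" "r < 1" by auto
          have "(\<lambda>m. r ^ k * \<bar>W m r - V' r\<bar> ^ (k + 1) * (1 + ln (1 / r)) powr (\<beta> * k)) \<longlonglongrightarrow>
             r ^ k * \<bar>V' r - V' r\<bar> ^ (k + 1) * (1 + ln (1 / r)) powr (\<beta> * k)"
            by (intro tendsto_intros Wlim r)
          then have "(\<lambda>m. ennreal (r ^ k * \<bar>W m r - V' r\<bar> ^ (k + 1) * (1 + ln (1 / r)) powr (\<beta> * k))) \<longlonglongrightarrow> ennreal 0"
            by (intro tendsto_ennrealI) simp
          then show ?thesis unfolding e_def using True by simp
        qed (simp add: e_def)
      qed
    qed (use h_fin in auto)
    then have e0: "(\<lambda>m. \<integral>\<^sup>+r. e m r \<partial>lborel) \<longlonglongrightarrow> 0" by simp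
    have "Phi_energy k w (\<lambda>x. U m x - u x) \<le> (\<integral>\<^sup>+r. e m r \<partial>lborel)" for m
      unfolding e_def by (rule Phi_energy_le[OF n w beta(1)]) (unfold radial_profile_diff, intro DERIV_diff dU du)
    then show "(\<lambda>m. Phi_energy k w (\<lambda>x. U m x - u x)) \<longlonglongrightarrow> 0"
      by (intro tendsto_sandwich[OF _ _ tendsto_const e0]) auto
  qed
  have "u \<in> Phi0_rad_weighted k w"
    unfolding Phi0_rad_weighted_def
  proof (intro CollectI conjI exI[of _ U] allI UP Ufin conv)
    show "radial_on (ball 0 1) u" unfolding radial_on_def u_def by simp
    show "locally_abs_continuous (radial_profile u)" by (rule locally_abs_continuous_C1[OF du cV'])
    have "((\<lambda>r. - ((1 + ln (1 / r)) powr \<theta> - 1)) \<longlongrightarrow> - ((1 + ln (1 / 1)) powr \<theta> - 1)) (at_left 1)"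
      by (intro tendsto_intros) auto
    then have "(V \<longlongrightarrow> 0) (at_left 1)" unfolding V_def[abs_def] by simp
    moreover have "\<forall>\<^sub>F r in at_left 1. V r = radial_profile u r"
      unfolding eventually_at_left_field by (intro exI[of _ 0]) (simp add: pu)
    ultimately show "(radial_profile u \<longlongrightarrow> 0) (at_left 1)" by (rule Lim_transform_eventually)
  qed
  moreover have "(\<integral>\<^sup>+x\<in>ball 0 1. ennreal (exp (\<bar>u x\<bar> powr \<gamma>)) \<partial>lborel) = \<infinity>"
  proof (rule ccontr)
    define I where "I = (\<integral>\<^sup>+x\<in>ball 0 1. ennreal (exp (\<bar>u x\<bar> powr \<gamma>)) \<partial>lborel)"
    assume "\<not> ?thesis"
    then obtain b where b: "I = ennreal b" "0 \<le> b" unfolding I_def[symmetric] by (cases I) auto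
    define v where "v = unit_ball_vol (real n)"
    have v: "v > 0" unfolding v_def by simp
    have "filterlim (\<lambda>T::real. ((1 + T) powr \<theta> - 1) powr \<gamma> - real n * T) at_top at_top"
      by (rule power_exponent_limit[OF \<theta>0 \<theta>\<gamma> \<gamma>0(2) n0])
    then have "\<forall>\<^sub>F T in at_top. ln ((b + 1) / v) \<le> ((1 + T) powr \<theta> - 1) powr \<gamma> - real n * T" unfolding filterlim_at_top by blast
    moreover have "\<forall>\<^sub>F T in at_top. (0::real) \<le> T" by (rule eventually_ge_at_top)
    ultimately have "\<forall>\<^sub>F T in at_top. ln ((b + 1) / v) \<le> ((1 + T) powr \<theta> - 1) powr \<gamma> - real n * T \<and> 0 \<le> T" by (rule eventually_conj)
    then obtain T where T: "ln ((b + 1) / v) \<le> ((1 + T) powr \<theta> - 1) powr \<gamma> - real n * T" "0 \<le> T"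
      unfolding eventually_at_top_linorder by blast
    \<comment> \<open>On the ball of radius exp (- T) the variable t is at least T. Its volume costs
      exp (- n T), and T was chosen so that the product is still at least b + 1.\<close>
    have "ennreal (unit_ball_vol CARD('n) * exp (- T) ^ CARD('n) * exp (((1 + T) powr \<theta> - 1) powr \<gamma>)) \<le> I"
      unfolding I_def
    proof (rule ball_exp_integral_ge)
      fix x :: "real ^ 'n" assume x: "x \<noteq> 0" "norm x < exp (- T)"
      then have "ln (norm x) < - T" by (metis exp_gt_zero ln_exp ln_less_cancel_iff zero_less_norm_iff)
      then have "T \<le> ln (1 / norm x)" using x by (simp add: ln_div)
      then have "(1 + T) powr \<theta> \<le> (1 + ln (1 / norm x)) powr \<theta>" using T(2) \<theta>0 by (intro powr_mono2) auto
      moreover have "1 \<le> (1 + T) powr \<theta>" using T(2) \<theta>0 by (simp add: ge_one_powr_ge_zero)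
      ultimately have "(1 + T) powr \<theta> - 1 \<le> \<bar>u x\<bar>" "0 \<le> (1 + T) powr \<theta> - 1" unfolding u_def V_def by auto
      then show "((1 + T) powr \<theta> - 1) powr \<gamma> \<le> \<bar>u x\<bar> powr \<gamma>" using \<gamma>0 by (intro powr_mono2) auto
    qed (use T in auto)
    moreover have "b + 1 \<le> unit_ball_vol CARD('n) * exp (- T) ^ CARD('n) * exp (((1 + T) powr \<theta> - 1) powr \<gamma>)"
    proof -
      have "b + 1 = v * exp (ln ((b + 1) / v))" using b v by simp
      also have "\<dots> \<le> v * exp (((1 + T) powr \<theta> - 1) powr \<gamma> - real n * T)" using T(1) v by simp
      also have "\<dots> = v * exp (- T) ^ n * exp (((1 + T) powr \<theta> - 1) powr \<gamma>)"
        by (simp add: exp_diff exp_minus field_simps flip: exp_of_nat_mult)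
      finally show ?thesis unfolding v_def n(1) .
    qed
    ultimately have "ennreal (b + 1) \<le> ennreal b" unfolding b(1) using ennreal_leI order_trans by blast
    then show False using b(2) by (simp add: ennreal_le_iff)
  qed
  ultimately show ?thesis by blast
qed

theorem theorem1p1:
  fixes n k :: nat and \<beta> \<gamma>\<^sub>0 \<alpha>\<^sub>0 :: real and w :: "real \<Rightarrow> real"
  assumes n_def: "n = CARD('n::finite)"
    and n_ge: "n \<ge> 2" and n_even: "even n" and k_def: "k = n div 2"
    and beta: "0 \<le> \<beta>" "\<beta> < 1"
    and w: "w = weight0 n \<beta> \<or> w = weight1 n \<beta>"
    and gamma_def: "\<gamma>\<^sub>0 = (real n + 2) / (real n * (1 - \<beta>))"
    and alpha_def: "\<alpha>\<^sub>0 = real n * (norm_const TYPE('n) k powr (2 / real n) * (1 - \<beta>)) powr (1 / (1 - \<beta>))"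
  shows "(\<forall>\<gamma>::real. \<gamma> > 0 \<longrightarrow>
            ((\<forall>u \<in> (Phi0_rad_weighted k w :: (real ^ 'n \<Rightarrow> real) set).
                (\<integral>\<^sup>+x\<in>ball 0 1. ennreal (exp (\<bar>u x\<bar> powr \<gamma>)) \<partial>lborel) < \<infinity>)
             \<longleftrightarrow> \<gamma> \<le> \<gamma>\<^sub>0))
       \<and> (\<forall>\<alpha>::real.
            ((SUP u \<in> {u \<in> (Phi0_rad_weighted k w :: (real ^ 'n \<Rightarrow> real) set). Phi_norm k w u \<le> 1}.
                (\<integral>\<^sup>+x\<in>ball 0 1. ennreal (exp (\<alpha> * \<bar>u x\<bar> powr \<gamma>\<^sub>0)) \<partial>lborel)) < \<infinity>
             \<longleftrightarrow> \<alpha> \<le> \<alpha>\<^sub>0))"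
proof -
  have n: "n = CARD('n)" "n = 2 * k" and k: "k \<ge> 1" using n_def n_ge n_even k_def by auto
  have gamma: "\<gamma>\<^sub>0 = (real k + 1) / (real k * (1 - \<beta>))"
  proof -
    have "real n + 2 = 2 * (real k + 1)" "real n * (1 - \<beta>) = 2 * (real k * (1 - \<beta>))" using n(2) by simp_all
    then show ?thesis unfolding gamma_def by (simp only: mult_divide_mult_cancel_left_if) simp
  qed
  have alpha: "\<alpha>\<^sub>0 = real n * (norm_const TYPE('n) k powr (1 / real k) * (1 - \<beta>)) powr (1 / (1 - \<beta>))"
    unfolding alpha_def using n(2) by simp
  have "(\<forall>u \<in> (Phi0_rad_weighted k w :: (real ^ 'n \<Rightarrow> real) set).
          (\<integral>\<^sup>+x\<in>ball 0 1. ennreal (exp (\<bar>u x\<bar> powr \<gamma>)) \<partial>lborel) < \<infinity>) \<longleftrightarrow> \<gamma> \<le> \<gamma>\<^sub>0" if "\<gamma> > 0" for \<gamma>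
  proof
    assume fin: "\<forall>u \<in> (Phi0_rad_weighted k w :: (real ^ 'n \<Rightarrow> real) set).
          (\<integral>\<^sup>+x\<in>ball 0 1. ennreal (exp (\<bar>u x\<bar> powr \<gamma>)) \<partial>lborel) < \<infinity>"
    show "\<gamma> \<le> \<gamma>\<^sub>0"
    proof (rule ccontr)
      assume "\<not> \<gamma> \<le> \<gamma>\<^sub>0"
      then obtain u :: "real ^ 'n \<Rightarrow> real" where "u \<in> Phi0_rad_weighted k w"
        "(\<integral>\<^sup>+x\<in>ball 0 1. ennreal (exp (\<bar>u x\<bar> powr \<gamma>)) \<partial>lborel) = \<infinity>"
        using supercritical_exp_integral_infinite[OF n k beta w gamma, of \<gamma>] by auto
      then show False using fin by fastforce
    qed
  next
    assume "\<gamma> \<le> \<gamma>\<^sub>0"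
    then show "\<forall>u \<in> (Phi0_rad_weighted k w :: (real ^ 'n \<Rightarrow> real) set).
          (\<integral>\<^sup>+x\<in>ball 0 1. ennreal (exp (\<bar>u x\<bar> powr \<gamma>)) \<partial>lborel) < \<infinity>"
      using exp_integral_finite[OF n k beta w gamma \<open>\<gamma> > 0\<close>] by blast
  qed
  moreover have "(SUP u \<in> {u \<in> (Phi0_rad_weighted k w :: (real ^ 'n \<Rightarrow> real) set). Phi_norm k w u \<le> 1}.
      (\<integral>\<^sup>+x\<in>ball 0 1. ennreal (exp (\<alpha> * \<bar>u x\<bar> powr \<gamma>\<^sub>0)) \<partial>lborel)) < \<infinity> \<longleftrightarrow> \<alpha> \<le> \<alpha>\<^sub>0" (is "?S < \<infinity> \<longleftrightarrow> _") for \<alpha>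
  proof
    assume fin: "?S < \<infinity>"
    show "\<alpha> \<le> \<alpha>\<^sub>0"
    proof (rule ccontr)
      assume "\<not> \<alpha> \<le> \<alpha>\<^sub>0"
      then have lt: "\<alpha>\<^sub>0 < \<alpha>" by simp
      obtain b where b: "?S = ennreal b" "0 \<le> b" using fin by (cases ?S) auto
      obtain u :: "real ^ 'n \<Rightarrow> real" where u: "u \<in> Phi0_rad_weighted k w" "Phi_norm k w u \<le> 1"
        "ennreal (b + 1) \<le> (\<integral>\<^sup>+x\<in>ball 0 1. ennreal (exp (\<alpha> * \<bar>u x\<bar> powr \<gamma>\<^sub>0)) \<partial>lborel)"
        using supercritical_sup_infinite[OF n k beta w gamma alpha lt, of "b + 1"] by blast
      have "(\<integral>\<^sup>+x\<in>ball 0 1. ennreal (exp (\<alpha> * \<bar>u x\<bar> powr \<gamma>\<^sub>0)) \<partial>lborel) \<le> ?S"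
        using u by (intro SUP_upper) auto
      then have "ennreal (b + 1) \<le> ennreal b" using u(3) unfolding b(1) by (rule order_trans[rotated])
      then show False using b(2) by (simp add: ennreal_le_iff)
    qed
  next
    assume le: "\<alpha> \<le> \<alpha>\<^sub>0"
    \<comment> \<open>The integrand increases with \<alpha>, negative values included, so the bound
      at \<open>\<alpha>\<^sub>0\<close> suffices; it is applied with \<delta> = 1.\<close>
    have "?S \<le> ennreal (Moser_const k \<beta>)"
    proof (rule SUP_least)
      fix u :: "real ^ 'n \<Rightarrow> real" assume u: "u \<in> {u \<in> Phi0_rad_weighted k w. Phi_norm k w u \<le> 1}"
      have "(\<integral>\<^sup>+x\<in>ball 0 1. ennreal (exp (\<alpha> * \<bar>u x\<bar> powr \<gamma>\<^sub>0)) \<partial>lborel) \<le>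
         (\<integral>\<^sup>+x\<in>ball 0 1. ennreal (exp (\<alpha>\<^sub>0 * \<bar>u x / 1\<bar> powr \<gamma>\<^sub>0)) \<partial>lborel)"
        using le by (intro nn_integral_mono mult_right_mono ennreal_leI) (auto intro: mult_right_mono)
      also have "\<dots> \<le> ennreal (Moser_const k \<beta>)"
        using u by (intro critical_exp_integral_bound_Phi_norm[OF n k beta w gamma alpha]) (auto simp: Phi0_rad_weighted_def)
      finally show "(\<integral>\<^sup>+x\<in>ball 0 1. ennreal (exp (\<alpha> * \<bar>u x\<bar> powr \<gamma>\<^sub>0)) \<partial>lborel) \<le> ennreal (Moser_const k \<beta>)" .
    qed
    also have "\<dots> < \<infinity>" by simp
    finally show "?S < \<infinity>" .
  qed
  ultimately show ?thesis by blast
qed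

end
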